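(* The Maximum Reachability Trip Temporalisation problem (mrtt) is NP-hard, even when restricted to inputs $(D,\mathbb{T})$ that are symmetric trip networks with $D$ strongly connected.
   Context: A weighted multidigraph $D=(V,E)$ has a finite node set $V$ and a finite multiset $E$ of edges $(u,v,w)$ with weight $w>0$. A trip network is a pair $(D,\mathbb{T})$ where $\mathbb{T}$ is a finite multiset of walks in $D$ (trips); every node and edge of $D$ appears in some trip. A temporalisation $\tau$ assigns a real starting time $\tau(T)$ to each trip. For a trip $T=e_1,\dots,e_k$ with $e_i=(u_i,v_i,w_i)$, it induces temporal edges $(u_i,v_i,\tau(T)+\sum_{j<i}w_j,w_i)$ (tail, head, starting time, travel time). The induced temporal graph $G[D,\mathbb{T},\tau]$ has node set $V$ and all temporal edges induced by all trips. A temporal path from $u$ to $v$ is a sequence of consecutive temporal edges from $u$ to $v$ in which each edge's starting time is at least the arrival time (starting time plus travel time) of the previous one; $v$ is $\tau$-reachable from $u$ if such a path exists (every node reaches itself). The $\tau$-reachability is the number of ordered pairs $(u,v)$ with $v$ $\tau$-reachable from $u$; mrtt asks for a temporalisation maximising it. A trip network is symmetric if its trips can be grouped into disjoint pairs $(T,\overline{T})$ of two distinct members of $\mathbb{T}$ where $\overline{T}$ is the reverse of $T$, visiting the same nodes as $T$ in reverse order. *)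

theory Defs
  imports
    "HOL-Computational_Algebra.Polynomial"
    "Graph_Theory.Arc_Walk"
    "Graph_Theory.Digraph_Component"
begin

section \<open>Trip networks and temporalisations\<close>

text \<open>
  Multisets whose members have to be told apart (parallel edges of equal weight, repeated
  trips with different starting times) are represented as indexed families: edges are the
  arcs of a multidigraph, trips are the entries of a list of nonempty arc walks.
\<close>

definition trip_nodes :: "('v, 'e) pre_digraph \<Rightarrow> 'e list \<Rightarrow> 'v list" where
  "trip_nodes D T = pre_digraph.awalk_verts D (tail D (hd T)) T"

locale trip_network = fin_digraph D
  for D :: "('v, 'e) pre_digraph" +
  fixes weight :: "'e \<Rightarrow> real" and trips :: "'e list list"
  assumes weight_pos: "e \<in> arcs D \<Longrightarrow> weight e > 0"
    and trip_nonempty: "T \<in> set trips \<Longrightarrow> T \<noteq> []"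
    and trip_walk: "T \<in> set trips \<Longrightarrow> \<exists>u v. awalk u T v"
    and arc_in_trip: "e \<in> arcs D \<Longrightarrow> \<exists>T \<in> set trips. e \<in> set T"
    and node_in_trip: "v \<in> verts D \<Longrightarrow> \<exists>T \<in> set trips. v \<in> set (trip_nodes D T)"

text \<open>The grouping into pairs is a fixed-point-free involution \<open>\<pi>\<close> on the trip indices.\<close>

definition symmetric_trips :: "('v, 'e) pre_digraph \<Rightarrow> 'e list list \<Rightarrow> bool" where
  "symmetric_trips D trips \<longleftrightarrow>
    (\<exists>\<pi>. \<forall>i < length trips.
       \<pi> i < length trips \<and> \<pi> i \<noteq> i \<and> \<pi> (\<pi> i) = i \<and>
       trip_nodes D (trips ! \<pi> i) = rev (trip_nodes D (trips ! i)))"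

type_synonym 'v temporal_edge = "'v \<times> 'v \<times> real \<times> real"

text \<open>
  Temporal edges are (tail, head, starting time, travel time). A temporalisation assigns
  \<open>\<tau> j\<close> to the \<open>j\<close>-th trip. Multiplicities of temporal edges do not matter for reachability.
\<close>

definition temporal_edges ::
  "('v, 'e) pre_digraph \<Rightarrow> ('e \<Rightarrow> real) \<Rightarrow> 'e list list \<Rightarrow> (nat \<Rightarrow> real) \<Rightarrow> 'v temporal_edge set"
where
  "temporal_edges D weight trips \<tau> =
    {(tail D (trips ! j ! i), head D (trips ! j ! i),
      \<tau> j + (\<Sum>l<i. weight (trips ! j ! l)), weight (trips ! j ! i)) |
     j i. j < length trips \<and> i < length (trips ! j)}"

fun temporal_path :: "'v temporal_edge set \<Rightarrow> 'v \<Rightarrow> 'v temporal_edge list \<Rightarrow> 'v \<Rightarrow> bool" where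
  "temporal_path E u [] v \<longleftrightarrow> u = v"
| "temporal_path E u ((a, b, t, d) # es) v \<longleftrightarrow>
     (a, b, t, d) \<in> E \<and> a = u \<and>
     (case es of [] \<Rightarrow> True | (a', b', t', d') # _ \<Rightarrow> t + d \<le> t') \<and>
     temporal_path E b es v"

definition reachability ::
  "('v, 'e) pre_digraph \<Rightarrow> ('e \<Rightarrow> real) \<Rightarrow> 'e list list \<Rightarrow> (nat \<Rightarrow> real) \<Rightarrow> nat"
where
  "reachability D weight trips \<tau> =
    card {(u, v). u \<in> verts D \<and> v \<in> verts D \<and>
                  (\<exists>p. temporal_path (temporal_edges D weight trips \<tau>) u p v)}"


section \<open>Polynomial time and NP-hardness\<close>

text \<open>
  Deterministic multi-tape Turing machines with two-way infinite tapes. States are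
  \<open>0, \<dots>, states\<close>, where \<open>0\<close> is initial and \<open>states\<close> is the halting state; symbols are
  the numbers below \<open>symbols\<close>, where \<open>0\<close> is the blank and \<open>1\<close>, \<open>2\<close> represent the two bits.
  The input is on tape 0 and the output on tape 1.
\<close>

datatype move = Left | Stay | Right

record tm =
  tapes :: nat
  symbols :: nat
  states :: nat
  delta :: "nat \<Rightarrow> nat list \<Rightarrow> nat \<times> (nat \<times> move) list"

definition wf_tm :: "tm \<Rightarrow> bool" where
  "wf_tm M \<longleftrightarrow> tapes M \<ge> 2 \<and> symbols M \<ge> 3 \<and>
    (\<forall>q < states M. \<forall>rs. length rs = tapes M \<and> set rs \<subseteq> {..<symbols M} \<longrightarrow>
       (case delta M q rs of (q', acts) \<Rightarrow>
          q' \<le> states M \<and> length acts = tapes M \<and> fst ` set acts \<subseteq> {..<symbols M}))"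

text \<open>A tape is its contents together with the head position.\<close>

type_synonym tape = "(int \<Rightarrow> nat) \<times> int"
type_synonym config = "nat \<times> tape list"

fun move_head :: "move \<Rightarrow> int \<Rightarrow> int" where
  "move_head Left h = h - 1"
| "move_head Stay h = h"
| "move_head Right h = h + 1"

fun act_tape :: "nat \<times> move \<Rightarrow> tape \<Rightarrow> tape" where
  "act_tape (s, m) (c, h) = (c(h := s), move_head m h)"

definition tm_step :: "tm \<Rightarrow> config \<Rightarrow> config" where
  "tm_step M cfg = (case cfg of (q, ts) \<Rightarrow>
    if q < states M
    then (case delta M q (map (\<lambda>(c, h). c h) ts) of (q', acts) \<Rightarrow> (q', map2 act_tape acts ts))
    else (q, ts))"

definition string_contents :: "bool list \<Rightarrow> int \<Rightarrow> nat" where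
  "string_contents x i =
    (if 0 \<le> i \<and> i < int (length x) then (if x ! nat i then 2 else 1) else 0)"

definition initial_config :: "tm \<Rightarrow> bool list \<Rightarrow> config" where
  "initial_config M x = (0, (string_contents x, 0) # replicate (tapes M - 1) (\<lambda>_. 0, 0))"

definition halts_with_output :: "tm \<Rightarrow> config \<Rightarrow> bool list \<Rightarrow> bool" where
  "halts_with_output M cfg y \<longleftrightarrow>
    fst cfg = states M \<and> fst (snd cfg ! 1) = string_contents y"

definition polytime :: "(bool list \<Rightarrow> bool list) \<Rightarrow> bool" where
  "polytime f \<longleftrightarrow>
    (\<exists>M (p :: nat poly). wf_tm M \<and>
      (\<forall>x. \<exists>n \<le> poly p (length x).
         halts_with_output M ((tm_step M ^^ n) (initial_config M x)) (f x)))"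

text \<open>A prefix-free list encoding: every entry is announced by a \<open>True\<close>, the end by a \<open>False\<close>.\<close>

definition encode_list :: "('a \<Rightarrow> bool list) \<Rightarrow> 'a list \<Rightarrow> bool list" where
  "encode_list f xs = concat (map (\<lambda>x. True # f x) xs) @ [False]"

definition encode_pair :: "bool list \<Rightarrow> bool list \<Rightarrow> bool list" where
  "encode_pair x y = encode_list (\<lambda>b. [b]) x @ y"

definition in_NP :: "bool list set \<Rightarrow> bool" where
  "in_NP L \<longleftrightarrow>
    (\<exists>R (p :: nat poly). polytime (\<lambda>z. [R z]) \<and>
      (\<forall>x. x \<in> L \<longleftrightarrow> (\<exists>y. length y \<le> poly p (length x) \<and> R (encode_pair x y))))"

text \<open>
  NP-hardness, under polynomial-time many-one reductions, of the problem of deciding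
  membership in \<open>A\<close> for inputs that are guaranteed to belong to \<open>I\<close>.
\<close>

definition NP_hard_on :: "bool list set \<Rightarrow> bool list set \<Rightarrow> bool" where
  "NP_hard_on I A \<longleftrightarrow>
    (\<forall>L. in_NP L \<longrightarrow>
      (\<exists>f. polytime f \<and> (\<forall>x. f x \<in> I \<and> (x \<in> L \<longleftrightarrow> f x \<in> A))))"


section \<open>Maximum Reachability Trip Temporalisation as a computational problem\<close>

text \<open>
  An instance consists of the number of nodes, the list of edges (tail, head, weight) and the
  list of trips, each given by the sequence of its edge indices. All numbers are in binary.
\<close>

type_synonym mrtt_input = "nat \<times> (nat \<times> nat \<times> rat) list \<times> nat list list"

fun input_digraph :: "mrtt_input \<Rightarrow> (nat, nat) pre_digraph" where
  "input_digraph (n, es, Ts) =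
    \<lparr>verts = {..<n}, arcs = {..<length es},
     tail = (\<lambda>i. fst (es ! i)), head = (\<lambda>i. fst (snd (es ! i)))\<rparr>"

fun input_weight :: "mrtt_input \<Rightarrow> nat \<Rightarrow> real" where
  "input_weight (n, es, Ts) i = of_rat (snd (snd (es ! i)))"

fun input_trips :: "mrtt_input \<Rightarrow> nat list list" where
  "input_trips (n, es, Ts) = Ts"

definition valid_input :: "mrtt_input \<Rightarrow> bool" where
  "valid_input N \<longleftrightarrow> trip_network (input_digraph N) (input_weight N) (input_trips N)"

fun binary :: "nat \<Rightarrow> bool list" where
  "binary n = (if n = 0 then [] else odd n # binary (n div 2))"

declare binary.simps [simp del]

definition encode_nat :: "nat \<Rightarrow> bool list" where
  "encode_nat n = encode_list (\<lambda>b. [b]) (binary n)"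

text \<open>Only used for positive rationals, represented by their reduced fraction.\<close>

definition encode_rat :: "rat \<Rightarrow> bool list" where
  "encode_rat r = (case quotient_of r of (a, b) \<Rightarrow> encode_nat (nat a) @ encode_nat (nat b))"

fun encode_mrtt :: "mrtt_input \<Rightarrow> nat \<Rightarrow> bool list" where
  "encode_mrtt (n, es, Ts) k =
    encode_nat n @
    encode_list (\<lambda>(u, v, w). encode_nat u @ encode_nat v @ encode_rat w) es @
    encode_list (encode_list encode_nat) Ts @
    encode_nat k"

text \<open>The decision version: can reachability at least \<open>k\<close> be achieved?\<close>

definition MRTT :: "bool list set" where
  "MRTT = {encode_mrtt N k | N k. valid_input N \<and>
    (\<exists>\<tau>. reachability (input_digraph N) (input_weight N) (input_trips N) \<tau> \<ge> k)}"

definition symmetric_strongly_connected_inputs :: "bool list set" where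
  "symmetric_strongly_connected_inputs =
    {encode_mrtt N k | N k. valid_input N \<and>
      symmetric_trips (input_digraph N) (input_trips N) \<and>
      strongly_connected (input_digraph N)}"


subsection \<open>The encoding is injective\<close>

definition prefix_code :: "('a \<Rightarrow> bool list) \<Rightarrow> 'a set \<Rightarrow> bool" where
  "prefix_code f A \<longleftrightarrow>
    (\<forall>a \<in> A. \<forall>b \<in> A. \<forall>xs ys. f a @ xs = f b @ ys \<longrightarrow> a = b \<and> xs = ys)"

lemma prefix_codeD:
  "\<lbrakk>prefix_code f A; f a @ xs = f b @ ys; a \<in> A; b \<in> A\<rbrakk> \<Longrightarrow> a = b \<and> xs = ys"
  unfolding prefix_code_def by blast

lemma prefix_code_list:
  assumes "prefix_code f A"
  shows "prefix_code (encode_list f) (lists A)"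
proof -
  have "as = bs \<and> xs = ys"
    if "encode_list f as @ xs = encode_list f bs @ ys" "set as \<subseteq> A" "set bs \<subseteq> A" for as bs xs ys
    using that
  proof (induction as arbitrary: bs)
    case Nil
    then show ?case by (cases bs) (auto simp: encode_list_def)
  next
    case (Cons a as)
    then obtain b bs' where bs: "bs = b # bs'"
      by (cases bs) (auto simp: encode_list_def)
    have "f a @ (encode_list f as @ xs) = f b @ (encode_list f bs' @ ys)"
      using Cons.prems(1) by (simp add: bs encode_list_def)
    from prefix_codeD[OF assms this] Cons.prems(2,3)
    have "a = b \<and> encode_list f as @ xs = encode_list f bs' @ ys"
      by (simp add: bs)
    with Cons.IH[of bs'] Cons.prems(2,3) show ?case by (simp add: bs)
  qed
  then show ?thesis unfolding prefix_code_def lists_eq_set by blast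
qed

lemma binary_inj: "binary m = binary n \<Longrightarrow> m = n"
proof (induction m arbitrary: n rule: less_induct)
  case (less m)
  show ?case
  proof (cases "m = 0 \<or> n = 0")
    case True
    with less.prems show ?thesis
      by (auto simp: binary.simps[of m] binary.simps[of n] split: if_splits)
  next
    case False
    with less.prems have eq: "odd m = odd n" "binary (m div 2) = binary (n div 2)"
      by (auto simp: binary.simps[of m] binary.simps[of n])
    from less.IH[OF _ eq(2)] False have "m div 2 = n div 2" by simp
    with eq(1) show ?thesis by presburger
  qed
qed

lemma prefix_code_nat: "prefix_code encode_nat UNIV"
proof -
  have *: "prefix_code (encode_list (\<lambda>b. [b])) (lists UNIV)"
    by (rule prefix_code_list) (simp add: prefix_code_def)
  have "m = n \<and> xs = ys" if eq: "encode_nat m @ xs = encode_nat n @ ys" for m n xs ys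
    using prefix_codeD[OF * eq[unfolded encode_nat_def]] binary_inj[of m n] by simp
  then show ?thesis unfolding prefix_code_def by blast
qed

lemma prefix_code_rat: "prefix_code encode_rat {0<..}"
  unfolding prefix_code_def
proof (intro ballI allI impI)
  fix r s :: rat and xs ys
  assume pos: "r \<in> {0<..}" "s \<in> {0<..}" and eq: "encode_rat r @ xs = encode_rat s @ ys"
  obtain a b c d where q: "quotient_of r = (a, b)" "quotient_of s = (c, d)"
    by (metis surj_pair)
  have "b > 0" "d > 0" using q by (auto dest: quotient_of_denom_pos)
  moreover from this pos have "a > 0" "c > 0"
    using quotient_of_div[OF q(1)] quotient_of_div[OF q(2)] by (auto simp: zero_less_divide_iff)
  moreover have "nat a = nat c \<and> nat b = nat d \<and> xs = ys"
    using eq by (auto simp: encode_rat_def q dest!: prefix_codeD[OF prefix_code_nat])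
  ultimately have "quotient_of r = quotient_of s" "xs = ys" by (auto simp: q)
  then show "r = s \<and> xs = ys" by (auto dest: quotient_of_inject)
qed

lemma valid_input_weight_pos:
  assumes "valid_input (n, es, Ts)" "(u, v, w) \<in> set es"
  shows "w > 0"
proof -
  interpret trip_network "input_digraph (n, es, Ts)" "input_weight (n, es, Ts)"
    "input_trips (n, es, Ts)"
    using assms(1) by (simp only: valid_input_def)
  obtain i where "i < length es" "es ! i = (u, v, w)"
    using assms(2) by (auto simp: in_set_conv_nth)
  with weight_pos[of i] show ?thesis by simp
qed

lemma encode_mrtt_inj:
  assumes "valid_input N" "valid_input N'" "encode_mrtt N k = encode_mrtt N' k'"
  shows "N = N' \<and> k = k'"
proof -
  obtain n es Ts n' es' Ts' where N: "N = (n, es, Ts)" "N' = (n', es', Ts')"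
    by (metis surj_pair)
  let ?e = "\<lambda>(u, v, w). encode_nat u @ encode_nat v @ encode_rat w"
  have "prefix_code ?e (UNIV \<times> UNIV \<times> {0<..})"
    unfolding prefix_code_def
    by (auto dest!: prefix_codeD[OF prefix_code_nat] prefix_codeD[OF prefix_code_rat])
  from prefix_code_list[OF this]
  have E: "prefix_code (encode_list ?e) (lists (UNIV \<times> UNIV \<times> {0<..}))" .
  have T: "prefix_code (encode_list (encode_list encode_nat)) (lists (lists UNIV))"
    by (intro prefix_code_list prefix_code_nat)
  have pos: "es \<in> lists (UNIV \<times> UNIV \<times> {0<..})" "es' \<in> lists (UNIV \<times> UNIV \<times> {0<..})"
    using assms(1,2) by (auto simp: N lists_eq_set dest: valid_input_weight_pos)
  note eq = assms(3)[unfolded N encode_mrtt.simps]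
  from prefix_codeD[OF prefix_code_nat eq]
  have 1: "n = n'" and eq1: "encode_list ?e es @ encode_list (encode_list encode_nat) Ts @ encode_nat k
      = encode_list ?e es' @ encode_list (encode_list encode_nat) Ts' @ encode_nat k'" by auto
  from prefix_codeD[OF E eq1 pos]
  have 2: "es = es'" and eq2: "encode_list (encode_list encode_nat) Ts @ encode_nat k
      = encode_list (encode_list encode_nat) Ts' @ encode_nat k'" by auto
  from prefix_codeD[OF T eq2] have 3: "Ts = Ts'" and eq3: "encode_nat k @ [] = encode_nat k' @ []"
    by auto
  from prefix_codeD[OF prefix_code_nat eq3] have "k = k'" by auto
  with 1 2 3 show ?thesis by (simp add: N)
qed

end

theory Submission
  imports Defs
begin

text \<open>
  The reduction passes through CNF-SAT. The run of a verifier is described by Horn clauses about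
  the tape contents relative to the heads, where only the certificate is a real choice. The clauses
  form finitely many families indexed by loop counters, so that the network of the formula is
  written down by nested loops; a multi-tape machine executes them in polynomial time with its head
  positions as counters.

  In the network every clause has a trip that runs from a block of \<open>L\<close> nodes over a first hub to a
  second such block, and one more trip runs likewise over a second hub. Missing a single pair of
  blocks costs more than all pairs with a node outside the blocks, so the bound is met iff all
  blocks are connected. The distances between blocks force all trips to pass their hubs at the same
  time and journeys between blocks to be shortest paths without waiting. The first block of a
  clause reaches the second block of the last trip only over the gadget of one of its literals. The
  single trip through the gadget of a variable can serve the entrance of the positive or that of
  the negative occurrences at the required time, but not both. Conversely, a satisfying assignment
  yields a schedule in which all trips and their reverses meet at the hubs at time 0.
\<close>

section \<open>Counter machines\<close>

text \<open>The geometry behind the network: each port lies at distance 2 from its hub.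
  \<open>Hub 0\<close> touches every port except the right port of trip \<open>m\<close>;
  \<open>Hub 1\<close> touches both ports of trip \<open>m\<close> and the right ports of the
  clauses. So the only ports of different trips without a common hub are the left port of a clause
  and the right port of trip \<open>m\<close>, and the literal paths join exactly these, with the
  same total length 2 + 1 + 1 = 4. Symmetry is the obstacle: every reverse trip has its own starting
  time and might open a shortcut. The lower bounds therefore let reverse trips and single edges
  depart whenever they like; the gadget edge of weight 2 in the middle keeps rides against the
  direction too slow even then. Conversely, mirroring all times at 0 turns a schedule of the trips
  into one of the reverse trips. On the machine side, counters in unary suffice because every number
  that is handled is polynomial in the input length. The Horn form of the clauses means that an
  assignment only has to contain the actual run, so no clause forbids a second symbol in a
  cell.\<close>

datatype cond = NonZero nat | InputNot nat
datatype prim = Inc nat | Dec nat | Out bool | InputLeft | InputRight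
datatype com = Done | Prim prim | Then com com | Choose cond com com | Loop cond com

type_synonym cstate = "int \<times> (nat \<Rightarrow> nat) \<times> bool list"

fun holds :: "bool list \<Rightarrow> cstate \<Rightarrow> cond \<Rightarrow> bool" where
  "holds x (h, \<rho>, out) (NonZero r) \<longleftrightarrow> \<rho> r \<noteq> 0"
| "holds x (h, \<rho>, out) (InputNot s) \<longleftrightarrow> string_contents x h \<noteq> s"

fun perform :: "prim \<Rightarrow> cstate \<Rightarrow> cstate" where
  "perform (Inc r) (h, \<rho>, out) = (h, \<rho>(r := \<rho> r + 1), out)"
| "perform (Dec r) (h, \<rho>, out) = (h, \<rho>(r := \<rho> r - 1), out)"
| "perform (Out b) (h, \<rho>, out) = (h, \<rho>, out @ [b])"
| "perform InputLeft (h, \<rho>, out) = (h - 1, \<rho>, out)"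
| "perform InputRight (h, \<rho>, out) = (h + 1, \<rho>, out)"

text \<open>The primitive is returned rather than performed, so the next command depends only on the
  outcomes of tests. This is all that a finite control can see.\<close>

fun advance :: "(cond \<Rightarrow> bool) \<Rightarrow> com \<Rightarrow> com \<times> prim option" where
  "advance v Done = (Done, None)"
| "advance v (Prim a) = (Done, Some a)"
| "advance v (Then c1 c2) =
    (if c1 = Done then (c2, None) else case advance v c1 of (c1', a) \<Rightarrow> (Then c1' c2, a))"
| "advance v (Choose b c1 c2) = (if v b then c1 else c2, None)"
| "advance v (Loop b c) = (if v b then Then c (Loop b c) else Done, None)"

definition cstep :: "bool list \<Rightarrow> com \<times> cstate \<Rightarrow> com \<times> cstate" where
  "cstep x cs = (case cs of (c, s) \<Rightarrow> case advance (holds x s) c of (c', a) \<Rightarrow>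
     (c', case a of None \<Rightarrow> s | Some p \<Rightarrow> perform p s))"

text \<open>\<open>Done\<close> is a fixed point of \<open>cstep\<close>, so \<open>n\<close> acts
  as an upper bound on the running time and costs may be rounded up.\<close>

definition runs :: "bool list \<Rightarrow> com \<Rightarrow> cstate \<Rightarrow> nat \<Rightarrow> cstate \<Rightarrow> bool" where
  "runs x c s n s' \<longleftrightarrow> (cstep x ^^ n) (c, s) = (Done, s')"

lemma cstep_Done [simp]: "cstep x (Done, s) = (Done, s)"
  by (simp add: cstep_def)

lemma cstep_pow_Done [simp]: "(cstep x ^^ n) (Done, s) = (Done, s)"
  by (induction n) auto

lemma runs_mono: "runs x c s n s' \<Longrightarrow> n \<le> n' \<Longrightarrow> runs x c s n' s'"
  using funpow_add[of "n' - n" n "cstep x"] by (auto simp: runs_def)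

lemma runs_Suc: "cstep x (c, s) = (c', s'') \<Longrightarrow> runs x c' s'' n s' \<Longrightarrow> runs x c s (Suc n) s'"
  unfolding runs_def by (simp add: funpow_Suc_right del: funpow.simps)

lemma runs_Done: "runs x Done s n s"
  by (simp add: runs_def)

lemma runs_Prim: "runs x (Prim a) s 1 (perform a s)"
  by (simp add: runs_def cstep_def)

lemma runs_Then:
  assumes "runs x c1 s n1 s1" "runs x c2 s1 n2 s2"
  shows "runs x (Then c1 c2) s (n1 + n2 + 1) s2"
  using assms(1)
proof (induction n1 arbitrary: c1 s)
  case 0
  then have "c1 = Done" "s = s1" by (auto simp: runs_def)
  then show ?case using assms(2)
    by (auto intro!: runs_Suc[of _ _ _ c2 s1] simp: cstep_def)
next
  case (Suc n1)
  show ?case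
  proof (cases "c1 = Done")
    case True
    then have "s = s1" using Suc.prems by (auto simp: runs_def)
    then have "runs x (Then c1 c2) s (Suc n2) s2" using assms(2) True
      by (auto intro!: runs_Suc[of _ _ _ c2 s1] simp: cstep_def)
    then show ?thesis by (rule runs_mono) simp
  next
    case False
    obtain c1' s' where st: "cstep x (c1, s) = (c1', s')" by (metis surj_pair)
    then have "runs x c1' s' n1 s1"
      using Suc.prems by (simp add: runs_def funpow_Suc_right del: funpow.simps)
    from Suc.IH[OF this] have "runs x (Then c1' c2) s' (n1 + n2 + 1) s2" .
    moreover have "cstep x (Then c1 c2, s) = (Then c1' c2, s')"
      using False st by (auto simp: cstep_def split: prod.splits)
    ultimately show ?thesis using runs_Suc by fastforce
  qed
qed

lemma runs_Choose:
  assumes "runs x (if holds x s b then c1 else c2) s n s'"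
  shows "runs x (Choose b c1 c2) s (n + 1) s'"
  using runs_Suc[OF _ assms, of "Choose b c1 c2" s] by (simp add: cstep_def)

lemma runs_Loop_false: "\<not> holds x s b \<Longrightarrow> runs x (Loop b c) s 1 s"
  by (simp add: runs_def cstep_def)

lemma runs_Loop_true:
  assumes "holds x s b" "runs x c s n1 s1" "runs x (Loop b c) s1 n2 s2"
  shows "runs x (Loop b c) s (n1 + n2 + 2) s2"
  using runs_Suc[OF _ runs_Then[OF assms(2,3)], of "Loop b c" s] assms(1) by (simp add: cstep_def)

text \<open>Each iteration pays 2 beyond its body: the successful test and the step that drops the
  finished body. The final 1 is the failing test.\<close>

lemma runs_Loop:
  assumes "\<And>i. i < n \<Longrightarrow> holds x (S i) b" "\<not> holds x (S n) b"
    and "\<And>i. i < n \<Longrightarrow> runs x c (S i) T (S (Suc i))"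
  shows "runs x (Loop b c) (S 0) (n * (T + 2) + 1) (S n)"
  using assms
proof (induction n arbitrary: S)
  case 0
  then show ?case using runs_Loop_false[of x "S 0" b c] by simp
next
  case (Suc n)
  have "runs x (Loop b c) (S (Suc 0)) (n * (T + 2) + 1) (S (Suc n))"
    using Suc.IH[of "\<lambda>i. S (Suc i)"] Suc.prems by simp
  from runs_Loop_true[OF _ _ this] Suc.prems
  have "runs x (Loop b c) (S 0) (T + (n * (T + 2) + 1) + 2) (S (Suc n))" by blast
  then show ?case by (rule runs_mono) simp
qed

section \<open>Commands as Turing machines\<close>

text \<open>The commands still to be executed serve as the states of the Turing machine.\<close>

fun resid :: "com \<Rightarrow> com set" where
  "resid Done = {Done}"
| "resid (Prim a) = {Prim a, Done}"
| "resid (Then c1 c2) = (\<lambda>c. Then c c2) ` resid c1 \<union> resid c2"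
| "resid (Choose b c1 c2) = {Choose b c1 c2} \<union> resid c1 \<union> resid c2"
| "resid (Loop b c) = {Loop b c, Done} \<union> (\<lambda>c'. Then c' (Loop b c)) ` resid c"

lemma finite_resid: "finite (resid c)"
  by (induction c) auto

lemma resid_refl: "c \<in> resid c"
  by (induction c) auto

text \<open>Closure under steps is what makes the finite set \<open>resid c\<close> usable as a
  state set. An unrolled loop stays inside because its second component is always the loop
  itself.\<close>

lemma resid_advance: "c' \<in> resid c \<Longrightarrow> fst (advance v c') \<in> resid c"
proof (induction c arbitrary: c')
  case (Then c1 c2)
  then show ?case
    by (fastforce simp: resid_refl split: prod.splits)
next
  case (Loop b c)
  then show ?case
    by (fastforce simp: resid_refl split: prod.splits if_splits)
qed (auto simp: resid_refl)

fun cond_below :: "nat \<Rightarrow> cond \<Rightarrow> bool" where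
  "cond_below K (NonZero r) \<longleftrightarrow> r < K"
| "cond_below K (InputNot s) \<longleftrightarrow> True"

fun prim_below :: "nat \<Rightarrow> prim \<Rightarrow> bool" where
  "prim_below K (Inc r) \<longleftrightarrow> r < K"
| "prim_below K (Dec r) \<longleftrightarrow> r < K"
| "prim_below K _ \<longleftrightarrow> True"

fun com_below :: "nat \<Rightarrow> com \<Rightarrow> bool" where
  "com_below K Done \<longleftrightarrow> True"
| "com_below K (Prim a) \<longleftrightarrow> prim_below K a"
| "com_below K (Then c1 c2) \<longleftrightarrow> com_below K c1 \<and> com_below K c2"
| "com_below K (Choose b c1 c2) \<longleftrightarrow> cond_below K b \<and> com_below K c1 \<and> com_below K c2"
| "com_below K (Loop b c) \<longleftrightarrow> cond_below K b \<and> com_below K c"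

lemma com_below_mono: "com_below K c \<Longrightarrow> K \<le> K' \<Longrightarrow> com_below K' c"
proof (induction c)
  case (Prim a) then show ?case by (cases a) auto
next
  case (Choose b c1 c2) then show ?case by (cases b) auto
next
  case (Loop b c) then show ?case by (cases b) auto
qed auto

lemma ex_cond_below: "\<exists>K. \<forall>K' \<ge> K. cond_below K' b"
proof (cases b)
  case (NonZero r)
  then show ?thesis by (auto intro!: exI[of _ "Suc r"])
qed auto

lemma ex_com_below: "\<exists>K. com_below K c"
proof (induction c)
  case (Prim a)
  have "\<exists>K. prim_below K a" by (cases a) auto
  then show ?case by simp
next
  case (Then c1 c2)
  then obtain K1 K2 where K: "com_below K1 c1" "com_below K2 c2" by auto
  show ?case
    by (rule exI[of _ "K1 + K2"]) (auto intro: com_below_mono[OF K(1)] com_below_mono[OF K(2)])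
next
  case (Choose b c1 c2)
  then obtain K1 K2 where K: "com_below K1 c1" "com_below K2 c2" by auto
  obtain K3 where K3: "\<And>K. K \<ge> K3 \<Longrightarrow> cond_below K b"
    using ex_cond_below by blast
  show ?case
    by (rule exI[of _ "K1 + K2 + K3"]) (auto intro: K3 com_below_mono[OF K(1)]
        com_below_mono[OF K(2)])
next
  case (Loop b c)
  then obtain K1 where K: "com_below K1 c" by auto
  obtain K3 where K3: "\<And>K. K \<ge> K3 \<Longrightarrow> cond_below K b"
    using ex_cond_below by blast
  show ?case
    by (rule exI[of _ "K1 + K3"]) (auto intro: K3 com_below_mono[OF K(1)])
qed auto

lemma com_below_resid: "com_below K c \<Longrightarrow> c' \<in> resid c \<Longrightarrow> com_below K c'"
proof (induction c arbitrary: c')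
  case (Then c1 c2)
  have "com_below K d" if "d \<in> resid c1" for d by (rule Then.IH(1))
      (use Then.prems that in simp_all)
  moreover have "com_below K d" if "d \<in> resid c2" for d
    by (rule Then.IH(2)) (use Then.prems that in simp_all)
  ultimately show ?case using Then.prems by auto
next
  case (Choose b c1 c2)
  have "com_below K d" if "d \<in> resid c1" for d
    by (rule Choose.IH(1)) (use Choose.prems that in simp_all)
  moreover have "com_below K d" if "d \<in> resid c2" for d
    by (rule Choose.IH(2)) (use Choose.prems that in simp_all)
  ultimately show ?case using Choose.prems by auto
next
  case (Loop b c)
  have "com_below K d" if "d \<in> resid c" for d by (rule Loop.IH) (use Loop.prems that in simp_all)
  then show ?case using Loop.prems by auto
qed auto

lemma advance_cong:
  "(\<And>b. cond_below K b \<Longrightarrow> v b = v' b) \<Longrightarrow> com_below K c \<Longrightarrow> advance v c = advance v' c"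
  by (induction c) (auto split: prod.splits)

lemma advance_prim_below: "com_below K c \<Longrightarrow> advance v c = (c', Some a) \<Longrightarrow> prim_below K a"
  by (induction c arbitrary: c') (auto split: prod.splits if_splits)

fun read_cond :: "nat list \<Rightarrow> cond \<Rightarrow> bool" where
  "read_cond rs (NonZero r) \<longleftrightarrow> rs ! (r + 2) \<noteq> 1"
| "read_cond rs (InputNot s) \<longleftrightarrow> rs ! 0 \<noteq> s"

text \<open>Counting never changes a tape: the scanned symbol is rewritten and only the head moves.
  On the mark, \<open>Dec\<close> stays put, which agrees with truncated subtraction. The shift by 2
  skips the input and output tapes.\<close>

fun prim_acts :: "prim option \<Rightarrow> nat list \<Rightarrow> (nat \<times> move) list" where
  "prim_acts None rs = map (\<lambda>s. (s, Stay)) rs"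
| "prim_acts (Some (Inc r)) rs = (map (\<lambda>s. (s, Stay)) rs)[r + 2 := (rs ! (r + 2), Right)]"
| "prim_acts (Some (Dec r)) rs =
    (map (\<lambda>s. (s, Stay)) rs)[r + 2 := (rs ! (r + 2), if rs ! (r + 2) = 1 then Stay else Left)]"
| "prim_acts (Some (Out b)) rs = (map (\<lambda>s. (s, Stay)) rs)[1 := (if b then 2 else 1, Right)]"
| "prim_acts (Some InputLeft) rs = (map (\<lambda>s. (s, Stay)) rs)[0 := (rs ! 0, Left)]"
| "prim_acts (Some InputRight) rs = (map (\<lambda>s. (s, Stay)) rs)[0 := (rs ! 0, Right)]"

text \<open>A register is the head position on a tape whose only nonblank cell is a mark at position 0.\<close>

definition reg_tape :: "nat \<Rightarrow> tape" where
  "reg_tape v = (\<lambda>i. if i = 0 then 1 else 0, int v)"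

fun state_tapes :: "nat \<Rightarrow> bool list \<Rightarrow> cstate \<Rightarrow> tape list" where
  "state_tapes K x (h, \<rho>, out) =
    (string_contents x, h) # (string_contents out, int (length out)) #
    map (\<lambda>r. reg_tape (\<rho> r)) [0..<K]"

definition readings :: "tape list \<Rightarrow> nat list" where
  "readings ts = map (\<lambda>(c, h). c h) ts"

lemma readings_state_tapes:
  "readings (state_tapes K x (h, \<rho>, out)) =
    string_contents x h # 0 # map (\<lambda>r. if \<rho> r = 0 then 1 else 0) [0..<K]"
  by (simp add: readings_def reg_tape_def string_contents_def)

lemma string_contents_snoc:
  "(string_contents out)(int (length out) := if b then 2 else 1) = string_contents (out @ [b])"
  by (rule ext) (auto simp: string_contents_def nth_append)

lemma map_Stay_eq:
  "map2 act_tape (map (\<lambda>s. (s, Stay)) (readings ts)) ts = ts"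
  by (induction ts) (auto simp: readings_def)

lemma map2_act_update:
  assumes "n < length ts"
  shows "map2 act_tape ((map (\<lambda>s. (s, Stay)) (readings ts))[n := a]) ts =
      ts[n := act_tape a (ts ! n)]"
proof -
  have "map2 act_tape ((map (\<lambda>s. (s, Stay)) (readings ts))[n := a]) ts
     = (map2 act_tape (map (\<lambda>s. (s, Stay)) (readings ts)) ts)[n := act_tape a (ts ! n)]"
    using assms by (intro nth_equalityI) (auto simp: readings_def nth_list_update)
  then show ?thesis by (simp only: map_Stay_eq)
qed

lemma prim_acts_correct:
  assumes "case a of None \<Rightarrow> True | Some p \<Rightarrow> prim_below K p"
  shows "map2 act_tape (prim_acts a (readings (state_tapes K x s))) (state_tapes K x s) =
    state_tapes K x (case a of None \<Rightarrow> s | Some p \<Rightarrow> perform p s)"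
proof (cases a)
  case None
  then show ?thesis by (simp add: map_Stay_eq)
next
  case (Some p)
  obtain h \<rho> out where s: "s = (h, \<rho>, out)" by (metis surj_pair)
  let ?ts = "state_tapes K x s"
  have upd: "?ts[r + 2 := reg_tape v] = state_tapes K x (h, \<rho>(r := v), out)" if "r < K" for r v
    using that by (auto simp: s intro!: nth_equalityI simp: nth_list_update)
  have len: "length ?ts = K + 2" by (simp add: s)
  have nth: "?ts ! (r + 2) = reg_tape (\<rho> r)" if "r < K" for r using that by (simp add: s)
  have rd: "readings ?ts ! (r + 2) = (if \<rho> r = 0 then 1 else 0)" if "r < K" for r
    using that by (simp add: s readings_state_tapes del: state_tapes.simps)
  show ?thesis
  proof (cases p)
    case (Inc r)
    then have r: "r < K" using assms Some by simp
    have "act_tape (if \<rho> r = 0 then 1 else 0, Right) (reg_tape (\<rho> r)) = reg_tape (\<rho> r + 1)"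
      by (auto simp: reg_tape_def)
    then show ?thesis using r
      by (simp add: Some Inc map2_act_update len nth rd upd del: state_tapes.simps One_nat_def
          add_2_eq_Suc')
        (simp add: s)
  next
    case (Dec r)
    then have r: "r < K" using assms Some by simp
    have "act_tape (if \<rho> r = 0 then 1 else 0, if \<rho> r = 0 then Stay else Left) (reg_tape (\<rho> r)) =
      reg_tape (\<rho> r - 1)"
      by (auto simp: reg_tape_def fun_eq_iff)
    moreover have "((if \<rho> r = 0 then 1 else 0) = (1::nat)) = (\<rho> r = 0)" by simp
    ultimately show ?thesis using r
      by (simp only: Some Dec map2_act_update len nth rd upd prim_acts.simps option.case) 
        (simp add: map2_act_update len nth upd s del: state_tapes.simps add_2_eq_Suc')
  next
    case (Out b)
    show ?thesis
      by (simp add: Some Out map2_act_update len del: state_tapes.simps)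
        (use string_contents_snoc[of out True] string_contents_snoc[of out False] in \<open>auto simp: s\<close>)
  next
    case InputLeft
    show ?thesis
      by (simp add: Some InputLeft map2_act_update len del: state_tapes.simps)
        (simp add: s readings_state_tapes del: state_tapes.simps, simp)
  next
    case InputRight
    show ?thesis
      by (simp add: Some InputRight map2_act_update len del: state_tapes.simps)
        (simp add: s readings_state_tapes del: state_tapes.simps, simp)
  qed
qed

lemma prim_acts_wf:
  assumes "length rs = K + 2" "set rs \<subseteq> {..<3}"
  shows "length (prim_acts a rs) = K + 2" "fst ` set (prim_acts a rs) \<subseteq> {..<3}"
proof -
  show "length (prim_acts a rs) = K + 2"
    using assms(1) by (cases "(a, rs)" rule: prim_acts.cases) auto
  have base: "fst ` set (map (\<lambda>s. (s, m)) rs) \<subseteq> {..<3}" for m :: move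
    using assms(2) by auto
  have upd: "fst ` set ((map (\<lambda>s. (s, Stay)) rs)[n := b]) \<subseteq> {..<3}"
    if "n < length rs \<Longrightarrow> fst b < 3" for n b
  proof (cases "n < length rs")
    case True
    then show ?thesis using base[of Stay] that set_update_subset_insert[of
        "map (\<lambda>s. (s, Stay)) rs" n b]
      by fastforce
  next
    case False
    then show ?thesis using base[of Stay] by (simp add: list_update_beyond)
  qed
  have nth: "rs ! n < 3" if "n < length rs" for n
    using assms(2) that nth_mem by blast
  show "fst ` set (prim_acts a rs) \<subseteq> {..<3}"
    by (cases "(a, rs)" rule: prim_acts.cases)
       (use base nth in \<open>auto simp del: set_map add_2_eq_Suc' intro!: upd\<close>)
qed

text \<open>One machine step simulates one command step. A single step in front writes the marks at
  cell 0 of the blank register tapes; hence the bound \<open>p + 1\<close>.\<close>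

theorem polytime_com:
  assumes "\<And>x. \<exists>h \<rho>. runs x c (0, \<lambda>_. 0, []) (poly p (length x)) (h, \<rho>, f x)"
  shows "polytime f"
proof -
  obtain K where K: "com_below K c" using ex_com_below by blast
  have "finite (resid c - {Done})" by (simp add: finite_resid)
  then obtain g n where g: "bij_betw g (resid c - {Done}) {0..<n::nat}"
    using ex_bij_betw_finite_nat by blast
  \<comment> \<open>State 0 stays free for the initialising step, the running commands take the
    numbers from 1 to \<open>n\<close>, and \<open>Done\<close> becomes the halting state
    \<open>n + 1\<close>.\<close>
  define enc where "enc = (\<lambda>c'. if c' = Done then n + 1 else g c' + 1)"
  define dec where "dec = (\<lambda>q. inv_into (resid c - {Done}) g (q - 1))"
  define M where "M = \<lparr>tapes = K + 2, symbols = 3, states = n + 1,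
    delta = (\<lambda>q rs. if q = 0 then (enc c, (rs ! 0, Stay) # (rs ! 1, Stay) # replicate K (1, Stay))
       else (case advance (read_cond rs) (dec q) of (c', a) \<Rightarrow> (enc c', prim_acts a rs)))\<rparr>"
  have g_lt: "g c' < n" if "c' \<in> resid c" "c' \<noteq> Done" for c'
    using g that by (auto simp: bij_betw_def)
  have dec_enc: "dec (enc c') = c'" if "c' \<in> resid c" "c' \<noteq> Done" for c'
    using that g by (auto simp: dec_def enc_def bij_betw_def intro!: inv_into_f_f)
  have dec_in: "dec q \<in> resid c" if "q \<noteq> 0" "q < n + 1" for q
  proof -
    have "q - 1 \<in> g ` (resid c - {Done})" using g that by (auto simp: bij_betw_def)
    from inv_into_into[OF this] show ?thesis by (simp add: dec_def)
  qed
  have enc_le: "enc c' \<le> n + 1" if "c' \<in> resid c" for c'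
    using g_lt[OF that] by (auto simp: enc_def)
  have sim: "tm_step M (enc c', state_tapes K x s) =
      (case cstep x (c', s) of (c'', s') \<Rightarrow> (enc c'', state_tapes K x s'))"
    if c': "c' \<in> resid c" for c' x s
  proof (cases "c' = Done")
    case True
    then show ?thesis by (simp add: tm_step_def M_def enc_def)
  next
    case False
    obtain h \<rho> out where s: "s = (h, \<rho>, out)" by (metis surj_pair)
    let ?rs = "readings (state_tapes K x s)"
    obtain c'' a where adv: "advance (holds x s) c' = (c'', a)" by (metis surj_pair)
    have below: "com_below K c'" using com_below_resid[OF K c'] .
    have "read_cond ?rs b = holds x s b" if "cond_below K b" for b
      using that by (cases b) (auto simp: s readings_state_tapes simp del: state_tapes.simps)
    then have adv': "advance (read_cond ?rs) c' = (c'', a)"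
      using advance_cong[OF _ below] adv by metis
    have "case a of None \<Rightarrow> True | Some p \<Rightarrow> prim_below K p"
      using advance_prim_below[OF below] adv by (auto split: option.splits)
    note acts = prim_acts_correct[OF this]
    have q: "enc c' < n + 1" "enc c' \<noteq> 0" using g_lt[OF c' False] False by (auto simp: enc_def)
    have "delta M (enc c') ?rs = (enc c'', prim_acts a ?rs)"
      using q adv' dec_enc[OF c' False] by (simp add: M_def)
    then have "tm_step M (enc c', state_tapes K x s) =
        (enc c'', map2 act_tape (prim_acts a ?rs) (state_tapes K x s))"
      using q by (simp add: tm_step_def readings_def M_def del: state_tapes.simps)
    then show ?thesis using adv by (simp add: acts cstep_def)
  qed
  have simn: "(tm_step M ^^ k) (enc c, state_tapes K x s) =
      (case (cstep x ^^ k) (c, s) of (c'', s') \<Rightarrow> (enc c'', state_tapes K x s')) \<and>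
      fst ((cstep x ^^ k) (c, s)) \<in> resid c" for k x s
  proof (induction k)
    case 0
    then show ?case by (simp add: resid_refl)
  next
    case (Suc k)
    obtain c' s' where cs: "(cstep x ^^ k) (c, s) = (c', s')" by (metis surj_pair)
    with Suc have "c' \<in> resid c" by simp
    obtain c'' s'' where st: "cstep x (c', s') = (c'', s'')" by (metis surj_pair)
    then have "c'' \<in> resid c"
      using resid_advance[OF \<open>c' \<in> resid c\<close>, of "holds x s'"] by
          (auto simp: cstep_def split: prod.splits)
    with sim[OF \<open>c' \<in> resid c\<close>, of x s'] Suc cs st show ?case
      by (simp del: state_tapes.simps)
  qed
  have init: "tm_step M (initial_config M x) = (enc c, state_tapes K x (0, \<lambda>_. 0, []))" for x
  proof -
    have "string_contents [] = (\<lambda>_. 0)" by (auto simp: string_contents_def)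
    moreover have "(\<lambda>_. 0)(0 := 1) = (\<lambda>i::int. if i = 0 then 1::nat else 0)" by auto
    moreover have "map2 act_tape (replicate K (1, Stay)) (replicate K (\<lambda>_. 0, 0)) =
       map (\<lambda>r. reg_tape 0) [0..<K]"
      by (rule nth_equalityI) (auto simp: reg_tape_def)
    ultimately show ?thesis
      by (auto simp: tm_step_def initial_config_def M_def)
  qed
  have wf: "wf_tm M"
    unfolding wf_tm_def
  proof (intro conjI allI impI)
    fix q rs assume q: "q < states M" and rs: "length rs = tapes M \<and> set rs \<subseteq> {..<symbols M}"
    show "case delta M q rs of (q', acts) \<Rightarrow>
       q' \<le> states M \<and> length acts = tapes M \<and> fst ` set acts \<subseteq> {..<symbols M}"
    proof (cases "q = 0")
      case True
      have "rs ! i < 3" if "i < 2" for i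
        using rs that nth_mem[of i rs] by (auto simp: M_def subset_iff)
      then have "rs ! 0 < 3" "rs ! 1 < 3" by simp_all
      then show ?thesis using True enc_le[OF resid_refl] by (auto simp: M_def)
    next
      case False
      then have "dec q \<in> resid c" using q dec_in by (simp add: M_def)
      from enc_le[OF resid_advance[OF this, of "read_cond rs"]]
      show ?thesis using False prim_acts_wf[of rs K] rs
        by (auto simp: M_def split: prod.splits)
    qed
  qed (auto simp: M_def)
  show ?thesis
    unfolding polytime_def
  proof (intro exI[of _ M] exI[of _ "p + 1"] conjI allI wf)
    fix x
    obtain h \<rho> where r: "runs x c (0, \<lambda>_. 0, []) (poly p (length x)) (h, \<rho>, f x)" using assms
        by blast
    let ?n = "poly p (length x)"
    have "(tm_step M ^^ Suc ?n) (initial_config M x) =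
        (tm_step M ^^ ?n) (enc c, state_tapes K x (0, \<lambda>_. 0, []))"
      by (simp add: funpow_Suc_right init del: funpow.simps state_tapes.simps)
    also have "\<dots> = (enc Done, state_tapes K x (h, \<rho>, f x))"
      using simn[of ?n x "(0, \<lambda>_. 0, [])"] r by (simp add: runs_def del: state_tapes.simps)
    finally show "\<exists>n\<le>poly (p + 1) (length x).
        halts_with_output M ((tm_step M ^^ n) (initial_config M x)) (f x)"
      by (intro exI[of _ "Suc ?n"]) (simp add: halts_with_output_def M_def enc_def)
  qed
qed

section \<open>A loop language with polynomial running time\<close>

text \<open>\<open>Bit\<close> yields the tape symbol 0, 1 or 2 instead of a truth value, so that an
  expression can name the symbol of an input cell in the tableau.\<close>

datatype exp = Const nat | Var nat | Len | Bit exp | Add exp exp | Sub exp exp | Mul exp exp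

primrec eval :: "bool list \<Rightarrow> (nat \<Rightarrow> nat) \<Rightarrow> exp \<Rightarrow> nat" where
  "eval x \<rho> (Const n) = n"
| "eval x \<rho> (Var k) = \<rho> k"
| "eval x \<rho> Len = length x"
| "eval x \<rho> (Bit e) = string_contents x (int (eval x \<rho> e))"
| "eval x \<rho> (Add e1 e2) = eval x \<rho> e1 + eval x \<rho> e2"
| "eval x \<rho> (Sub e1 e2) = eval x \<rho> e1 - eval x \<rho> e2"
| "eval x \<rho> (Mul e1 e2) = eval x \<rho> e1 * eval x \<rho> e2"

primrec exp_below :: "nat \<Rightarrow> exp \<Rightarrow> bool" where
  "exp_below d (Const n) \<longleftrightarrow> True"
| "exp_below d (Var k) \<longleftrightarrow> k < d"
| "exp_below d Len \<longleftrightarrow> True"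
| "exp_below d (Bit e) \<longleftrightarrow> exp_below d e"
| "exp_below d (Add e1 e2) \<longleftrightarrow> exp_below d e1 \<and> exp_below d e2"
| "exp_below d (Sub e1 e2) \<longleftrightarrow> exp_below d e1 \<and> exp_below d e2"
| "exp_below d (Mul e1 e2) \<longleftrightarrow> exp_below d e1 \<and> exp_below d e2"

lemma eval_cong: "exp_below d e \<Longrightarrow> (\<And>k. k < d \<Longrightarrow> \<rho> k = \<rho>' k) \<Longrightarrow> eval x \<rho> e = eval x \<rho>' e"
  by (induction e) auto

section \<open>Register arithmetic with time bounds\<close>

lemma runs_Prim1: "perform a s = s' \<Longrightarrow> runs x (Prim a) s 1 s'"
  using runs_Prim by blast

lemma runs_Prim2: "perform b (perform a s) = s' \<Longrightarrow> runs x (Then (Prim a) (Prim b)) s 3 s'"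
  using runs_Then[OF runs_Prim[of x a s] runs_Prim[of x b "perform a s"]] by
      (simp add: numeral_3_eq_3)

text \<open>The decrement precedes the body, so the body sees the number of iterations that remain
  after the current one.\<close>

definition drain :: "nat \<Rightarrow> com \<Rightarrow> com" where
  "drain r c = Loop (NonZero r) (Then (Prim (Dec r)) c)"

lemma runs_drain:
  assumes "\<And>i. i < n \<Longrightarrow>
      runs x c (h i, (\<rho> i)(r := n - Suc i), out i) T (h (Suc i), \<rho> (Suc i), out (Suc i))"
    and "\<And>i. i \<le> n \<Longrightarrow> \<rho> i r = n - i"
  shows "runs x (drain r c) (h 0, \<rho> 0, out 0) (n * (T + 4) + 1) (h n, \<rho> n, out n)"
proof -
  let ?S = "\<lambda>i. (h i, \<rho> i, out i)"
  have "runs x (Then (Prim (Dec r)) c) (?S i) (T + 2) (?S (Suc i))" if "i < n" for i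
  proof -
    have "perform (Dec r) (?S i) = (h i, (\<rho> i)(r := n - Suc i), out i)"
      using assms(2)[of i] that by simp
    from runs_Then[OF runs_Prim assms(1)[OF that, folded this]] show ?thesis
      by (rule runs_mono) simp
  qed
  moreover have "holds x (?S i) (NonZero r)" if "i < n" for i using assms(2)[of i] that by simp
  moreover have "\<not> holds x (?S n) (NonZero r)" using assms(2)[of n] by simp
  ultimately have "runs x (drain r c) (?S 0) (n * (T + 2 + 2) + 1) (?S n)"
    unfolding drain_def by (rule runs_Loop[of n x ?S, rotated 2])
  then show ?thesis by (rule runs_mono) (simp add: algebra_simps)
qed

lemma runs_clear: "runs x (drain r Done) (h, \<rho>, out) (\<rho> r * 4 + 1) (h, \<rho>(r := 0), out)"
  using runs_drain[of "\<rho> r" x Done "\<lambda>_. h" "\<lambda>i. \<rho>(r := \<rho> r - i)" r "\<lambda>_. out" 0]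
  by (simp add: runs_Done)

definition transfer :: "nat \<Rightarrow> nat \<Rightarrow> com" where
  "transfer r t = drain r (Prim (Inc t))"

lemma runs_transfer:
  assumes "r \<noteq> t"
  shows "runs x (transfer r t) (h, \<rho>, out) (\<rho> r * 5 + 1) (h, \<rho>(r := 0, t := \<rho> t + \<rho> r), out)"
proof -
  let ?\<rho> = "\<lambda>i. \<rho>(r := \<rho> r - i, t := \<rho> t + i)"
  have "runs x (Prim (Inc t)) (h, (?\<rho> i)(r := \<rho> r - Suc i), out) 1 (h, ?\<rho> (Suc i), out)" for i
  proof -
    have "perform (Inc t) (h, (?\<rho> i)(r := \<rho> r - Suc i), out) = (h, ?\<rho> (Suc i), out)"
      using assms by (auto simp: fun_eq_iff)
    then show ?thesis by (rule runs_Prim1)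
  qed
  from runs_drain[of "\<rho> r" x _ "\<lambda>_. h" ?\<rho> r "\<lambda>_. out" 1, OF this]
  show ?thesis using assms by (simp add: transfer_def)
qed

text \<open>Counting a register down destroys it; the second copy in \<open>u\<close> is there to
  restore it.\<close>

definition copy :: "nat \<Rightarrow> nat \<Rightarrow> nat \<Rightarrow> com" where
  "copy r t u = Then (drain r (Then (Prim (Inc t)) (Prim (Inc u)))) (transfer u r)"

lemma runs_copy:
  assumes "r \<noteq> t" "r \<noteq> u" "t \<noteq> u" "\<rho> u = 0"
  shows "runs x (copy r t u) (h, \<rho>, out) (\<rho> r * 12 + 3) (h, \<rho>(t := \<rho> t + \<rho> r), out)"
proof -
  let ?\<rho> = "\<lambda>i. \<rho>(r := \<rho> r - i, t := \<rho> t + i, u := i)"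
  have "runs x (Then (Prim (Inc t)) (Prim (Inc u))) (h, (?\<rho> i)(r := \<rho> r - Suc i), out) 3
      (h, ?\<rho> (Suc i), out)" for i
  proof -
    have "perform (Inc u) (perform (Inc t) (h, (?\<rho> i)(r := \<rho> r - Suc i), out)) =
        (h, ?\<rho> (Suc i), out)"
      using assms by (auto simp: fun_eq_iff)
    then show ?thesis by (rule runs_Prim2)
  qed
  from runs_drain[of "\<rho> r" x _ "\<lambda>_. h" ?\<rho> r "\<lambda>_. out" 3, OF this]
  have 1: "runs x (drain r (Then (Prim (Inc t)) (Prim (Inc u)))) (h, \<rho>, out) (\<rho> r * 7 + 1)
     (h, \<rho>(r := 0, t := \<rho> t + \<rho> r, u := \<rho> r), out)"
    using assms fun_upd_idem[of \<rho> u 0] by simp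
  have "\<rho>(r := 0, t := \<rho> t + \<rho> r, u := 0, r := \<rho> r) = \<rho>(t := \<rho> t + \<rho> r)"
    using assms by (auto simp: fun_eq_iff)
  with runs_transfer[of u r x h "\<rho>(r := 0, t := \<rho> t + \<rho> r, u := \<rho> r)" out]
  have 2: "runs x (transfer u r) (h, \<rho>(r := 0, t := \<rho> t + \<rho> r, u := \<rho> r), out) (\<rho> r * 5 + 1)
     (h, \<rho>(t := \<rho> t + \<rho> r), out)"
    using assms by simp
  show ?thesis unfolding copy_def
    by (rule runs_mono[OF runs_Then[OF 1 2]]) simp
qed

primrec add_const :: "nat \<Rightarrow> nat \<Rightarrow> com" where
  "add_const r 0 = Done"
| "add_const r (Suc n) = Then (Prim (Inc r)) (add_const r n)"

lemma runs_add_const: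
  "\<rho>' = \<rho>(r := \<rho> r + n) \<Longrightarrow> runs x (add_const r n) (h, \<rho>, out) (2 * n) (h, \<rho>', out)"
proof (induction n arbitrary: \<rho>)
  case 0
  then show ?case by (simp add: runs_Done)
next
  case (Suc n)
  have "runs x (Prim (Inc r)) (h, \<rho>, out) 1 (h, \<rho>(r := \<rho> r + 1), out)"
    by (rule runs_Prim1) simp
  moreover have "runs x (add_const r n) (h, \<rho>(r := \<rho> r + 1), out) (2 * n) (h, \<rho>', out)"
    using Suc.prems by (intro Suc.IH) (auto simp: fun_eq_iff)
  ultimately have "runs x (add_const r (Suc n)) (h, \<rho>, out) (1 + 2 * n + 1) (h, \<rho>', out)"
    unfolding add_const.simps by (rule runs_Then)
  then show ?case by simp
qed

definition trunc_sub :: "nat \<Rightarrow> nat \<Rightarrow> com" where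
  "trunc_sub r t = drain r (Prim (Dec t))"

lemma runs_trunc_sub:
  assumes "r \<noteq> t"
  shows "runs x (trunc_sub r t) (h, \<rho>, out) (\<rho> r * 5 + 1) (h, \<rho>(r := 0, t := \<rho> t - \<rho> r), out)"
proof -
  let ?\<rho> = "\<lambda>i. \<rho>(r := \<rho> r - i, t := \<rho> t - i)"
  have "runs x (Prim (Dec t)) (h, (?\<rho> i)(r := \<rho> r - Suc i), out) 1 (h, ?\<rho> (Suc i), out)" for i
  proof -
    have "perform (Dec t) (h, (?\<rho> i)(r := \<rho> r - Suc i), out) = (h, ?\<rho> (Suc i), out)"
      using assms by (auto simp: fun_eq_iff)
    then show ?thesis by (rule runs_Prim1)
  qed
  from runs_drain[of "\<rho> r" x _ "\<lambda>_. h" ?\<rho> r "\<lambda>_. out" 1, OF this]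
  show ?thesis using assms by (simp add: trunc_sub_def)
qed

definition multiply :: "nat \<Rightarrow> com" where
  "multiply d = Then (drain d (copy (d + 1) (d + 2) (d + 3)))
     (Then (drain (d + 1) Done) (transfer (d + 2) d))"

lemma runs_multiply:
  assumes "\<rho> (d + 2) = 0" "\<rho> (d + 3) = 0"
  shows "runs x (multiply d) (h, \<rho>, out) (\<rho> d * (\<rho> (d + 1) * 17 + 7) + \<rho> (d + 1) * 4 + 5)
     (h, \<rho>(d := \<rho> d * \<rho> (d + 1), d + 1 := 0), out)"
proof -
  let ?a = "\<rho> d" and ?b = "\<rho> (d + 1)"
  let ?\<rho> = "\<lambda>i. \<rho>(d := ?a - i, d + 2 := i * ?b)"
  have "runs x (copy (d + 1) (d + 2) (d + 3)) (h, (?\<rho> i)(d := ?a - Suc i), out) (?b * 12 + 3)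
      (h, ?\<rho> (Suc i), out)" for i
  proof -
    have "(?\<rho> i)(d := ?a - Suc i, d + 2 := i * ?b + ?b) = ?\<rho> (Suc i)"
      by (auto simp: fun_eq_iff)
    then show ?thesis
      using runs_copy[of "d + 1" "d + 2" "d + 3" "(?\<rho> i)(d := ?a - Suc i)" x h out] assms by simp
  qed
  from runs_drain[of ?a x _ "\<lambda>_. h" ?\<rho> d "\<lambda>_. out", OF this]
  have 1: "runs x (drain d (copy (d + 1) (d + 2) (d + 3))) (h, \<rho>, out) (?a * (?b * 12 + 7) + 1)
      (h, ?\<rho> ?a, out)"
    using assms(1) fun_upd_triv[of \<rho> "d + 2"] by (simp add: algebra_simps)
  have 2: "runs x (drain (d + 1) Done) (h, ?\<rho> ?a, out) (?b * 4 + 1) (h, (?\<rho> ?a)(d + 1 := 0), out)"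
    using runs_clear[of x "d + 1" h "?\<rho> ?a" out] by simp
  have "(?\<rho> ?a)(d + 1 := 0, d + 2 := 0, d := ?a * ?b) = \<rho>(d := ?a * ?b, d + 1 := 0)"
    using assms(1) by (auto simp: fun_eq_iff)
  with runs_transfer[of "d + 2" d x h "(?\<rho> ?a)(d + 1 := 0)" out]
  have 3: "runs x (transfer (d + 2) d) (h, (?\<rho> ?a)(d + 1 := 0), out) (?a * ?b * 5 + 1)
     (h, \<rho>(d := ?a * ?b, d + 1 := 0), out)" by simp
  show ?thesis unfolding multiply_def
    by (rule runs_mono[OF runs_Then[OF 1 runs_Then[OF 2 3]]]) (simp add: algebra_simps)
qed

text \<open>Register \<open>d + 1\<close> records how far the head has travelled, because every
  expression expects it back at cell 0.\<close>

definition read_input :: "nat \<Rightarrow> com" where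
  "read_input d = Then (drain d (Then (Prim (Inc (d + 1))) (Prim InputRight)))
     (Then (Choose (InputNot 1) (Choose (InputNot 2) Done (add_const d 2)) (add_const d 1))
        (drain (d + 1) (Prim InputLeft)))"

lemma runs_read_input:
  assumes "\<rho> (d + 1) = 0"
  shows "runs x (read_input d) (0, \<rho>, out) (\<rho> d * 12 + 10)
     (0, \<rho>(d := string_contents x (int (\<rho> d))), out)"
proof -
  let ?a = "\<rho> d" and ?s = "string_contents x (int (\<rho> d))"
  let ?\<rho> = "\<lambda>i. \<rho>(d := ?a - i, d + 1 := i)"
  have "runs x (Then (Prim (Inc (d + 1))) (Prim InputRight)) (int i, (?\<rho> i)(d := ?a - Suc i), out) 3
     (int (Suc i), ?\<rho> (Suc i), out)" for i
  proof -
    have "perform InputRight (perform (Inc (d + 1)) (int i, (?\<rho> i)(d := ?a - Suc i), out))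
       = (int (Suc i), ?\<rho> (Suc i), out)"
      by (auto simp: fun_eq_iff)
    then show ?thesis by (rule runs_Prim2)
  qed
  from runs_drain[of ?a x _ int ?\<rho> d "\<lambda>_. out", OF this]
  have 1: "runs x (drain d (Then (Prim (Inc (d + 1))) (Prim InputRight))) (0, \<rho>, out) (?a * 7 + 1)
      (int ?a, ?\<rho> ?a, out)"
    using assms(1) fun_upd_triv[of \<rho> "d + 1"] by (simp add: algebra_simps)
  have "?s = 0 \<or> ?s = 1 \<or> ?s = 2" by (auto simp: string_contents_def)
  then have 2: "runs x (Choose (InputNot 1) (Choose (InputNot 2) Done (add_const d 2))
      (add_const d 1))
     (int ?a, ?\<rho> ?a, out) 6 (int ?a, \<rho>(d := ?s, d + 1 := ?a), out)"
  proof (elim disjE)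
    assume s: "?s = 0"
    have "runs x (Choose (InputNot 2) Done (add_const d 2)) (int ?a, ?\<rho> ?a, out) (0 + 1)
        (int ?a, ?\<rho> ?a, out)"
      by (rule runs_Choose) (simp add: s runs_Done)
    then have "runs x (Choose (InputNot 1) (Choose (InputNot 2) Done (add_const d 2))
        (add_const d 1))
     (int ?a, ?\<rho> ?a, out) (0 + 1 + 1) (int ?a, ?\<rho> ?a, out)"
      by (intro runs_Choose) (simp add: s)
    then show ?thesis using s by (auto elim: runs_mono)
  next
    assume s: "?s = 1"
    have "runs x (add_const d 1) (int ?a, ?\<rho> ?a, out) (2 * 1) (int ?a, \<rho>(d := 1, d + 1 := ?a), out)"
      by (rule runs_add_const) (auto simp: fun_eq_iff)
    then have "runs x (Choose (InputNot 1) (Choose (InputNot 2) Done (add_const d 2))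
        (add_const d 1))
     (int ?a, ?\<rho> ?a, out) (2 * 1 + 1) (int ?a, \<rho>(d := 1, d + 1 := ?a), out)"
      by (intro runs_Choose) (simp add: s del: add_const.simps One_nat_def)
    then show ?thesis using s by (auto elim: runs_mono)
  next
    assume s: "?s = 2"
    have "runs x (add_const d 2) (int ?a, ?\<rho> ?a, out) (2 * 2) (int ?a, \<rho>(d := 2, d + 1 := ?a), out)"
      by (rule runs_add_const) (auto simp: fun_eq_iff)
    then have "runs x (Choose (InputNot 2) Done (add_const d 2)) (int ?a, ?\<rho> ?a, out) (2 * 2 + 1)
        (int ?a, \<rho>(d := 2, d + 1 := ?a), out)"
      by (intro runs_Choose) (simp add: s del: add_const.simps One_nat_def)
    then have "runs x (Choose (InputNot 1) (Choose (InputNot 2) Done (add_const d 2))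
        (add_const d 1))
     (int ?a, ?\<rho> ?a, out) (2 * 2 + 1 + 1) (int ?a, \<rho>(d := 2, d + 1 := ?a), out)"
      by (intro runs_Choose) (simp add: s)
    then show ?thesis using s by (auto elim: runs_mono)
  qed
  let ?\<rho>' = "\<lambda>i. \<rho>(d := ?s, d + 1 := ?a - i)"
  have "runs x (Prim InputLeft) (int ?a - int i, (?\<rho>' i)(d + 1 := ?a - Suc i), out) 1
     (int ?a - int (Suc i), ?\<rho>' (Suc i), out)" for i
  proof -
    have "perform InputLeft (int ?a - int i, (?\<rho>' i)(d + 1 := ?a - Suc i), out) =
        (int ?a - int (Suc i), ?\<rho>' (Suc i), out)"
      by (auto simp: fun_eq_iff)
    then show ?thesis by (rule runs_Prim1)
  qed
  from runs_drain[of ?a x _ "\<lambda>i. int ?a - int i" ?\<rho>' "d + 1" "\<lambda>_. out", OF this]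
  have 3: "runs x (drain (d + 1) (Prim InputLeft)) (int ?a, \<rho>(d := ?s, d + 1 := ?a), out)
      (?a * 5 + 1)
     (0, \<rho>(d := ?s), out)"
    using assms(1) fun_upd_idem[of "\<rho>(d := ?s)" "d + 1" 0] by (simp add: algebra_simps)
  show ?thesis unfolding read_input_def
    by (rule runs_mono[OF runs_Then[OF 1 runs_Then[OF 2 3]]]) (simp add: algebra_simps)
qed

text \<open>Input bits are stored as 1 and 2, so the first blank marks the end. The way back
  recounts the length while returning the head.\<close>

definition input_length :: "nat \<Rightarrow> com" where
  "input_length d = Then (Loop (InputNot 0) (Then (Prim (Inc d)) (Prim InputRight)))
     (Then (drain d (Then (Prim (Inc (d + 1))) (Prim InputLeft))) (transfer (d + 1) d))"

lemma runs_input_length: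
  assumes "\<rho> d = 0" "\<rho> (d + 1) = 0"
  shows "runs x (input_length d) (0, \<rho>, out) (length x * 17 + 10) (0, \<rho>(d := length x), out)"
proof -
  let ?n = "length x"
  let ?S = "\<lambda>i. (int i, \<rho>(d := i), out)"
  have "runs x (Then (Prim (Inc d)) (Prim InputRight)) (?S i) 3 (?S (Suc i))" for i
    by (rule runs_Prim2) simp
  moreover have "holds x (?S i) (InputNot 0)" if "i < ?n" for i
    using that by (simp add: string_contents_def)
  moreover have "\<not> holds x (?S ?n) (InputNot 0)" by (simp add: string_contents_def)
  ultimately have "runs x (Loop (InputNot 0) (Then (Prim (Inc d)) (Prim InputRight))) (?S 0)
      (?n * (3 + 2) + 1) (?S ?n)"
    by (intro runs_Loop[of ?n x ?S]) auto
  then have 1: "runs x (Loop (InputNot 0) (Then (Prim (Inc d)) (Prim InputRight))) (0, \<rho>, out)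
      (?n * 5 + 1) (?S ?n)"
    using assms(1) fun_upd_triv[of \<rho> d] by simp
  let ?\<rho> = "\<lambda>i. \<rho>(d := ?n - i, d + 1 := i)"
  have "runs x (Then (Prim (Inc (d + 1))) (Prim InputLeft)) (int ?n - int i,
      (?\<rho> i)(d := ?n - Suc i), out) 3
     (int ?n - int (Suc i), ?\<rho> (Suc i), out)" for i
  proof -
    have "perform InputLeft (perform (Inc (d + 1)) (int ?n - int i, (?\<rho> i)(d := ?n - Suc i), out))
       = (int ?n - int (Suc i), ?\<rho> (Suc i), out)"
      by (auto simp: fun_eq_iff)
    then show ?thesis by (rule runs_Prim2)
  qed
  from runs_drain[of ?n x _ "\<lambda>i. int ?n - int i" ?\<rho> d "\<lambda>_. out", OF this]
  have 2: "runs x (drain d (Then (Prim (Inc (d + 1))) (Prim InputLeft))) (?S ?n) (?n * 7 + 1)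
     (0, ?\<rho> ?n, out)"
    using assms(2) fun_upd_idem[of "\<rho>(d := ?n)" "d + 1" 0] by (simp add: algebra_simps)
  have "(?\<rho> ?n)(d + 1 := 0, d := ?n) = \<rho>(d := ?n)" using assms(2) by (auto simp: fun_eq_iff)
  then have 3: "runs x (transfer (d + 1) d) (0, ?\<rho> ?n, out) (?n * 5 + 1) (0, \<rho>(d := ?n), out)"
    using runs_transfer[of "d + 1" d x 0 "?\<rho> ?n" out] by simp
  show ?thesis unfolding input_length_def
    by (rule runs_mono[OF runs_Then[OF 1 runs_Then[OF 2 3]]]) (simp add: algebra_simps)
qed


section \<open>Compilation of expressions\<close>

primrec cexp :: "exp \<Rightarrow> nat \<Rightarrow> com" where
  "cexp (Const n) d = add_const d n"
| "cexp (Var k) d = copy k d (d + 1)"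
| "cexp Len d = input_length d"
| "cexp (Bit e) d = Then (cexp e d) (read_input d)"
| "cexp (Add e1 e2) d = Then (cexp e1 d) (Then (cexp e2 (d + 1)) (transfer (d + 1) d))"
| "cexp (Sub e1 e2) d = Then (cexp e1 d) (Then (cexp e2 (d + 1)) (trunc_sub (d + 1) d))"
| "cexp (Mul e1 e2) d = Then (cexp e1 d) (Then (cexp e2 (d + 1)) (multiply d))"

lemma poly_mono_nat: "a \<le> b \<Longrightarrow> poly p a \<le> poly p (b::nat)"
  by (induction p) (auto intro: mult_mono add_mono)

text \<open>One polynomial bounds value and time together, since later operations count the value
  down in unary. The registers from \<open>d\<close> on are clean scratch space and are clean again
  afterwards, except for the result. Those between \<open>D\<close> and \<open>d\<close> are
  unconstrained: they hold parked intermediate results.\<close>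

definition exp_cost :: "nat \<Rightarrow> exp \<Rightarrow> nat poly \<Rightarrow> bool" where
  "exp_cost D e p \<longleftrightarrow> (\<forall>d x \<rho> N out.
    D \<le> d \<longrightarrow> length x \<le> N \<longrightarrow> (\<forall>k<D. \<rho> k \<le> N) \<longrightarrow> (\<forall>r\<ge>d. \<rho> r = 0) \<longrightarrow>
    eval x \<rho> e \<le> poly p N \<and>
    runs x (cexp e d) (0, \<rho>, out) (poly p N) (0, \<rho>(d := eval x \<rho> e), out))"

lemma exp_costI:
  assumes "\<And>d x \<rho> N out. D \<le> d \<Longrightarrow> length x \<le> N \<Longrightarrow> \<forall>k<D. \<rho> k \<le> N \<Longrightarrow> \<forall>r\<ge>d. \<rho> r = 0 \<Longrightarrow>
    eval x \<rho> e \<le> poly p N \<and>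
    runs x (cexp e d) (0, \<rho>, out) (poly p N) (0, \<rho>(d := eval x \<rho> e), out)"
  shows "exp_cost D e p"
  unfolding exp_cost_def using assms by blast

lemma exp_costD:
  assumes "exp_cost D e p" "D \<le> d" "length x \<le> N" "\<forall>k<D. \<rho> k \<le> N" "\<forall>r\<ge>d. \<rho> r = 0"
  shows "eval x \<rho> e \<le> poly p N"
    "runs x (cexp e d) (0, \<rho>, out) (poly p N) (0, \<rho>(d := eval x \<rho> e), out)"
  using assms unfolding exp_cost_def by blast+

lemma exp_cost_binary:
  assumes p: "exp_cost D e1 p" and q: "exp_cost D e2 q" and below: "exp_below D e2"
    and code: "\<And>d. cexp e d = Then (cexp e1 d) (Then (cexp e2 (d + 1)) (c d))"
    and val: "\<And>x \<rho>. eval x \<rho> e = g (eval x \<rho> e1) (eval x \<rho> e2)"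
    and op: "\<And>d x \<rho> out v w. \<forall>r\<ge>d. \<rho> r = 0 \<Longrightarrow>
      runs x (c d) (0, \<rho>(d := v, d + 1 := w), out) (t v w) (0, \<rho>(d := g v w), out)"
    and le: "\<And>N v w. v \<le> poly p N \<Longrightarrow> w \<le> poly q N \<Longrightarrow>
      g v w \<le> poly r N \<and> poly p N + (poly q N + t v w + 1) + 1 \<le> poly r N"
  shows "exp_cost D e r"
proof (rule exp_costI)
  fix d :: nat and x :: "bool list" and \<rho> :: "nat \<Rightarrow> nat" and N :: nat and out :: "bool list"
  assume H: "D \<le> d" "length x \<le> N" "\<forall>k<D. \<rho> k \<le> N" "\<forall>r\<ge>d. \<rho> r = 0"
  let ?v = "eval x \<rho> e1" and ?w = "eval x \<rho> e2"
  \<comment> \<open>The first value is parked in register \<open>d\<close>, which \<open>e2\<close>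
    cannot mention because its variables lie below \<open>D\<close>.\<close>
  have w: "eval x (\<rho>(d := ?v)) e2 = ?w" by (rule eval_cong[OF below]) (use H(1) in simp)
  note P = exp_costD[OF p H]
  have Q: "?w \<le> poly q N"
    "runs x (cexp e2 (d + 1)) (0, \<rho>(d := ?v), out) (poly q N) (0, \<rho>(d := ?v, d + 1 := ?w), out)"
    using exp_costD[OF q, of "d + 1" x N "\<rho>(d := ?v)"] H by (simp_all add: w)
  have R: "g ?v ?w \<le> poly r N" "poly p N + (poly q N + t ?v ?w + 1) + 1 \<le> poly r N"
    using le[OF P(1) Q(1)] by auto
  from runs_mono[OF runs_Then[OF P(2) runs_Then[OF Q(2) op[OF H(4)]]] R(2)]
  show "eval x \<rho> e \<le> poly r N \<and>
      runs x (cexp e d) (0, \<rho>, out) (poly r N) (0, \<rho>(d := eval x \<rho> e), out)"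
    using R(1) unfolding code val by simp
qed

lemma ex_exp_cost: "exp_below D e \<Longrightarrow> \<exists>p. exp_cost D e p"
proof (induction e)
  case (Const n)
  show ?case
  proof (intro exI[of _ "[:2 * n:]"] exp_costI)
    fix d :: nat and x :: "bool list" and \<rho> :: "nat \<Rightarrow> nat" and N :: nat and out :: "bool list"
    assume "\<forall>r\<ge>d. \<rho> r = (0::nat)"
    then have "runs x (add_const d n) (0, \<rho>, out) (2 * n) (0, \<rho>(d := n), out)"
      by (intro runs_add_const) simp
    then show "eval x \<rho> (Const n) \<le> poly [:2 * n:] N \<and> runs x (cexp (Const n) d) (0, \<rho>, out)
       (poly [:2 * n:] N) (0, \<rho>(d := eval x \<rho> (Const n)), out)" by simp
  qed
next
  case (Var k)
  show ?case
  proof (intro exI[of _ "[:3, 12:]"] exp_costI)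
    fix d :: nat and x :: "bool list" and \<rho> :: "nat \<Rightarrow> nat" and N :: nat and out :: "bool list"
    assume H: "D \<le> d" "\<forall>k<D. \<rho> k \<le> N" "\<forall>r\<ge>d. \<rho> r = (0::nat)"
    then have k: "\<rho> k \<le> N" using Var by simp
    have "runs x (copy k d (d + 1)) (0, \<rho>, out) (\<rho> k * 12 + 3) (0, \<rho>(d := \<rho> d + \<rho> k), out)"
      using H Var by (intro runs_copy) auto
    then have "runs x (copy k d (d + 1)) (0, \<rho>, out) (3 + N * 12) (0, \<rho>(d := \<rho> d + \<rho> k), out)"
      by (rule runs_mono) (use k in simp)
    then show "eval x \<rho> (Var k) \<le> poly [:3, 12:] N \<and> runs x (cexp (Var k) d) (0, \<rho>, out)
       (poly [:3, 12:] N) (0, \<rho>(d := eval x \<rho> (Var k)), out)" using k H(3) by simp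
  qed
next
  case Len
  show ?case
  proof (intro exI[of _ "[:10, 17:]"] exp_costI)
    fix d :: nat and x :: "bool list" and \<rho> :: "nat \<Rightarrow> nat" and N :: nat and out :: "bool list"
    assume H: "length (x :: bool list) \<le> N" "\<forall>r\<ge>d. \<rho> r = (0::nat)"
    have "runs x (input_length d) (0, \<rho>, out) (length x * 17 + 10) (0, \<rho>(d := length x), out)"
      using H(2) by (intro runs_input_length) auto
    then have "runs x (input_length d) (0, \<rho>, out) (10 + N * 17) (0, \<rho>(d := length x), out)"
      by (rule runs_mono) (use H(1) in simp)
    then show "eval x \<rho> Len \<le> poly [:10, 17:] N \<and> runs x (cexp Len d) (0, \<rho>, out)
       (poly [:10, 17:] N) (0, \<rho>(d := eval x \<rho> Len), out)" using H(1) by simp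
  qed
next
  case (Bit e)
  then obtain p where p: "exp_cost D e p" by auto
  let ?p = "p + smult 12 p + [:11:]"
  have *: "runs x (cexp (Bit e) d) (0, \<rho>, out) (poly ?p N) (0, \<rho>(d := eval x \<rho> (Bit e)), out)"
    if H: "D \<le> d" "length x \<le> N" "\<forall>k<D. \<rho> k \<le> N" "\<forall>r\<ge>d. \<rho> r = 0" for x d \<rho> out N
  proof -
    let ?v = "eval x \<rho> e"
    note P = exp_costD[OF p H]
    have "runs x (read_input d) (0, \<rho>(d := ?v), out) (?v * 12 + 10) (0, \<rho>(d := eval x \<rho> (Bit e)),
        out)"
      using runs_read_input[of "\<rho>(d := ?v)" d x out] H by simp
    from runs_Then[OF P(2) this] show ?thesis
      unfolding cexp.simps by (rule runs_mono) (use P in simp)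
  qed
  have **: "eval x \<rho> (Bit e) \<le> poly ?p N" for x \<rho> N
    by (auto simp: string_contents_def)
  show ?case by (intro exI[of _ ?p] exp_costI conjI * **)
next
  case (Add e1 e2)
  then obtain p q where "exp_cost D e1 p" "exp_cost D e2 q" "exp_below D e2" by
      (meson exp_below.simps)
  then have "exp_cost D (Add e1 e2) (p + smult 6 q + [:3:])"
  proof (rule exp_cost_binary[where g = "(+)" and t = "\<lambda>v w. w * 5 + 1"])
    fix d :: nat and x \<rho> out and v w :: nat assume "\<forall>r\<ge>d. \<rho> r = (0::nat)"
    then have "\<rho>(d := v, d + 1 := w, d + 1 := 0, d := v + w) = \<rho>(d := v + w)" by
        (auto simp: fun_eq_iff)
    then show "runs x (transfer (d + 1) d) (0, \<rho>(d := v, d + 1 := w), out) (w * 5 + 1)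
        (0, \<rho>(d := v + w), out)"
      using runs_transfer[of "d + 1" d x 0 "\<rho>(d := v, d + 1 := w)" out] by simp
  qed auto
  then show ?case by blast
next
  case (Sub e1 e2)
  then obtain p q where "exp_cost D e1 p" "exp_cost D e2 q" "exp_below D e2" by
      (meson exp_below.simps)
  then have "exp_cost D (Sub e1 e2) (p + smult 6 q + [:3:])"
  proof (rule exp_cost_binary[where g = "(-)" and t = "\<lambda>v w. w * 5 + 1"])
    fix d :: nat and x \<rho> out and v w :: nat assume "\<forall>r\<ge>d. \<rho> r = (0::nat)"
    then have "\<rho>(d := v, d + 1 := w, d + 1 := 0, d := v - w) = \<rho>(d := v - w)" by
        (auto simp: fun_eq_iff)
    then show "runs x (trunc_sub (d + 1) d) (0, \<rho>(d := v, d + 1 := w), out) (w * 5 + 1)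
        (0, \<rho>(d := v - w), out)"
      using runs_trunc_sub[of "d + 1" d x 0 "\<rho>(d := v, d + 1 := w)" out] by simp
  qed auto
  then show ?case by blast
next
  case (Mul e1 e2)
  then obtain p q where "exp_cost D e1 p" "exp_cost D e2 q" "exp_below D e2" by
      (meson exp_below.simps)
  then have "exp_cost D (Mul e1 e2) (p + q + p * (smult 17 q + [:7:]) + smult 4 q + [:7:])"
  proof (rule exp_cost_binary[where g = times and t = "\<lambda>v w. v * (w * 17 + 7) + w * 4 + 5"])
    fix d :: nat and x \<rho> out and v w :: nat assume z: "\<forall>r\<ge>d. \<rho> r = (0::nat)"
    then have "\<rho>(d := v, d + 1 := w, d := v * w, d + 1 := 0) = \<rho>(d := v * w)" by
        (auto simp: fun_eq_iff)
    then show "runs x (multiply d) (0, \<rho>(d := v, d + 1 := w), out) (v * (w * 17 + 7) + w * 4 + 5)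
        (0, \<rho>(d := v * w), out)"
      using runs_multiply[of "\<rho>(d := v, d + 1 := w)" d x 0 out] z by simp
  next
    fix N v w :: nat assume "v \<le> poly p N" "w \<le> poly q N"
    then have "v * w \<le> poly p N * poly q N" "v * (w * 17 + 7) \<le> poly p N * (poly q N * 17 + 7)"
        "w \<le> poly q N"
      by (auto intro!: mult_mono add_mono)
    then show "v * w \<le> poly (p + q + p * (smult 17 q + [:7:]) + smult 4 q + [:7:]) N \<and>
        poly p N + (poly q N + (v * (w * 17 + 7) + w * 4 + 5) + 1) + 1
          \<le> poly (p + q + p * (smult 17 q + [:7:]) + smult 4 q + [:7:]) N"
      by (simp add: algebra_simps)
  qed auto
  then show ?case by blast
qed

section \<open>Printing numbers in binary\<close>

lemma encode_nat_rec:
  "encode_nat v = (if v = 0 then [False] else True # odd v # encode_nat (v div 2))"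
  by (subst encode_nat_def, subst binary.simps) (simp add: encode_list_def encode_nat_def)

text \<open>Halving by counting: while \<open>d\<close> is drained, \<open>d + 2\<close> toggles
  between 0 and 1 and every second step adds 1 to \<open>d + 1\<close>. In the end these are the
  remainder and the quotient.\<close>

definition emit_digit :: "nat \<Rightarrow> com" where
  "emit_digit d = Then (Prim (Out True)) (Then
     (drain d (Choose (NonZero (d + 2)) (Then (Prim (Dec (d + 2))) (Prim (Inc (d + 1))))
         (Prim (Inc (d + 2)))))
     (Then (Choose (NonZero (d + 2)) (Then (Prim (Dec (d + 2))) (Prim (Out True)))
         (Prim (Out False)))
     (transfer (d + 1) d)))"

lemma runs_emit_digit:
  assumes "\<rho> (d + 1) = 0" "\<rho> (d + 2) = 0"
  shows "runs x (emit_digit d) (h, \<rho>, out) (\<rho> d * 13 + 10)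
    (h, \<rho>(d := \<rho> d div 2), out @ [True, odd (\<rho> d)])"
proof -
  let ?v = "\<rho> d"
  let ?\<rho> = "\<lambda>i. \<rho>(d := ?v - i, d + 1 := i div 2, d + 2 := i mod 2)"
  let ?c = "Choose (NonZero (d + 2)) (Then (Prim (Dec (d + 2))) (Prim (Inc (d + 1))))
      (Prim (Inc (d + 2)))"
  let ?o = "out @ [True]"
  have 1: "runs x (Prim (Out True)) (h, \<rho>, out) 1 (h, \<rho>, ?o)"
    by (rule runs_Prim1) simp
  have "runs x ?c (h, (?\<rho> i)(d := ?v - Suc i), ?o) (3 + 1) (h, ?\<rho> (Suc i), ?o)" for i
  proof (rule runs_Choose)
    show "runs x (if holds x (h, (?\<rho> i)(d := ?v - Suc i), ?o) (NonZero (d + 2))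
       then Then (Prim (Dec (d + 2))) (Prim (Inc (d + 1))) else Prim (Inc (d + 2)))
       (h, (?\<rho> i)(d := ?v - Suc i), ?o) 3 (h, ?\<rho> (Suc i), ?o)"
    proof (cases "odd i")
      case True
      then have "perform (Inc (d + 1)) (perform (Dec (d + 2)) (h, (?\<rho> i)(d := ?v - Suc i), ?o)) =
          (h, ?\<rho> (Suc i), ?o)"
        by (auto simp: fun_eq_iff odd_iff_mod_2_eq_one div_Suc mod_Suc)
      from runs_Prim2[OF this] show ?thesis using True by (simp add: odd_iff_mod_2_eq_one)
    next
      case False
      then have "perform (Inc (d + 2)) (h, (?\<rho> i)(d := ?v - Suc i), ?o) = (h, ?\<rho> (Suc i), ?o)"
        by (auto simp: fun_eq_iff div_Suc mod_Suc)
      from runs_mono[OF runs_Prim1[OF this], of 3] show ?thesis using False by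
          (simp add: even_iff_mod_2_eq_zero)
    qed
  qed
  from runs_drain[of ?v x _ "\<lambda>_. h" ?\<rho> d "\<lambda>_. ?o", OF this]
  have "runs x (drain d ?c) (h, ?\<rho> 0, ?o) (?v * 8 + 1) (h, ?\<rho> ?v, ?o)" by simp
  moreover have "?\<rho> 0 = \<rho>" using assms by (auto simp: fun_eq_iff)
  ultimately have 2: "runs x (drain d ?c) (h, \<rho>, ?o) (?v * 8 + 1) (h, ?\<rho> ?v, ?o)" by metis
  have 3: "runs x (Choose (NonZero (d + 2)) (Then (Prim (Dec (d + 2))) (Prim (Out True)))
      (Prim (Out False)))
    (h, ?\<rho> ?v, ?o) (3 + 1) (h, \<rho>(d := 0, d + 1 := ?v div 2), ?o @ [odd ?v])"
  proof (rule runs_Choose)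
    show "runs x (if holds x (h, ?\<rho> ?v, ?o) (NonZero (d + 2))
       then Then (Prim (Dec (d + 2))) (Prim (Out True)) else Prim (Out False))
       (h, ?\<rho> ?v, ?o) 3 (h, \<rho>(d := 0, d + 1 := ?v div 2), ?o @ [odd ?v])"
    proof (cases "odd ?v")
      case True
      then have "perform (Out True) (perform (Dec (d + 2)) (h, ?\<rho> ?v, ?o)) =
          (h, \<rho>(d := 0, d + 1 := ?v div 2), ?o @ [odd ?v])"
        using assms by (auto simp: fun_eq_iff odd_iff_mod_2_eq_one)
      from runs_Prim2[OF this] show ?thesis using True by (simp add: odd_iff_mod_2_eq_one)
    next
      case False
      then have "perform (Out False) (h, ?\<rho> ?v, ?o) =
          (h, \<rho>(d := 0, d + 1 := ?v div 2), ?o @ [odd ?v])"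
        using assms by (auto simp: fun_eq_iff)
      from runs_mono[OF runs_Prim1[OF this], of 3] show ?thesis using False by
          (simp add: even_iff_mod_2_eq_zero)
    qed
  qed
  have "\<rho>(d := 0, d + 1 := ?v div 2, d + 1 := 0, d := ?v div 2) = \<rho>(d := ?v div 2)"
    using assms by (auto simp: fun_eq_iff)
  then have 4: "runs x (transfer (d + 1) d) (h, \<rho>(d := 0, d + 1 := ?v div 2), ?o @ [odd ?v])
      (?v div 2 * 5 + 1)
      (h, \<rho>(d := ?v div 2), ?o @ [odd ?v])"
    using runs_transfer[of "d + 1" d x h "\<rho>(d := 0, d + 1 := ?v div 2)" "?o @ [odd ?v]"] by simp
  have "?v div 2 \<le> ?v" by simp
  then have "runs x (emit_digit d) (h, \<rho>, out) (\<rho> d * 13 + 10) (h, \<rho>(d := ?v div 2), ?o @ [odd ?v])"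
    unfolding emit_digit_def
    by (intro runs_mono[OF runs_Then[OF 1 runs_Then[OF 2 runs_Then[OF 3 4]]]]) simp
  then show ?thesis by simp
qed

definition emit_nat :: "nat \<Rightarrow> com" where
  "emit_nat d = Then (Loop (NonZero d) (emit_digit d)) (Prim (Out False))"

text \<open>The terminating \<open>False\<close> is printed after the loop, hence the detour over
  \<open>out'\<close>.\<close>

lemma runs_emit_digits:
  assumes "\<rho> (d + 1) = 0" "\<rho> (d + 2) = 0"
  shows "\<exists>out'. out' @ [False] = encode_nat v \<and> runs x (Loop (NonZero d) (emit_digit d))
      (h, \<rho>(d := v), out)
    (v * (v * 13 + 12) + 1) (h, \<rho>(d := 0), out @ out')"
proof (induction v arbitrary: out rule: less_induct)
  case (less v)
  show ?case
  proof (cases "v = 0")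
    case True
    then show ?thesis
      using runs_Loop_false[of x "(h, \<rho>(d := 0), out)" "NonZero d" "emit_digit d"]
      by (intro exI[of _ "[]"]) (simp add: encode_nat_rec del: fun_upd_apply, simp)
  next
    case False
    let ?w = "v div 2"
    let ?o = "out @ [True, odd v]"
    obtain out' where o: "out' @ [False] = encode_nat ?w"
      and r: "runs x (Loop (NonZero d) (emit_digit d)) (h, \<rho>(d := ?w), ?o)
          (?w * (?w * 13 + 12) + 1) (h, \<rho>(d := 0), ?o @ out')"
      using less[of ?w ?o] False by (metis div_less_dividend neq0_conv one_less_numeral_iff
          semiring_norm(76))
    have "runs x (emit_digit d) (h, \<rho>(d := v), out) (v * 13 + 10) (h, \<rho>(d := ?w), ?o)"
      using runs_emit_digit[of "\<rho>(d := v)" d x h out] assms by simp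
    from runs_Loop_true[OF _ this r] False
    have R: "runs x (Loop (NonZero d) (emit_digit d)) (h, \<rho>(d := v), out)
       (v * 13 + 10 + (?w * (?w * 13 + 12) + 1) + 2) (h, \<rho>(d := 0), ?o @ out')" by simp
    \<comment> \<open>This crude bound suffices: one factor \<open>v * 13 + 12\<close> fewer already
      pays for the current digit.\<close>
    have "?w \<le> v - 1" using False by linarith
    then have "?w * (?w * 13 + 12) \<le> (v - 1) * (v * 13 + 12)"
      by (intro mult_mono) auto
    moreover have "v * (v * 13 + 12) = (v - 1) * (v * 13 + 12) + (v * 13 + 12)"
      using False by (cases v) auto
    ultimately have "runs x (Loop (NonZero d) (emit_digit d)) (h, \<rho>(d := v), out)
       (v * (v * 13 + 12) + 1) (h, \<rho>(d := 0), ?o @ out')"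
      by (intro runs_mono[OF R]) simp
    then show ?thesis using o False
      by (intro exI[of _ "True # odd v # out'"]) (simp add: encode_nat_rec[of v] del: fun_upd_apply)
  qed
qed

lemma runs_emit_nat:
  assumes "\<rho> (d + 1) = 0" "\<rho> (d + 2) = 0"
  shows "runs x (emit_nat d) (h, \<rho>(d := v), out) (v * (v * 13 + 12) + 3) (h, \<rho>(d := 0), out @
      encode_nat v)"
proof -
  obtain out' where o: "out' @ [False] = encode_nat v"
    and r: "runs x (Loop (NonZero d) (emit_digit d)) (h, \<rho>(d := v), out) (v * (v * 13 + 12) + 1)
        (h, \<rho>(d := 0), out @ out')"
    using runs_emit_digits[of \<rho> d v x h out] assms by blast
  have "runs x (Prim (Out False)) (h, \<rho>(d := 0), out @ out') 1 (h, \<rho>(d := 0), out @ encode_nat v)"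
    by (rule runs_Prim1) (simp flip: o)
  from runs_mono[OF runs_Then[OF r this]] show ?thesis by (simp add: emit_nat_def)
qed

section \<open>Loop programs that print the instance\<close>

datatype prog = Nop | Emit bool | EmitNat exp | Seq prog prog | For exp prog

text \<open>
  The loop counter of \<open>For\<close> at depth \<open>d\<close> is variable \<open>d\<close>; variable \<open>d + 1\<close> holds the number of
  remaining iterations, so that loop variables are numbered by even numbers.
\<close>

primrec emitted :: "bool list \<Rightarrow> prog \<Rightarrow> nat \<Rightarrow> (nat \<Rightarrow> nat) \<Rightarrow> bool list" where
  "emitted x Nop d \<rho> = []"
| "emitted x (Emit b) d \<rho> = [b]"
| "emitted x (EmitNat e) d \<rho> = encode_nat (eval x \<rho> e)"
| "emitted x (Seq p q) d \<rho> = emitted x p d \<rho> @ emitted x q d \<rho>"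
| "emitted x (For e p) d \<rho> = concat (map (\<lambda>i. emitted x p (d + 2)
     (\<rho>(d := i, d + 1 := eval x \<rho> e - Suc i))) [0..<eval x \<rho> e])"

primrec prog_below :: "nat \<Rightarrow> prog \<Rightarrow> bool" where
  "prog_below d Nop \<longleftrightarrow> True"
| "prog_below d (Emit b) \<longleftrightarrow> True"
| "prog_below d (EmitNat e) \<longleftrightarrow> exp_below d e"
| "prog_below d (Seq p q) \<longleftrightarrow> prog_below d p \<and> prog_below d q"
| "prog_below d (For e p) \<longleftrightarrow> exp_below d e \<and> prog_below (d + 2) p"

primrec cprog :: "prog \<Rightarrow> nat \<Rightarrow> com" where
  "cprog Nop d = Done"
| "cprog (Emit b) d = Prim (Out b)"
| "cprog (EmitNat e) d = Then (cexp e d) (emit_nat d)"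
| "cprog (Seq p q) d = Then (cprog p d) (cprog q d)"
| "cprog (For e p) d = Then (cexp e (d + 1))
     (Then (drain (d + 1) (Then (cprog p (d + 2)) (Prim (Inc d)))) (drain d Done))"

text \<open>All registers end as they began, so that programs can be sequenced and loop bodies
  repeated.\<close>

definition prog_cost :: "nat \<Rightarrow> prog \<Rightarrow> nat poly \<Rightarrow> bool" where
  "prog_cost d pr q \<longleftrightarrow> (\<forall>x \<rho> N out.
    length x \<le> N \<longrightarrow> (\<forall>k<d. \<rho> k \<le> N) \<longrightarrow> (\<forall>r\<ge>d. \<rho> r = 0) \<longrightarrow>
    runs x (cprog pr d) (0, \<rho>, out) (poly q N) (0, \<rho>, out @ emitted x pr d \<rho>))"

lemma prog_costI:
  assumes "\<And>x \<rho> N out. length x \<le> N \<Longrightarrow> \<forall>k<d. \<rho> k \<le> N \<Longrightarrow> \<forall>r\<ge>d. \<rho> r = 0 \<Longrightarrow>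
    runs x (cprog pr d) (0, \<rho>, out) (poly q N) (0, \<rho>, out @ emitted x pr d \<rho>)"
  shows "prog_cost d pr q"
  unfolding prog_cost_def using assms by blast

lemma prog_costD:
  assumes "prog_cost d pr q" "length x \<le> N" "\<forall>k<d. \<rho> k \<le> N" "\<forall>r\<ge>d. \<rho> r = 0"
  shows "runs x (cprog pr d) (0, \<rho>, out) (poly q N) (0, \<rho>, out @ emitted x pr d \<rho>)"
  using assms unfolding prog_cost_def by blast

lemma ex_prog_cost: "prog_below d pr \<Longrightarrow> \<exists>q. prog_cost d pr q"
proof (induction pr arbitrary: d)
  case Nop
  show ?case by (intro exI[of _ 0] prog_costI) (simp add: runs_Done)
next
  case (Emit b)
  have "runs x (Prim (Out b)) (0, \<rho>, out) (poly 1 N) (0, \<rho>, out @ [b])" for x \<rho> out and N :: nat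
    using runs_Prim1[of "Out b" "(0, \<rho>, out)" _ x] by simp
  then show ?case by (intro exI[of _ 1] prog_costI) simp
next
  case (EmitNat e)
  then obtain p where p: "exp_cost d e p" using ex_exp_cost by auto
  let ?q = "p + p * (smult 13 p + [:12:]) + [:4:]"
  have *: "runs x (cprog (EmitNat e) d) (0, \<rho>, out) (poly ?q N)
      (0, \<rho>, out @ emitted x (EmitNat e) d \<rho>)"
    if H: "length x \<le> N" "\<forall>k<d. \<rho> k \<le> N" "\<forall>r\<ge>d. \<rho> r = 0" for x \<rho> N out
  proof -
    let ?v = "eval x \<rho> e"
    note P = exp_costD[OF p order_refl H]
    have 2: "runs x (emit_nat d) (0, \<rho>(d := ?v), out) (?v * (?v * 13 + 12) + 3)
        (0, \<rho>, out @ encode_nat ?v)"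
      using runs_emit_nat[of \<rho> d x 0 ?v out] H(3) fun_upd_idem[of \<rho> d 0] by simp
    have "?v * (?v * 13 + 12) \<le> poly p N * (poly p N * 13 + 12)"
      using P by (intro mult_mono add_mono) auto
    then show ?thesis
      using runs_Then[OF P(2) 2] by (auto elim!: runs_mono simp: algebra_simps)
  qed
  show ?case by (rule exI, rule prog_costI, rule *)
next
  case (Seq p1 p2)
  then obtain q1 q2 where q1: "prog_cost d p1 q1" and q2: "prog_cost d p2 q2" by fastforce
  have *: "runs x (cprog (Seq p1 p2) d) (0, \<rho>, out) (poly (q1 + q2 + 1) N)
      (0, \<rho>, out @ emitted x (Seq p1 p2) d \<rho>)"
    if H: "length x \<le> N" "\<forall>k<d. \<rho> k \<le> N" "\<forall>r\<ge>d. \<rho> r = 0" for x \<rho> N out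
    using runs_Then[OF prog_costD[OF q1 H] prog_costD[OF q2 H]] by simp
  show ?case by (rule exI, rule prog_costI, rule *)
next
  case (For e p)
  then obtain pe where pe: "exp_cost d e pe" using ex_exp_cost[of d e] by auto
  obtain q where q: "prog_cost (d + 2) p q" using For by auto
  \<comment> \<open>The body sees two further registers, both bounded by the value of
    \<open>e\<close>; its cost is therefore taken at \<open>N + poly pe N\<close>.\<close>
  let ?q = "pcompose q ([:0, 1:] + pe)"
  let ?r = "pe + (pe * (?q + [:6:]) + 1) + (smult 4 pe + 1) + [:2:]"
  have *: "runs x (cprog (For e p) d) (0, \<rho>, out) (poly ?r N) (0, \<rho>, out @ emitted x (For e p) d \<rho>)"
    if H: "length x \<le> N" "\<forall>k<d. \<rho> k \<le> N" "\<forall>r\<ge>d. \<rho> r = 0" for x \<rho> N out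
  proof -
    let ?n = "eval x \<rho> e"
    let ?N = "N + poly pe N"
    let ?\<rho> = "\<lambda>i. \<rho>(d := i, d + 1 := ?n - i)"
    let ?out = "\<lambda>i. out @ concat (map (\<lambda>i. emitted x p (d + 2) (\<rho>(d := i, d + 1 := ?n - Suc i)))
        [0..<i])"
    have H': "\<forall>r\<ge>d+1. \<rho> r = 0" using H(3) by simp
    note P = exp_costD[OF pe le_add1 H(1,2) H']
    have "?\<rho> 0 = \<rho>(d + 1 := ?n)" using H(3) by (auto simp: fun_eq_iff)
    then have 1: "runs x (cexp e (d + 1)) (0, \<rho>, out) (poly pe N) (0, ?\<rho> 0, ?out 0)"
      using P by simp
    have "runs x (Then (cprog p (d + 2)) (Prim (Inc d))) (0, (?\<rho> i)(d + 1 := ?n - Suc i), ?out i)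
        (poly ?q N + 2) (0, ?\<rho> (Suc i), ?out (Suc i))" if "i < ?n" for i
    proof -
      let ?\<rho>' = "\<rho>(d := i, d + 1 := ?n - Suc i)"
      have "\<forall>k<d+2. ?\<rho>' k \<le> ?N"
      proof (intro allI impI)
        fix k assume "k < d + 2"
        then consider "k < d" | "k = d" | "k = d + 1" by linarith
        then show "?\<rho>' k \<le> ?N" using H(2) P that by cases (auto intro: trans_le_add1)
      qed
      moreover have "\<forall>r\<ge>d+2. ?\<rho>' r = 0" using H(3) by auto
      ultimately have "runs x (cprog p (d + 2)) (0, ?\<rho>', ?out i) (poly q ?N) (0, ?\<rho>', ?out i @
          emitted x p (d + 2) ?\<rho>')"
        using H(1) by (intro prog_costD[OF q]) auto
      moreover have "runs x (Prim (Inc d)) (0, ?\<rho>', ?out i @ emitted x p (d + 2) ?\<rho>') 1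
          (0, ?\<rho> (Suc i), ?out (Suc i))"
        by (rule runs_Prim1) (auto simp: fun_eq_iff)
      ultimately have "runs x (Then (cprog p (d + 2)) (Prim (Inc d))) (0, ?\<rho>', ?out i)
         (poly q ?N + 1 + 1) (0, ?\<rho> (Suc i), ?out (Suc i))" by (rule runs_Then)
      moreover have "(?\<rho> i)(d + 1 := ?n - Suc i) = ?\<rho>'" by simp
      ultimately show ?thesis by (simp add: poly_pcompose)
    qed
    from runs_drain[of ?n x _ "\<lambda>_. 0" ?\<rho> "d + 1" ?out, OF this]
    have 2: "runs x (drain (d + 1) (Then (cprog p (d + 2)) (Prim (Inc d)))) (0, ?\<rho> 0, ?out 0)
       (?n * (poly ?q N + 6) + 1) (0, ?\<rho> ?n, ?out ?n)" by (simp add: add.commute)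
    have "(?\<rho> ?n)(d := 0) = \<rho>" using H(3) by (auto simp: fun_eq_iff)
    then have 3: "runs x (drain d Done) (0, ?\<rho> ?n, ?out ?n) (?n * 4 + 1) (0, \<rho>, ?out ?n)"
      using runs_clear[of x d 0 "?\<rho> ?n" "?out ?n"] by simp
    have "?n * (poly ?q N + 6) \<le> poly pe N * (poly ?q N + 6)" by (rule mult_le_mono1[OF P(1)])
    moreover have "poly ?r N = poly pe N + (poly pe N * (poly ?q N + 6) + 1) + (4 * poly pe N + 1)
        + 2"
      by simp
    ultimately have "poly pe N + (?n * (poly ?q N + 6) + 1 + (?n * 4 + 1) + 1) + 1 \<le> poly ?r N"
      using P(1) by linarith
    from runs_mono[OF runs_Then[OF 1 runs_Then[OF 2 3]] this] show ?thesis by simp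
  qed
  show ?case by (rule exI, rule prog_costI, rule *)
qed

theorem polytime_prog:
  assumes "prog_below 0 pr"
  shows "polytime (\<lambda>x. emitted x pr 0 (\<lambda>_. 0))"
proof -
  obtain q where q: "prog_cost 0 pr q" using ex_prog_cost[OF assms] by blast
  show ?thesis
  proof (rule polytime_com[of "cprog pr 0" q])
    show "\<exists>h \<rho>. runs x (cprog pr 0) (0, \<lambda>_. 0, []) (poly q (length x))
        (h, \<rho>, emitted x pr 0 (\<lambda>_. 0))" for x
      using prog_costD[OF q, of x "length x" "\<lambda>_. 0" "[]"] by auto
  qed
qed

section \<open>Journeys and symmetric networks of routes\<close>

text \<open>Explicit times with waiting at both ends make journeys easy to concatenate, which lists
  of temporal edges are not.\<close>

inductive journey :: "'v temporal_edge set \<Rightarrow> 'v \<Rightarrow> real \<Rightarrow> 'v \<Rightarrow> real \<Rightarrow> bool" for E where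
  wait: "t \<le> t' \<Longrightarrow> journey E u t u t'"
| ride: "(u, w, s, d) \<in> E \<Longrightarrow> t \<le> s \<Longrightarrow> journey E w (s + d) v t' \<Longrightarrow> journey E u t v t'"

lemma journey_trans: "journey E u t v t' \<Longrightarrow> t' \<le> s \<Longrightarrow> journey E v s w s' \<Longrightarrow> journey E u t w s'"
proof (induction rule: journey.induct)
  case (wait t t' u)
  then have "t \<le> s" by simp
  from wait(3) show ?case
  proof cases
    case wait
    then show ?thesis using \<open>t \<le> s\<close> by (auto intro: journey.wait)
  next
    case (ride w s' d)
    then show ?thesis using \<open>t \<le> s\<close> by (auto intro: journey.ride)
  qed
next
  case (ride u w s d t v t')
  then show ?case by (auto intro: journey.ride)
qed

lemma journey_edge: "(u, w, s, d) \<in> E \<Longrightarrow> journey E u s w (s + d)"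
  by (auto intro: journey.intros)

lemma journey_temporal_path:
  "journey E u t v t' \<Longrightarrow>
    \<exists>p. temporal_path E u p v \<and> (case p of [] \<Rightarrow> True | (a, b, s, d) # _ \<Rightarrow> t \<le> s)"
proof (induction rule: journey.induct)
  case (wait t t' u)
  then show ?case by (intro exI[of _ "[]"]) simp
next
  case (ride u w s d t v t')
  then obtain p where "temporal_path E w p v" "case p of [] \<Rightarrow> True | (a, b, s', d') # _ \<Rightarrow> s + d \<le>
      s'" by blast
  then show ?case using ride(1,2) by (intro exI[of _ "(u, w, s, d) # p"]) (auto split: list.splits)
qed

lemma temporal_path_journey:
  "temporal_path E u p v \<Longrightarrow> (case p of [] \<Rightarrow> True | (a, b, s, d) # _ \<Rightarrow> t \<le> s) \<Longrightarrow>
      \<exists>t'. journey E u t v t'"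
proof (induction p arbitrary: u t)
  case Nil
  then show ?case by (auto intro: journey.wait)
next
  case (Cons e p)
  obtain a b s d where e: "e = (a, b, s, d)" by (metis surj_pair)
  have "\<exists>t'. journey E b (s + d) v t'"
    using Cons.prems by (intro Cons.IH) (auto simp: e split: list.splits)
  then show ?case using Cons.prems by (auto simp: e intro: journey.ride)
qed

definition connects :: "'v temporal_edge set \<Rightarrow> 'v \<Rightarrow> 'v \<Rightarrow> bool" where
  "connects E u v \<longleftrightarrow> (\<exists>t t'. journey E u t v t')"

lemma connects_iff: "connects E u v \<longleftrightarrow> (\<exists>p. temporal_path E u p v)"
proof
  assume "\<exists>p. temporal_path E u p v"
  then obtain p where p: "temporal_path E u p v" ..
  show "connects E u v"
  proof (cases p)
    case Nil
    then show ?thesis using temporal_path_journey[OF p, of 0] by (auto simp: connects_def)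
  next
    case (Cons e p')
    obtain a b s d where "e = (a, b, s, d)" by (metis surj_pair)
    then show ?thesis using Cons temporal_path_journey[OF p, of s] by (auto simp: connects_def)
  qed
qed (auto simp: connects_def dest: journey_temporal_path)

text \<open>Only boarding has to preserve \<open>I\<close>, so \<open>I\<close> may be a lower bound
  on arrival times. The time in the conclusion is that of the last arrival, before any final
  waiting.\<close>

lemma journey_invariant:
  assumes "journey E u t v t'" "I u t"
    and "\<And>u w s d t. (u, w, s, d) \<in> E \<Longrightarrow> t \<le> s \<Longrightarrow> I u t \<Longrightarrow> I w (s + d)"
  shows "\<exists>t. I v t"
  using assms by (induction rule: journey.induct) blast+

definition map_edges :: "('a \<Rightarrow> 'b) \<Rightarrow> 'a temporal_edge set \<Rightarrow> 'b temporal_edge set" where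
  "map_edges g E = (\<lambda>(u, v, s, d). (g u, g v, s, d)) ` E"

lemma journey_map: "journey E u t v t' \<Longrightarrow> journey (map_edges g E) (g u) t (g v) t'"
  by (induction rule: journey.induct) (force intro: journey.intros simp: map_edges_def)+

lemma journey_unmap:
  assumes "journey (map_edges g E) x t y t'" "inj_on g V" "x = g u" "y = g v" "u \<in> V" "v \<in> V"
    and "\<And>a b s d. (a, b, s, d) \<in> E \<Longrightarrow> a \<in> V \<and> b \<in> V"
  shows "journey E u t v t'"
  using assms(1,3,4,5)
proof (induction arbitrary: u rule: journey.induct)
  case (wait t t' x)
  then show ?case using assms by (auto dest: inj_onD intro: journey.wait)
next
  case (ride x w s d t y t')
  then obtain a b where ab: "(a, b, s, d) \<in> E" "x = g a" "w = g b" by (auto simp: map_edges_def)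
  then have "a = u" "b \<in> V" using assms ride by (auto dest!: inj_onD)
  then show ?case using ride ab by (auto intro: journey.ride)
qed

lemma connects_map:
  assumes "inj_on g V" "u \<in> V" "v \<in> V" "\<And>a b s d. (a, b, s, d) \<in> E \<Longrightarrow> a \<in> V \<and> b \<in> V"
  shows "connects (map_edges g E) (g u) (g v) \<longleftrightarrow> connects E u v"
  unfolding connects_def
  using journey_map[of E u _ v _ g] journey_unmap[OF _ assms(1) refl refl assms(2,3), of E] assms(4)
  by blast

text \<open>A walk \<open>pos 0, \<dots>, pos len\<close> where \<open>cum i\<close> is the total weight of its first \<open>i\<close> edges.\<close>

datatype 'a route = Route (pos: "nat \<Rightarrow> 'a") (cum: "nat \<Rightarrow> nat") (len: nat)

definition route_arcs :: "('a \<Rightarrow> nat) \<Rightarrow> 'a route \<Rightarrow> (nat \<times> nat \<times> nat) list" where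
  "route_arcs code r = map (\<lambda>i. (code (pos r i), code (pos r (Suc i)), cum r (Suc i) - cum r i))
      [0..<len r]"

text \<open>The two directions of edge \<open>e\<close> become the arcs \<open>2 * e\<close> and
  \<open>2 * e + 1\<close>; the index lists of the forward and backward trips rely on this
  numbering.\<close>

definition bidirect :: "(nat \<times> nat \<times> nat) list \<Rightarrow> (nat \<times> nat \<times> rat) list" where
  "bidirect U = concat (map (\<lambda>(u, v, w). [(u, v, of_nat w), (v, u, of_nat w)]) U)"

definition forward_trip :: "nat \<Rightarrow> nat \<Rightarrow> nat list" where
  "forward_trip s l = map (\<lambda>i. 2 * (s + i)) [0..<l]"

definition backward_trip :: "nat \<Rightarrow> nat \<Rightarrow> nat list" where
  "backward_trip s l = map (\<lambda>i. 2 * (s + (l - Suc i)) + 1) [0..<l]"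

fun trips_from :: "nat \<Rightarrow> nat list \<Rightarrow> nat list list" where
  "trips_from s [] = []"
| "trips_from s (l # ls) = forward_trip s l # backward_trip s l # trips_from (s + l) ls"

definition route_input :: "('a \<Rightarrow> nat) \<Rightarrow> nat \<Rightarrow> 'a route list \<Rightarrow> mrtt_input" where
  "route_input code n Rs =
    (n, bidirect (concat (map (route_arcs code) Rs)), trips_from 0 (map len Rs))"

text \<open>
  The temporal edges of the routes when the \<open>k\<close>-th route is run forwards, passing \<open>pos i\<close> at time
  \<open>f k + cum i\<close>, and backwards, passing \<open>pos i\<close> at time \<open>b k - cum i\<close>.
\<close>

definition route_edges :: "'a route list \<Rightarrow> (nat \<Rightarrow> real) \<Rightarrow> (nat \<Rightarrow> real) \<Rightarrow> 'a temporal_edge set" where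
  "route_edges Rs f b =
    {(pos r i, pos r (Suc i), f k + real (cum r i), real (cum r (Suc i)) - real (cum r i)) | k r i.
       k < length Rs \<and> r = Rs ! k \<and> i < len r} \<union>
    {(pos r (Suc i), pos r i, b k - real (cum r (Suc i)), real (cum r (Suc i)) - real (cum r i)) |
        k r i.
       k < length Rs \<and> r = Rs ! k \<and> i < len r}"

lemma length_trips_from [simp]: "length (trips_from s ls) = 2 * length ls"
  by (induction s ls rule: trips_from.induct) auto

lemma nth_trips_from:
  assumes "k < length ls"
  shows "trips_from s ls ! (2 * k) = forward_trip (s + sum_list (take k ls)) (ls ! k)"
    "trips_from s ls ! Suc (2 * k) = backward_trip (s + sum_list (take k ls)) (ls ! k)"
  using assms
proof (induction s ls arbitrary: k rule: trips_from.induct)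
  case (2 s l ls)
  {
    case 1
    then show ?case using 2 by (cases k) (auto simp: add.assoc)
  next
    case 2
    then show ?case using \<open>\<And>k. k < length ls \<Longrightarrow> trips_from (s + l) ls ! Suc (2 * k) = _ k\<close>
      by (cases k) (auto simp: add.assoc)
  }
qed auto

lemma length_bidirect [simp]: "length (bidirect U) = 2 * length U"
  by (induction U) (auto simp: bidirect_def)

lemma nth_bidirect:
  assumes "e < length U" "U ! e = (u, v, w)"
  shows "bidirect U ! (2 * e) = (u, v, of_nat w)" "bidirect U ! Suc (2 * e) = (v, u, of_nat w)"
proof -
  have "bidirect U ! (2 * e) = (u, v, of_nat w) \<and> bidirect U ! Suc (2 * e) = (v, u, of_nat w)"
    using assms
  proof (induction U arbitrary: e)
    case (Cons x U)
    obtain a b c where "x = (a, b, c)" by (metis surj_pair)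
    then show ?case using Cons by (cases e) (auto simp: bidirect_def)
  qed auto
  then show "bidirect U ! (2 * e) = (u, v, of_nat w)" "bidirect U ! Suc (2 * e) = (v, u, of_nat w)"
    by auto
qed

lemma nth_concat_take:
  assumes "k < length xss" "i < length (xss ! k)"
  shows "sum_list (take k (map length xss)) + i < length (concat xss) \<and>
    concat xss ! (sum_list (take k (map length xss)) + i) = xss ! k ! i"
  using assms
proof (induction xss arbitrary: k)
  case (Cons xs xss)
  then show ?case by (cases k) (auto simp: nth_append)
qed auto

lemma concat_index:
  assumes "e < length (concat xss)"
  shows "\<exists>k i. k < length xss \<and> i < length (xss ! k) \<and> e = sum_list (take k (map length xss)) + i"
  using assms
proof (induction xss arbitrary: e)
  case (Cons xs xss)
  show ?case
  proof (cases "e < length xs")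
    case True
    then show ?thesis by (intro exI[of _ 0] exI[of _ e]) auto
  next
    case False
    then have "e - length xs < length (concat xss)" using Cons.prems by auto
    then obtain k i where "k < length xss" "i < length (xss ! k)"
      "e - length xs = sum_list (take k (map length xss)) + i"
      using Cons.IH by blast
    then show ?thesis using False by (intro exI[of _ "Suc k"] exI[of _ i]) auto
  qed
qed auto

lemma (in wf_digraph) awalk_map:
  assumes "\<And>i. i < l \<Longrightarrow> g i \<in> arcs G \<and> tail G (g i) = p i \<and> head G (g i) = p (Suc i)" "p 0 \<in> verts G"
  shows "awalk (p 0) (map g [0..<l]) (p l) \<and> awalk_verts (p 0) (map g [0..<l]) = map p [0..<Suc l]"
  using assms
proof (induction l arbitrary: g p)
  case 0
  then show ?case by (auto simp: awalk_def)
next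
  case (Suc l)
  have "p (Suc 0) \<in> verts G" using Suc.prems(1)[of 0] head_in_verts[of "g 0"] by auto
  moreover have "g (Suc i) \<in> arcs G \<and> tail G (g (Suc i)) = p (Suc i) \<and> head G (g (Suc i)) =
      p (Suc (Suc i))" if "i < l" for i
    using Suc.prems(1)[of "Suc i"] that by auto
  ultimately have IH: "awalk (p (Suc 0)) (map (g \<circ> Suc) [0..<l]) (p (Suc l)) \<and>
     awalk_verts (p (Suc 0)) (map (g \<circ> Suc) [0..<l]) = map (p \<circ> Suc) [0..<Suc l]"
    using Suc.IH[of "g \<circ> Suc" "p \<circ> Suc"] by (simp add: comp_def)
  have split: "map h [0..<Suc n] = h 0 # map (h \<circ> Suc) [0..<n]" for h :: "nat \<Rightarrow> 'z" and n
    by (metis map_map map_Suc_upt upt_conv_Cons zero_less_Suc list.simps(9))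
  show ?case
    unfolding split[of g l] split[of p "Suc l"]
    using IH Suc.prems(1)[of 0] Suc.prems(2) by (auto simp: awalk_def)
qed

section \<open>Networks in which every route is run in both directions\<close>

locale route_system =
  fixes code :: "'a \<Rightarrow> nat" and V :: "'a set" and Rs :: "'a route list" and n :: nat
  assumes code_bij: "bij_betw code V {..<n}"
    and pos_in: "r \<in> set Rs \<Longrightarrow> i \<le> len r \<Longrightarrow> pos r i \<in> V"
    and len_pos: "r \<in> set Rs \<Longrightarrow> 0 < len r"
    and cum_0: "r \<in> set Rs \<Longrightarrow> cum r 0 = 0"
    and cum_Suc: "r \<in> set Rs \<Longrightarrow> i < len r \<Longrightarrow> cum r i < cum r (Suc i)"
    and covered: "v \<in> V \<Longrightarrow> \<exists>r \<in> set Rs. \<exists>i \<le> len r. pos r i = v"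
begin

abbreviation N where "N \<equiv> route_input code n Rs"
abbreviation D where "D \<equiv> input_digraph N"
abbreviation weight where "weight \<equiv> input_weight N"
abbreviation trips where "trips \<equiv> input_trips N"

definition off :: "nat \<Rightarrow> nat" where
  "off k = sum_list (take k (map len Rs))"

definition farc :: "nat \<Rightarrow> nat \<Rightarrow> nat" where
  "farc k i = 2 * (off k + i)"

definition barc :: "nat \<Rightarrow> nat \<Rightarrow> nat" where
  "barc k i = Suc (2 * (off k + i))"

lemma code_lt: "v \<in> V \<Longrightarrow> code v < n"
  using code_bij by (auto simp: bij_betw_def)

lemma verts_D: "verts D = {..<n}"
  by (simp add: route_input_def)

lemma length_trips: "length trips = 2 * length Rs"
  by (simp add: route_input_def)

lemma nth_trips:
  assumes "k < length Rs"
  shows "trips ! (2 * k) = forward_trip (off k) (len (Rs ! k))"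
    "trips ! Suc (2 * k) = backward_trip (off k) (len (Rs ! k))"
  using nth_trips_from[of k "map len Rs" 0] assms by (auto simp: route_input_def off_def)

lemma arc:
  assumes "k < length Rs" "r = Rs ! k" "i < len r"
  shows "farc k i \<in> arcs D" "barc k i \<in> arcs D"
    "tail D (farc k i) = code (pos r i)" "head D (farc k i) = code (pos r (Suc i))"
    "tail D (barc k i) = code (pos r (Suc i))" "head D (barc k i) = code (pos r i)"
    "weight (farc k i) = real (cum r (Suc i)) - real (cum r i)"
    "weight (barc k i) = real (cum r (Suc i)) - real (cum r i)"
proof -
  let ?U = "map (route_arcs code) Rs"
  have eq: "map length ?U = map len Rs" by (simp add: route_arcs_def comp_def)
  have "off k + i < length (concat ?U) \<and> concat ?U ! (off k + i) = ?U ! k ! i"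
    using nth_concat_take[of k ?U i] assms unfolding off_def eq by (simp add: route_arcs_def)
  then have lt: "off k + i < length (concat ?U)"
    and nth: "concat ?U ! (off k + i) = (code (pos r i), code (pos r (Suc i)),
        cum r (Suc i) - cum r i)"
    using assms by (simp_all add: route_arcs_def)
  have le: "cum r i \<le> cum r (Suc i)" using cum_Suc[of r i] assms by auto
  show "farc k i \<in> arcs D" "barc k i \<in> arcs D"
    "tail D (farc k i) = code (pos r i)" "head D (farc k i) = code (pos r (Suc i))"
    "tail D (barc k i) = code (pos r (Suc i))" "head D (barc k i) = code (pos r i)"
    "weight (farc k i) = real (cum r (Suc i)) - real (cum r i)"
    "weight (barc k i) = real (cum r (Suc i)) - real (cum r i)"
    unfolding farc_def barc_def
    using lt nth_bidirect[OF lt nth] le by (auto simp: route_input_def of_nat_diff of_rat_diff)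
qed

lemma arc_cases:
  assumes "e \<in> arcs D"
  obtains k i where "k < length Rs" "i < len (Rs ! k)" "e = farc k i \<or> e = barc k i"
proof -
  let ?U = "map (route_arcs code) Rs"
  have eq: "map length ?U = map len Rs" by (simp add: route_arcs_def comp_def)
  have "e div 2 < length (concat ?U)" using assms by (auto simp: route_input_def)
  then obtain k i where "k < length Rs" "i < len (Rs ! k)" "e div 2 = off k + i"
    using concat_index[of "e div 2" ?U] unfolding eq off_def by (auto simp: route_arcs_def)
  moreover have "e = 2 * (e div 2) \<or> e = Suc (2 * (e div 2))" by linarith
  ultimately show ?thesis using that unfolding farc_def barc_def by metis
qed

lemma forward_trip_eq: "forward_trip (off k) l = map (farc k) [0..<l]"
  by (simp add: forward_trip_def farc_def)

lemma backward_trip_eq: "backward_trip (off k) l = map (\<lambda>i. barc k (l - Suc i)) [0..<l]"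
  by (simp add: backward_trip_def barc_def)

lemma trip_cases:
  assumes "T \<in> set trips"
  obtains k where "k < length Rs"
    "T = forward_trip (off k) (len (Rs ! k)) \<or> T = backward_trip (off k) (len (Rs ! k))"
proof -
  obtain j where j: "j < 2 * length Rs" "T = trips ! j"
    using assms by (metis in_set_conv_nth length_trips)
  then have k: "j div 2 < length Rs" by linarith
  have "j = 2 * (j div 2) \<or> j = Suc (2 * (j div 2))" by linarith
  then have "T = forward_trip (off (j div 2)) (len (Rs ! (j div 2))) \<or>
     T = backward_trip (off (j div 2)) (len (Rs ! (j div 2)))"
    using nth_trips[OF k] j(2) by metis
  then show ?thesis using that k by blast
qed

sublocale fin_digraph D
proof
  show "finite (verts D)" "finite (arcs D)" by (simp_all add: route_input_def)
next
  fix e assume "e \<in> arcs D"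
  then obtain k i where ki: "k < length Rs" "i < len (Rs ! k)" "e = farc k i \<or> e = barc k i"
    by (rule arc_cases)
  then show "tail D e \<in> verts D" "head D e \<in> verts D"
    using arc[OF ki(1) refl ki(2)] pos_in[of "Rs ! k"] code_lt unfolding verts_D by auto
qed

lemma awalk_forward:
  assumes "k < length Rs" "r = Rs ! k"
  shows "awalk (code (pos r 0)) (forward_trip (off k) (len r)) (code (pos r (len r))) \<and>
    awalk_verts (code (pos r 0)) (forward_trip (off k) (len r)) =
        map (\<lambda>i. code (pos r i)) [0..<Suc (len r)]"
proof -
  have "code (pos r 0) \<in> verts D" using code_lt[OF pos_in] assms unfolding verts_D by auto
  then show ?thesis unfolding forward_trip_eq
    using arc[OF assms] by (intro awalk_map[where p = "\<lambda>i. code (pos r i)"]) auto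
qed

lemma awalk_backward:
  assumes "k < length Rs" "r = Rs ! k"
  shows "awalk (code (pos r (len r))) (backward_trip (off k) (len r)) (code (pos r 0)) \<and>
    awalk_verts (code (pos r (len r))) (backward_trip (off k) (len r)) =
      map (\<lambda>i. code (pos r (len r - i))) [0..<Suc (len r)]"
proof -
  have "barc k (len r - Suc i) \<in> arcs D \<and>
     tail D (barc k (len r - Suc i)) = code (pos r (len r - i)) \<and>
     head D (barc k (len r - Suc i)) = code (pos r (len r - Suc i))" if "i < len r" for i
  proof -
    have "len r - Suc i < len r" "Suc (len r - Suc i) = len r - i" using that by auto
    then show ?thesis using arc[OF assms, of "len r - Suc i"] by simp
  qed
  moreover have "code (pos r (len r - 0)) \<in> verts D"
    using code_lt[OF pos_in, of r "len r"] assms unfolding verts_D by auto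
  ultimately show ?thesis
    using awalk_map[where p = "\<lambda>i. code (pos r (len r - i))" and l = "len r"
        and g = "\<lambda>i. barc k (len r - Suc i)"]
    unfolding backward_trip_eq by simp
qed

lemma trip_nodes_trips:
  assumes "k < length Rs" "r = Rs ! k"
  shows "trip_nodes D (trips ! (2 * k)) = map (\<lambda>i. code (pos r i)) [0..<Suc (len r)]"
    "trip_nodes D (trips ! Suc (2 * k)) = rev (map (\<lambda>i. code (pos r i)) [0..<Suc (len r)])"
proof -
  have l: "0 < len r" using len_pos assms by auto
  have "hd (forward_trip (off k) (len r)) = farc k 0"
    using l by (auto simp: forward_trip_eq hd_map upt_conv_Cons)
  then have "tail D (hd (forward_trip (off k) (len r))) = code (pos r 0)"
    using arc(3)[OF assms l] by simp
  then show "trip_nodes D (trips ! (2 * k)) = map (\<lambda>i. code (pos r i)) [0..<Suc (len r)]"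
    using awalk_forward[OF assms] nth_trips[OF assms(1)] by (simp add: trip_nodes_def assms(2))
  have "hd (backward_trip (off k) (len r)) = barc k (len r - 1)"
    using l by (auto simp: backward_trip_eq hd_map upt_conv_Cons)
  then have "tail D (hd (backward_trip (off k) (len r))) = code (pos r (len r))"
    using arc(5)[OF assms, of "len r - 1"] l by simp
  then have "trip_nodes D (trips ! Suc (2 * k)) = map (\<lambda>i. code (pos r (len r - i)))
      [0..<Suc (len r)]"
    using awalk_backward[OF assms] nth_trips[OF assms(1)] by (simp add: trip_nodes_def assms(2))
  also have "\<dots> = rev (map (\<lambda>i. code (pos r i)) [0..<Suc (len r)])"
    by (rule nth_equalityI) (auto simp: rev_nth simp del: upt_Suc)
  finally show "trip_nodes D (trips ! Suc (2 * k)) =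
      rev (map (\<lambda>i. code (pos r i)) [0..<Suc (len r)])" .
qed

lemma trip_network_N: "trip_network D weight trips"
proof
  fix e assume "e \<in> arcs D"
  then obtain k i where ki: "k < length Rs" "i < len (Rs ! k)" "e = farc k i \<or> e = barc k i"
    by (rule arc_cases)
  then show "0 < weight e" using arc[OF ki(1) refl ki(2)] cum_Suc[of "Rs ! k" i] by auto
  have "farc k i \<in> set (trips ! (2 * k))"
    using ki by (simp add: nth_trips forward_trip_eq)
  moreover have "barc k i \<in> set (trips ! Suc (2 * k))"
  proof -
    have "i = len (Rs ! k) - Suc (len (Rs ! k) - Suc i)" "len (Rs ! k) - Suc i < len (Rs ! k)"
      using ki by auto
    then show ?thesis using ki(1) unfolding nth_trips[OF ki(1)] backward_trip_eq by force
  qed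
  moreover have "trips ! (2 * k) \<in> set trips" "trips ! Suc (2 * k) \<in> set trips"
    using ki length_trips by auto
  ultimately show "\<exists>T \<in> set trips. e \<in> set T" using ki(3) by blast
next
  fix T assume "T \<in> set trips"
  then obtain k where k: "k < length Rs"
    "T = forward_trip (off k) (len (Rs ! k)) \<or> T = backward_trip (off k) (len (Rs ! k))"
    by (rule trip_cases)
  then show "T \<noteq> []" using len_pos[of "Rs ! k"] by (auto simp: forward_trip_def backward_trip_def)
  show "\<exists>u v. awalk u T v" using k awalk_forward awalk_backward by blast
next
  fix v assume "v \<in> verts D"
  then obtain a where a: "a \<in> V" "v = code a" using code_bij by (auto simp: verts_D bij_betw_def)
  then obtain r i where r: "r \<in> set Rs" "i \<le> len r" "pos r i = a" using covered by blast
  then obtain k where k: "k < length Rs" "r = Rs ! k" by (metis in_set_conv_nth)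
  have "code (pos r i) \<in> set (trip_nodes D (trips ! (2 * k)))"
    unfolding trip_nodes_trips[OF k] using r(2) by (auto simp del: upt_Suc)
  moreover have "trips ! (2 * k) \<in> set trips" using k length_trips by auto
  ultimately show "\<exists>T \<in> set trips. v \<in> set (trip_nodes D T)" using a r by blast
qed

lemma valid_N: "valid_input N"
  unfolding valid_input_def by (rule trip_network_N)

text \<open>The two trips of route \<open>k\<close> have the indices \<open>2 * k\<close> and
  \<open>2 * k + 1\<close>, so exchanging the neighbours is the required involution.\<close>

lemma symmetric_N: "symmetric_trips D trips"
  unfolding symmetric_trips_def
proof (intro exI[of _ "\<lambda>i. if even i then Suc i else i - 1"] allI impI)
  fix i assume i: "i < length trips"
  then have k: "i div 2 < length Rs" by (simp add: length_trips)
  show "(if even i then Suc i else i - 1) < length trips \<and> (if even i then Suc i else i - 1) \<noteq> i \<and>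
    (if even (if even i then Suc i else i - 1) then Suc (if even i then Suc i else i - 1)
       else (if even i then Suc i else i - 1) - 1) = i \<and>
    trip_nodes D (trips ! (if even i then Suc i else i - 1)) = rev (trip_nodes D (trips ! i))"
  proof (cases "even i")
    case True
    then have "i = 2 * (i div 2)" by simp
    then obtain k where "i = 2 * k" "k < length Rs" using k by blast
    then show ?thesis using trip_nodes_trips[of k] length_trips by simp
  next
    case False
    then have "i = Suc (2 * (i div 2))" by presburger
    then obtain k where "i = Suc (2 * k)" "k < length Rs" using k by blast
    then show ?thesis using trip_nodes_trips[of k] length_trips by simp
  qed
qed

lemma route_reachable:
  assumes "r \<in> set Rs" "i \<le> len r" "j \<le> len r"
  shows "code (pos r i) \<rightarrow>\<^sup>*\<^bsub>D\<^esub> code (pos r j)"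
proof -
  obtain k where k: "k < length Rs" "r = Rs ! k" using assms by (metis in_set_conv_nth)
  have V: "code (pos r i) \<in> verts D" if "i \<le> len r" for i
    using code_lt[OF pos_in] assms that unfolding verts_D by auto
  have step: "code (pos r i) \<rightarrow>\<^sup>*\<^bsub>D\<^esub> code (pos r (Suc i))"
      "code (pos r (Suc i)) \<rightarrow>\<^sup>*\<^bsub>D\<^esub> code (pos r i)"
    if "i < len r" for i
    using in_arcs_imp_in_arcs_ends[OF arc(1)[OF k that]]
        in_arcs_imp_in_arcs_ends[OF arc(2)[OF k that]]
    arc[OF k that] by auto
  have "code (pos r 0) \<rightarrow>\<^sup>*\<^bsub>D\<^esub> code (pos r j) \<and> code (pos r j) \<rightarrow>\<^sup>*\<^bsub>D\<^esub> code (pos r 0)" if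
      "j \<le> len r" for j
    using that
  proof (induction j)
    case 0
    then show ?case using V by auto
  next
    case (Suc j)
    then show ?case using step[of j] by (auto intro: reachable_trans)
  qed
  then show ?thesis using assms(2,3) reachable_trans by blast
qed

lemma sum_cum: "r \<in> set Rs \<Longrightarrow> i \<le> len r \<Longrightarrow>
    (\<Sum>l<i. real (cum r (Suc l)) - real (cum r l)) = real (cum r i)"
  using sum_lessThan_telescope[of "\<lambda>l. real (cum r l)" i] cum_0[of r] by simp

lemma sum_cum_rev:
  assumes "i \<le> len r"
  shows "(\<Sum>l<i. real (cum r (Suc (len r - Suc l))) - real (cum r (len r - Suc l))) =
      real (cum r (len r)) - real (cum r (len r - i))"
  using assms
proof (induction i)
  case (Suc i)
  then have "Suc (len r - Suc i) = len r - i" by simp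
  then show ?case using Suc by simp
qed simp

lemma forward_temporal:
  assumes "k < length Rs" "r = Rs ! k" "i < len r"
  shows "(tail D (trips ! (2 * k) ! i), head D (trips ! (2 * k) ! i),
      \<tau> + (\<Sum>l<i. weight (trips ! (2 * k) ! l)), weight (trips ! (2 * k) ! i)) =
    (code (pos r i), code (pos r (Suc i)), \<tau> + real (cum r i), real (cum r (Suc i)) - real
        (cum r i))"
proof -
  have nth: "trips ! (2 * k) ! l = farc k l" if "l < len r" for l
    using that assms by (simp add: nth_trips forward_trip_eq)
  have "(\<Sum>l<i. weight (trips ! (2 * k) ! l)) = (\<Sum>l<i. real (cum r (Suc l)) - real (cum r l))"
    using assms(3) by (intro sum.cong refl) (simp add: nth arc(7)[OF assms(1,2)])
  also have "\<dots> = real (cum r i)" using assms by (intro sum_cum) auto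
  finally show ?thesis using arc[OF assms] nth[OF assms(3)] by simp
qed

lemma backward_temporal:
  assumes "k < length Rs" "r = Rs ! k" "i < len r"
  shows "(tail D (trips ! Suc (2 * k) ! i), head D (trips ! Suc (2 * k) ! i),
      \<tau> + (\<Sum>l<i. weight (trips ! Suc (2 * k) ! l)), weight (trips ! Suc (2 * k) ! i)) =
    (code (pos r (len r - i)), code (pos r (len r - Suc i)),
      \<tau> + real (cum r (len r)) - real (cum r (len r - i)),
      real (cum r (len r - i)) - real (cum r (len r - Suc i)))"
proof -
  have nth: "trips ! Suc (2 * k) ! l = barc k (len r - Suc l)" if "l < len r" for l
    using that assms by (simp add: nth_trips backward_trip_eq)
  have "(\<Sum>l<i. weight (trips ! Suc (2 * k) ! l)) =
      (\<Sum>l<i. real (cum r (Suc (len r - Suc l))) - real (cum r (len r - Suc l)))"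
    using assms(3) by (intro sum.cong refl) (simp add: nth arc(8)[OF assms(1,2)])
  also have "\<dots> = real (cum r (len r)) - real (cum r (len r - i))"
    using assms by (intro sum_cum_rev) auto
  finally show ?thesis
    using arc[OF assms(1,2), of "len r - Suc i"] nth[OF assms(3)] assms(3) Suc_diff_Suc[OF assms(3)]
    by simp
qed

text \<open>A backward trip starts at the far end, where \<open>cum\<close> is the total weight;
  adding this weight to its starting time gives the parameter \<open>b\<close> for which position
  \<open>i\<close> is passed at \<open>b k - cum i\<close>.\<close>

lemma temporal_edges_N:
  "temporal_edges D weight trips \<tau> =
    map_edges code (route_edges Rs (\<lambda>k. \<tau> (2 * k))
        (\<lambda>k. \<tau> (Suc (2 * k)) + real (cum (Rs ! k) (len (Rs ! k)))))"
  (is "?L = map_edges code (route_edges Rs ?f ?b)")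
proof (intro set_eqI iffI)
  fix e assume "e \<in> ?L"
  then obtain j i where j: "j < length trips" and i: "i < length (trips ! j)"
    and e: "e = (tail D (trips ! j ! i), head D (trips ! j ! i),
      \<tau> j + (\<Sum>l<i. weight (trips ! j ! l)), weight (trips ! j ! i))"
    unfolding temporal_edges_def by blast
  have "j = 2 * (j div 2) \<or> j = Suc (2 * (j div 2))" "j div 2 < length Rs"
    using j length_trips by (linarith, simp)
  then obtain k where k: "k < length Rs" and jk: "j = 2 * k \<or> j = Suc (2 * k)" by blast
  let ?r = "Rs ! k"
  show "e \<in> map_edges code (route_edges Rs ?f ?b)"
  proof (cases "j = 2 * k")
    case True
    then have i': "i < len ?r" using i k by (simp add: nth_trips forward_trip_eq)
    have "(pos ?r i, pos ?r (Suc i), ?f k + real (cum ?r i), real (cum ?r (Suc i)) - real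
        (cum ?r i)) \<in> route_edges Rs ?f ?b"
      unfolding route_edges_def using k i' by blast
    then show ?thesis unfolding e True forward_temporal[OF k refl i'] map_edges_def by force
  next
    case False
    then have j: "j = Suc (2 * k)" using jk by simp
    then have i': "i < len ?r" using i k by (simp add: nth_trips backward_trip_eq)
    let ?i = "len ?r - Suc i"
    have s: "Suc ?i = len ?r - i" "?i < len ?r" using i' by auto
    have "(pos ?r (Suc ?i), pos ?r ?i, ?b k - real (cum ?r (Suc ?i)),
        real (cum ?r (Suc ?i)) - real (cum ?r ?i)) \<in> route_edges Rs ?f ?b"
      unfolding route_edges_def using k s(2) by blast
    then show ?thesis unfolding e j backward_temporal[OF k refl i'] map_edges_def s(1) by force
  qed
next
  fix e assume "e \<in> map_edges code (route_edges Rs ?f ?b)"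
  then obtain k i where k: "k < length Rs" and i: "i < len (Rs ! k)"
    and e: "e = (code (pos (Rs ! k) i), code (pos (Rs ! k) (Suc i)), ?f k + real (cum (Rs ! k) i),
        real (cum (Rs ! k) (Suc i)) - real (cum (Rs ! k) i)) \<or>
      e = (code (pos (Rs ! k) (Suc i)), code (pos (Rs ! k) i), ?b k - real (cum (Rs ! k) (Suc i)),
        real (cum (Rs ! k) (Suc i)) - real (cum (Rs ! k) i))"
    unfolding map_edges_def route_edges_def by auto
  let ?r = "Rs ! k"
  from e show "e \<in> ?L"
  proof
    assume e: "e = (code (pos (Rs ! k) i), code (pos (Rs ! k) (Suc i)),
        ?f k + real (cum (Rs ! k) i),
        real (cum (Rs ! k) (Suc i)) - real (cum (Rs ! k) i))"
    have "2 * k < length trips" "i < length (trips ! (2 * k))"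
      using k i by (simp_all add: length_trips nth_trips forward_trip_def)
    then show ?thesis unfolding e forward_temporal[OF k refl i, symmetric] temporal_edges_def
        by blast
  next
    assume e: "e = (code (pos (Rs ! k) (Suc i)), code (pos (Rs ! k) i),
        ?b k - real (cum (Rs ! k) (Suc i)),
        real (cum (Rs ! k) (Suc i)) - real (cum (Rs ! k) i))"
    let ?i = "len ?r - Suc i"
    have s: "len ?r - ?i = Suc i" "?i < len ?r" "len ?r - Suc ?i = i" using i by auto
    have "Suc (2 * k) < length trips" "?i < length (trips ! Suc (2 * k))"
      using k i by (simp_all add: length_trips nth_trips backward_trip_def)
    then have "(tail D (trips ! Suc (2 * k) ! ?i), head D (trips ! Suc (2 * k) ! ?i),
      \<tau> (Suc (2 * k)) + (\<Sum>l<?i. weight (trips ! Suc (2 * k) ! l)),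
          weight (trips ! Suc (2 * k) ! ?i)) \<in> ?L"
      unfolding temporal_edges_def by blast
    then show ?thesis unfolding e backward_temporal[OF k refl s(2)] s .
  qed
qed

lemma route_edges_in_V: "(u, v, s, d) \<in> route_edges Rs f b \<Longrightarrow> u \<in> V \<and> v \<in> V"
  unfolding route_edges_def using pos_in nth_mem by (auto simp: Suc_le_eq)

lemma reachability_N:
  "reachability D weight trips \<tau> = card {(u, v). u \<in> V \<and> v \<in> V \<and>
    connects (route_edges Rs (\<lambda>k. \<tau> (2 * k)) (\<lambda>k. \<tau> (Suc (2 * k)) + real
        (cum (Rs ! k) (len (Rs ! k))))) u v}"
  (is "_ = card {(u, v). u \<in> V \<and> v \<in> V \<and> connects ?E u v}")
proof -
  have inj: "inj_on code V" and im: "code ` V = {..<n}" using code_bij by (auto simp: bij_betw_def)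
  have iff: "connects (map_edges code ?E) (code u) (code v) \<longleftrightarrow> connects ?E u v" if "u \<in> V"
      "v \<in> V" for u v
    by (rule connects_map[OF inj that]) (rule route_edges_in_V)
  have "{(u, v). u \<in> verts D \<and> v \<in> verts D \<and> connects (map_edges code ?E) u v} =
      map_prod code code ` {(u, v). u \<in> V \<and> v \<in> V \<and> connects ?E u v}"
    unfolding verts_D im[symmetric] using iff by (auto simp: image_iff) 
  moreover have "inj_on (map_prod code code) {(u, v). u \<in> V \<and> v \<in> V \<and> connects ?E u v}"
    using inj by (auto simp: inj_on_def)
  ultimately show ?thesis
    unfolding reachability_def temporal_edges_N connects_iff[symmetric] by (simp add: card_image)
qed

text \<open>Every pair \<open>f\<close>, \<open>b\<close> comes from a temporalisation, so all
  further arguments can use times at positions instead of starting times.\<close>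

lemma ex_reachability:
  "(\<exists>\<tau>. k \<le> reachability D weight trips \<tau>) \<longleftrightarrow>
    (\<exists>f b. k \<le> card {(u, v). u \<in> V \<and> v \<in> V \<and> connects (route_edges Rs f b) u v})"
proof
  assume "\<exists>f b. k \<le> card {(u, v). u \<in> V \<and> v \<in> V \<and> connects (route_edges Rs f b) u v}"
  then obtain f b where fb: "k \<le> card {(u, v). u \<in> V \<and> v \<in> V \<and> connects (route_edges Rs f b) u v}"
      by blast
  let ?\<tau> = "\<lambda>j. if even j then f (j div 2) else b (j div 2) - real
      (cum (Rs ! (j div 2)) (len (Rs ! (j div 2))))"
  have "k \<le> reachability D weight trips ?\<tau>" unfolding reachability_N using fb by simp
  then show "\<exists>\<tau>. k \<le> reachability D weight trips \<tau>" by blast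
qed (auto simp: reachability_N)

end

lemma forward_journey:
  assumes "k < length Rs" "r = Rs ! k" "i \<le> j" "j \<le> len r"
  shows "journey (route_edges Rs f b) (pos r i) (f k + cum r i) (pos r j) (f k + cum r j)"
  using assms(3,4)
proof (induction j rule: dec_induct)
  case base
  show ?case by (rule journey.wait) simp
next
  case (step j)
  then have "j < len r" by simp
  then have "(pos r j, pos r (Suc j), f k + real (cum r j), real (cum r (Suc j)) - real (cum r j))
      \<in> route_edges Rs f b"
    unfolding route_edges_def using assms(1,2) by blast
  from journey_trans[OF step.IH _ journey_edge[OF this]] show ?case using step.prems by simp
qed

lemma backward_journey:
  assumes "k < length Rs" "r = Rs ! k" "i \<le> j" "j \<le> len r"
  shows "journey (route_edges Rs f b) (pos r j) (b k - cum r j) (pos r i) (b k - cum r i)"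
  using assms(3,4)
proof (induction j rule: dec_induct)
  case base
  show ?case by (rule journey.wait) simp
next
  case (step j)
  then have "j < len r" by simp
  then have "(pos r (Suc j), pos r j, b k - real (cum r (Suc j)), real (cum r (Suc j)) - real
      (cum r j)) \<in> route_edges Rs f b"
    unfolding route_edges_def using assms(1,2) by blast
  from journey_trans[OF journey_edge[OF this] _ step.IH] show ?case using step.prems by simp
qed

section \<open>The trip network of a formula\<close>

definition satisfiable :: "(bool \<times> nat) list list \<Rightarrow> bool" where
  "satisfiable cls \<longleftrightarrow> (\<exists>A. \<forall>C \<in> set cls. \<exists>(s, v) \<in> set C. A v = s)"

text \<open>
  The nodes \<open>Nd c i\<close> of trip \<open>c\<close> form a block for \<open>i < L\<close>, the ports \<open>i = L\<close> and \<open>i = L + 1\<close> on both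
  sides of the hub, and a second block for larger \<open>i\<close>. The gadget of variable \<open>v\<close> is entered at
  \<open>Xn v 0\<close> by its positive and at \<open>Xn v 2\<close> by its negative occurrences.
\<close>

datatype node = Nd nat nat | Hub nat | Xn nat nat

fun node_code :: "nat \<Rightarrow> nat \<Rightarrow> node \<Rightarrow> nat" where
  "node_code m L (Nd c i) = c * (2 * L + 2) + i"
| "node_code m L (Hub j) = (m + 1) * (2 * L + 2) + j"
| "node_code m L (Xn v i) = (m + 1) * (2 * L + 2) + 2 + 4 * v + i"

definition node_count :: "nat \<Rightarrow> nat \<Rightarrow> nat \<Rightarrow> nat" where
  "node_count m nv L = (m + 1) * (2 * L + 2) + 2 + 4 * nv"

definition nodes :: "nat \<Rightarrow> nat \<Rightarrow> nat \<Rightarrow> node set" where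
  "nodes m nv L = {Nd c i | c i. c \<le> m \<and> i < 2 * L + 2} \<union> {Hub j | j. j < 2} \<union>
      {Xn v i | v i. v < nv \<and> i < 4}"

lemma bij_node_code: "bij_betw (node_code m L) (nodes m nv L) {..<node_count m nv L}"
proof -
  let ?P = "2 * L + 2" and ?Q = "(m + 1) * (2 * L + 2)"
  define dec where "dec x = (if x < ?Q then Nd (x div ?P) (x mod ?P) else
    if x < ?Q + 2 then Hub (x - ?Q) else Xn ((x - (?Q + 2)) div 4) ((x - (?Q + 2)) mod 4))" for x
  have lt: "c * ?P + i < ?Q" if "c \<le> m" "i < ?P" for c i
  proof -
    have "c * ?P + i < (c + 1) * ?P" using that(2) by simp
    also have "\<dots> \<le> ?Q" using that(1) by (intro mult_le_mono1) simp
    finally show ?thesis .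
  qed
  show ?thesis
  proof (rule bij_betw_byWitness[of _ dec])
    show "\<forall>a\<in>nodes m nv L. dec (node_code m L a) = a"
    proof
      fix a assume "a \<in> nodes m nv L"
      then consider (1) c i where "a = Nd c i" "c \<le> m" "i < ?P" | (2) j where "a = Hub j" "j < 2"
        | (3) v i where "a = Xn v i" "v < nv" "i < 4" by (auto simp: nodes_def)
      then show "dec (node_code m L a) = a"
      proof cases
        case 1
        have "(c * ?P + i) div ?P = c" "(c * ?P + i) mod ?P = i"
          using 1(3) div_mult_self3[of ?P c i] mod_mult_self3[of c ?P i] by
              (simp_all only: div_less mod_less add_0_right)
        then show ?thesis using 1 lt[of c i] unfolding dec_def by simp
      next
        case 2
        then show ?thesis by (simp add: dec_def)
      next
        case 3
        then show ?thesis by (simp add: dec_def)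
      qed
    qed
    show "\<forall>x\<in>{..<node_count m nv L}. node_code m L (dec x) = x"
    proof
      fix x assume "x \<in> {..<node_count m nv L}"
      have "4 * ((x - (?Q + 2)) div 4) + (x - (?Q + 2)) mod 4 = x - (?Q + 2)" by simp
      moreover have "(x div ?P) * ?P + x mod ?P = x" by (rule div_mult_mod_eq)
      ultimately show "node_code m L (dec x) = x"
        unfolding dec_def by auto
    qed
    show "node_code m L ` nodes m nv L \<subseteq> {..<node_count m nv L}"
    proof (rule image_subsetI)
      fix a assume "a \<in> nodes m nv L"
      then consider (1) c i where "a = Nd c i" "c \<le> m" "i < ?P" | (2) j where "a = Hub j" "j < 2"
        | (3) v i where "a = Xn v i" "v < nv" "i < 4" by (auto simp: nodes_def)
      then show "node_code m L a \<in> {..<node_count m nv L}"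
        by cases (use lt in \<open>fastforce simp: node_count_def\<close>)+
    qed
    show "dec ` {..<node_count m nv L} \<subseteq> nodes m nv L"
    proof
      fix a assume "a \<in> dec ` {..<node_count m nv L}"
      then obtain x where x: "x < node_count m nv L" "a = dec x" by blast
      have "x div ?P < m + 1" if "x < ?Q"
        using that by (simp add: less_mult_imp_div_less)
      moreover have "x mod ?P < ?P" by simp
      moreover have "(x - (?Q + 2)) div 4 < nv" if "\<not> x < ?Q + 2"
      proof -
        have "x - (?Q + 2) < nv * 4" using that x(1) by (simp add: node_count_def)
        then show ?thesis by (rule less_mult_imp_div_less)
      qed
      ultimately show "a \<in> nodes m nv L"
        unfolding x(2) dec_def nodes_def by (auto simp: less_Suc_eq_le)
    qed
  qed
qed

definition trip_hub :: "nat \<Rightarrow> nat \<Rightarrow> node" where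
  "trip_hub m c = Hub (if c = m then 1 else 0)"

definition trip_pos :: "nat \<Rightarrow> nat \<Rightarrow> nat \<Rightarrow> nat \<Rightarrow> node" where
  "trip_pos m L c i = (if i \<le> L then Nd c i else if i = L + 1 then trip_hub m c else Nd c (i - 1))"

text \<open>Weight 1 inside the blocks and 2 on either side of the hub, so that the two ports of a
  trip are 4 apart.\<close>

definition trip_cum :: "nat \<Rightarrow> nat \<Rightarrow> nat" where
  "trip_cum L i = (if i \<le> L then i else if i = L + 1 then L + 2 else i + 2)"

definition trip_route :: "nat \<Rightarrow> nat \<Rightarrow> nat \<Rightarrow> node route" where
  "trip_route m L c = Route (trip_pos m L c) (trip_cum L) (2 * L + 2)"

text \<open>The weights are 1, 2, 1. An outer edge between a literal edge of weight 2 and an exit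
  edge of weight 1 completes a path of length 4. The middle edge makes it too slow to enter at
  \<open>Xn v 2\<close> and go back to the exit at \<open>Xn v 1\<close>.\<close>

definition gadget_cum :: "nat \<Rightarrow> nat" where
  "gadget_cum i = (if i = 0 then 0 else if i = 1 then 1 else if i = 2 then 3 else 4)"

definition gadget_route :: "nat \<Rightarrow> node route" where
  "gadget_route v = Route (Xn v) gadget_cum 3"

fun light_route :: "node \<times> node \<times> nat \<Rightarrow> node route" where
  "light_route (a, b, w) = Route (\<lambda>i. if i = 0 then a else b) (\<lambda>i. if i = 0 then 0 else w) 1"

definition literal_node :: "bool \<times> nat \<Rightarrow> node" where
  "literal_node l = (case l of (s, v) \<Rightarrow> Xn v (if s then 0 else 2))"

text \<open>Each entry is a route of its own, hence its two directions can be timed freely. The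
  first two groups supply the missing links between ports and hubs; the other three form the literal
  paths around the gadgets.\<close>

definition lights :: "(bool \<times> nat) list list \<Rightarrow> nat \<Rightarrow> nat \<Rightarrow> (node \<times> node \<times> nat) list" where
  "lights cls nv L =
    map (\<lambda>c. (Nd c (L + 1), Hub 1, 2)) [0..<length cls] @
    [(Nd (length cls) L, Hub 0, 2)] @
    map (\<lambda>v. (Xn v 1, Nd (length cls) (L + 1), 1)) [0..<nv] @
    map (\<lambda>v. (Xn v 3, Nd (length cls) (L + 1), 1)) [0..<nv] @
    concat (map (\<lambda>c. map (\<lambda>l. (Nd c L, literal_node l, 2)) (cls ! c)) [0..<length cls])"

definition sat_routes :: "(bool \<times> nat) list list \<Rightarrow> nat \<Rightarrow> nat \<Rightarrow> node route list" where
  "sat_routes cls nv L = map (trip_route (length cls) L) [0..<length cls + 1] @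
    map gadget_route [0..<nv] @ map light_route (lights cls nv L)"

definition sat_input :: "(bool \<times> nat) list list \<Rightarrow> nat \<Rightarrow> nat \<Rightarrow> mrtt_input" where
  "sat_input cls nv L = route_input (node_code (length cls) L) (node_count (length cls) nv L)
      (sat_routes cls nv L)"

text \<open>Two blocks without any connection cost \<open>L * L\<close> pairs.\<close>

definition sat_bound :: "nat \<Rightarrow> nat \<Rightarrow> nat \<Rightarrow> nat" where
  "sat_bound m nv L = node_count m nv L * node_count m nv L - L * L + 1"

section \<open>Structure of the network of a formula\<close>

locale sat_network =
  fixes cls :: "(bool \<times> nat) list list" and nv L :: nat
  assumes L_pos: "0 < L" and vars: "C \<in> set cls \<Longrightarrow> (s, v) \<in> set C \<Longrightarrow> v < nv"
begin

abbreviation "m \<equiv> length cls"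
abbreviation "Rs \<equiv> sat_routes cls nv L"
abbreviation "V \<equiv> nodes m nv L"
abbreviation "n \<equiv> node_count m nv L"
abbreviation "Ls \<equiv> lights cls nv L"

lemma set_lights:
  "(a, b, w) \<in> set Ls \<longleftrightarrow>
    (\<exists>c<m. a = Nd c (L + 1) \<and> b = Hub 1 \<and> w = 2) \<or>
    (a = Nd m L \<and> b = Hub 0 \<and> w = 2) \<or>
    (\<exists>v<nv. (a = Xn v 1 \<or> a = Xn v 3) \<and> b = Nd m (L + 1) \<and> w = 1) \<or>
    (\<exists>c<m. \<exists>s v. (s, v) \<in> set (cls ! c) \<and> a = Nd c L \<and> b = Xn v (if s then 0 else 2) \<and> w = 2)"
proof -
  have 1: "(a, b, w) \<in> set (map (\<lambda>c. (Nd c (L + 1), Hub 1, 2)) [0..<m]) \<longleftrightarrow>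
      (\<exists>c<m. a = Nd c (L + 1) \<and> b = Hub 1 \<and> w = 2)" by auto
  have 2: "(a, b, w) \<in> set [(Nd m L, Hub 0, 2)] \<longleftrightarrow> a = Nd m L \<and> b = Hub 0 \<and> w = 2" by auto
  have 3: "(a, b, w) \<in> set (map (\<lambda>v. (Xn v i, Nd m (L + 1), 1)) [0..<nv]) \<longleftrightarrow>
      (\<exists>v<nv. a = Xn v i \<and> b = Nd m (L + 1) \<and> w = 1)" for i by auto
  have 4: "(a, b, w) \<in> set (concat (map (\<lambda>c. map (\<lambda>l. (Nd c L, literal_node l, 2)) (cls ! c))
      [0..<m])) \<longleftrightarrow>
      (\<exists>c<m. \<exists>s v. (s, v) \<in> set (cls ! c) \<and> a = Nd c L \<and> b = Xn v (if s then 0 else 2) \<and> w = 2)"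
  proof -
    have "(a, b, w) \<in> set (concat (map (\<lambda>c. map (\<lambda>l. (Nd c L, literal_node l, 2)) (cls ! c))
        [0..<m])) \<longleftrightarrow>
      (\<exists>c<m. \<exists>l \<in> set (cls ! c). a = Nd c L \<and> b = literal_node l \<and> w = 2)" by auto
    then show ?thesis unfolding Bex_def split_paired_Ex literal_node_def by simp
  qed
  show ?thesis
    unfolding lights_def set_append Un_iff 1 2 3 4 by blast
qed

lemma lights_in_V: "(a, b, w) \<in> set Ls \<Longrightarrow> a \<in> V \<and> b \<in> V \<and> 0 < w"
  unfolding set_lights
  by (elim disjE exE conjE) (use vars nth_mem[of _ cls] in \<open>fastforce simp: nodes_def\<close>)+

lemma set_sat_routes:
  "set Rs = trip_route m L ` {..m} \<union> gadget_route ` {..<nv} \<union> light_route ` set Ls"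
proof -
  have "set [0..<m + 1] = {..m}" "set [0..<nv] = {..<nv}" by auto
  then show ?thesis unfolding sat_routes_def set_append set_map by (simp only: Un_assoc)
qed

lemma trip_route_sel [simp]:
  "pos (trip_route m' L c) = trip_pos m' L c" "cum (trip_route m' L c) = trip_cum L"
  "len (trip_route m' L c) = 2 * L + 2"
  by (simp_all add: trip_route_def)

lemma gadget_route_sel [simp]:
  "pos (gadget_route v) = Xn v" "cum (gadget_route v) = gadget_cum" "len (gadget_route v) = 3"
  by (simp_all add: gadget_route_def)

sublocale rs: route_system "node_code m L" V Rs n
proof
  show "bij_betw (node_code m L) V {..<n}" by (rule bij_node_code)
next
  fix r i assume r: "r \<in> set Rs" and i: "i \<le> len r"
  show "pos r i \<in> V"
    using r[unfolded set_sat_routes]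
  proof (elim UnE imageE)
    fix c assume "r = trip_route m L c" "c \<in> {..m}"
    then show ?thesis using i by (auto simp: trip_pos_def trip_hub_def nodes_def)
  next
    fix v assume "r = gadget_route v" "v \<in> {..<nv}"
    then show ?thesis using i by (auto simp: nodes_def)
  next
    fix e assume e: "r = light_route e" "e \<in> set Ls"
    obtain a b w where "e = (a, b, w)" by (metis surj_pair)
    then show ?thesis using e lights_in_V by auto
  qed
next
  fix r assume r: "r \<in> set Rs"
  show "0 < len r" "cum r 0 = 0"
    using r unfolding set_sat_routes by (auto simp: trip_cum_def gadget_cum_def)
next
  fix r i assume r: "r \<in> set Rs" and i: "i < len r"
  show "cum r i < cum r (Suc i)"
    using r[unfolded set_sat_routes]
  proof (elim UnE imageE)
    fix c assume "r = trip_route m L c" "c \<in> {..m}"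
    then show ?thesis by (auto simp: trip_cum_def)
  next
    fix v assume "r = gadget_route v" "v \<in> {..<nv}"
    then show ?thesis using i by (auto simp: gadget_cum_def)
  next
    fix e assume e: "r = light_route e" "e \<in> set Ls"
    obtain a b w where "e = (a, b, w)" by (metis surj_pair)
    then show ?thesis using e lights_in_V i by auto
  qed
next
  fix a assume "a \<in> V"
  then consider (1) c i where "a = Nd c i" "c \<le> m" "i < 2 * L + 2" | (2) j where "a = Hub j" "j < 2"
    | (3) v i where "a = Xn v i" "v < nv" "i < 4" by (auto simp: nodes_def)
  then show "\<exists>r \<in> set Rs. \<exists>i \<le> len r. pos r i = a"
  proof cases
    case 1
    then have "trip_route m L c \<in> set Rs" by (auto simp: set_sat_routes)
    moreover have "trip_pos m L c (if i \<le> L then i else i + 1) = a" by (auto simp: trip_pos_def 1)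
    ultimately show ?thesis using 1
      by (intro bexI[of _ "trip_route m L c"] exI[of _ "if i \<le> L then i else i + 1"]) auto
  next
    case 2
    then consider "j = 0" | "j = 1" by linarith
    then show ?thesis
    proof cases
      case 1
      have e: "(Nd m L, Hub 0, 2) \<in> set Ls" by (simp add: set_lights)
      then have "light_route (Nd m L, Hub 0, 2) \<in> set Rs" unfolding set_sat_routes by
          (metis UnI2 imageI)
      then show ?thesis using 1 2 by (intro bexI[of _ "light_route (Nd m L, Hub 0, 2)"]
          exI[of _ 1]) auto
    next
      case 2
      have "trip_route m L m \<in> set Rs" by (auto simp: set_sat_routes)
      then show ?thesis using 2 \<open>a = Hub j\<close>
        by (intro bexI[of _ "trip_route m L m"] exI[of _ "L + 1"])
            (auto simp: trip_pos_def trip_hub_def)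
    qed
  next
    case 3
    then have "gadget_route v \<in> set Rs" by (auto simp: set_sat_routes)
    then show ?thesis using 3 by (intro bexI[of _ "gadget_route v"] exI[of _ i]) auto
  qed
qed

lemma sat_input_eq: "sat_input cls nv L = rs.N"
  by (simp add: sat_input_def)

text \<open>Since every route is traversed both ways, it is enough to link each node to
  \<open>Hub 0\<close>. Trip \<open>m\<close> gets there over the edge from its left port, and the
  gadgets get there over the right port of trip \<open>m\<close>.\<close>

lemma strongly_connected_sat: "strongly_connected (input_digraph (sat_input cls nv L))"
proof -
  let ?c = "node_code m L"
  define conn where "conn a b \<longleftrightarrow> ?c a \<rightarrow>\<^sup>*\<^bsub>rs.D\<^esub> ?c b \<and> ?c b \<rightarrow>\<^sup>*\<^bsub>rs.D\<^esub> ?c a" for a b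
  have route: "conn (pos r i) (pos r j)" if "r \<in> set Rs" "i \<le> len r" "j \<le> len r" for r i j
    using rs.route_reachable that unfolding conn_def by blast
  have trans: "conn a b \<Longrightarrow> conn b c \<Longrightarrow> conn a c" for a b c
    unfolding conn_def using rs.reachable_trans by blast
  have trip: "conn (Nd c i) (trip_hub m c)" if "c \<le> m" "i < 2 * L + 2" for c i
  proof -
    have "trip_route m L c \<in> set Rs" using that by (auto simp: set_sat_routes)
    note r = route[OF this, where j = "L + 1"]
    show ?thesis
    proof (cases "i \<le> L")
      case True
      then show ?thesis using r[of i] by (simp add: trip_pos_def)
    next
      case False
      then show ?thesis using r[of "i + 1"] that by (simp add: trip_pos_def)
    qed
  qed
  have light: "conn a b" if "(a, b, w) \<in> set Ls" for a b w
  proof -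
    have "light_route (a, b, w) \<in> set Rs" using that unfolding set_sat_routes by (metis UnI2 imageI)
    from route[OF this, of 0 1] show ?thesis by simp
  qed
  have sym: "conn a b \<Longrightarrow> conn b a" for a b unfolding conn_def by blast
  have l0: "conn (Nd m L) (Hub 0)" by (rule light[of _ _ 2]) (simp add: set_lights)
  have h1: "conn (Hub 1) (Hub 0)"
    using trans[OF sym[OF trip[of m L]] l0] by (simp add: trip_hub_def)
  have hub: "conn (trip_hub m c) (Hub 0)" for c
  proof (cases "c = m")
    case True
    then show ?thesis using h1 by (simp add: trip_hub_def)
  next
    case False
    have "conn (Hub 0) (Hub 0)" using trans[OF sym[OF h1] h1] .
    then show ?thesis using False by (simp add: trip_hub_def)
  qed
  have nd: "conn (Nd c i) (Hub 0)" if "c \<le> m" "i < 2 * L + 2" for c i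
    using trans[OF trip[OF that] hub] .
  have hub0: "conn a (Hub 0)" if "a \<in> V" for a
  proof -
    from that consider (1) c i where "a = Nd c i" "c \<le> m" "i < 2 * L + 2" | (2) j where
        "a = Hub j" "j < 2"
      | (3) v i where "a = Xn v i" "v < nv" "i < 4" by (auto simp: nodes_def)
    then show ?thesis
    proof cases
      case 1
      then show ?thesis using nd by simp
    next
      case 2
      then consider "j = 0" | "j = 1" by linarith
      then show ?thesis using 2(1) h1 trans[OF sym[OF h1] h1] by cases simp_all
    next
      case 3
      then have "gadget_route v \<in> set Rs" by (auto simp: set_sat_routes)
      from route[OF this, of i 1] have "conn (Xn v i) (Xn v 1)" using 3 by simp
      moreover have "conn (Xn v 1) (Nd m (L + 1))" by (rule light[of _ _ 1])
          (use 3 in \<open>simp add: set_lights\<close>)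
      ultimately have "conn (Xn v i) (Nd m (L + 1))" by (rule trans)
      then have "conn (Xn v i) (Hub 0)" by (rule trans) (simp add: nd)
      then show ?thesis using 3 by simp
    qed
  qed
  have all: "conn a b" if "a \<in> V" "b \<in> V" for a b
    using trans[OF hub0[OF that(1)] sym[OF hub0[OF that(2)]]] .
  show ?thesis unfolding sat_input_eq
  proof (rule strongly_connectedI)
    show "verts rs.D \<noteq> {}" unfolding rs.verts_D by (auto simp: node_count_def)
    fix x y assume "x \<in> verts rs.D" "y \<in> verts rs.D"
    then have "x \<in> ?c ` V" "y \<in> ?c ` V"
      using bij_node_code[of m L nv] unfolding rs.verts_D bij_betw_def by simp_all
    then obtain a b where ab: "a \<in> V" "b \<in> V" "x = ?c a" "y = ?c b" by (elim imageE)
    show "x \<rightarrow>\<^sup>*\<^bsub>rs.D\<^esub> y" using all[OF ab(1,2)] unfolding conn_def ab(3,4) by (rule conjunct1)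
  qed
qed

lemma length_Rs: "length Rs = m + 1 + nv + length Ls"
  by (simp add: sat_routes_def)

lemma nth_Rs:
  "c \<le> m \<Longrightarrow> Rs ! c = trip_route m L c"
  "v < nv \<Longrightarrow> Rs ! (m + 1 + v) = gadget_route v"
  "k < length Ls \<Longrightarrow> Rs ! (m + 1 + nv + k) = light_route (Ls ! k)"
  by (auto simp: sat_routes_def nth_append less_Suc_eq_le)

section \<open>From high reachability to a satisfying assignment\<close>

lemma route_edge_cases:
  assumes "(u, w, s, d) \<in> route_edges Rs f b"
  obtains (trip) c i where "c \<le> m" "i < 2 * L + 2" "d = real (trip_cum L (Suc i)) - real
      (trip_cum L i)"
      "u = trip_pos m L c i \<and> w = trip_pos m L c (Suc i) \<and> s = f c + real (trip_cum L i) \<or>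
       u = trip_pos m L c (Suc i) \<and> w = trip_pos m L c i"
  | (gadget) v i where "v < nv" "i < 3" "d = real (gadget_cum (Suc i)) - real (gadget_cum i)"
      "u = Xn v i \<and> w = Xn v (Suc i) \<and> s = f (m + 1 + v) + real (gadget_cum i) \<or> u =
          Xn v (Suc i) \<and> w = Xn v i"
  | (light) x y e where "(x, y, e) \<in> set Ls" "d = real e" "u = x \<and> w = y \<or> u = y \<and> w = x"
proof -
  obtain k i where k: "k < length Rs" "i < len (Rs ! k)"
    and d: "d = real (cum (Rs ! k) (Suc i)) - real (cum (Rs ! k) i)"
    and e: "u = pos (Rs ! k) i \<and> w = pos (Rs ! k) (Suc i) \<and> s = f k + real (cum (Rs ! k) i) \<or>
      u = pos (Rs ! k) (Suc i) \<and> w = pos (Rs ! k) i"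
    using assms unfolding route_edges_def by blast
  consider "k \<le> m" | v where "k = m + 1 + v" "v < nv" | j where "k = m + 1 + nv + j" "j < length Ls"
  proof -
    have "k \<le> m \<or> (k = m + 1 + (k - (m + 1)) \<and> k - (m + 1) < nv) \<or>
        (k = m + 1 + nv + (k - (m + 1 + nv)) \<and> k - (m + 1 + nv) < length Ls)"
      using k(1) unfolding length_Rs by linarith
    then show ?thesis using that by blast
  qed
  then show ?thesis
  proof cases
    case 1
    show ?thesis by (rule trip[of k i]) (use 1 k d e in \<open>auto simp: nth_Rs(1)[OF 1]\<close>)
  next
    case (2 v)
    note eq = nth_Rs(2)[OF 2(2), folded 2(1)]
    show ?thesis by (rule gadget[of v i]) (use 2 k(2)[unfolded eq] d[unfolded eq] e[unfolded eq]
        in simp_all)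
  next
    case (3 j)
    note eq = nth_Rs(3)[OF 3(2), folded 3(1)]
    obtain x y w' where l: "Ls ! j = (x, y, w')" by (metis surj_pair)
    then have "(x, y, w') \<in> set Ls" using 3(2) by (metis nth_mem)
    then show ?thesis by (rule light[of x y w'])
        (use k(2)[unfolded eq l] d[unfolded eq l] e[unfolded eq l] in auto)
  qed
qed

text \<open>Only the forward trips over hubs and through gadgets are held to their timetable
  \<open>f\<close>. Backward trips and single edges may depart at any time, which eliminates
  \<open>b\<close> from the arguments and is still restrictive enough for the lower bounds.\<close>

lemma invariant_preserved:
  fixes I :: "node \<Rightarrow> real \<Rightarrow> bool" and f b :: "nat \<Rightarrow> real"
  assumes edge: "(u, w, s, d) \<in> route_edges Rs f b" and t: "t \<le> s" and I: "I u t"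
    and out_left: "\<And>c i t. c \<le> m \<Longrightarrow> i < L \<Longrightarrow> I (Nd c i) t \<Longrightarrow> t \<le> f c + i \<Longrightarrow>
        I (Nd c (Suc i)) (f c + i + 1)"
    and out_hub: "\<And>c t. c \<le> m \<Longrightarrow> I (Nd c L) t \<Longrightarrow> t \<le> f c + L \<Longrightarrow> I (trip_hub m c) (f c + L + 2)"
    and hub_out: "\<And>c t. c \<le> m \<Longrightarrow> I (trip_hub m c) t \<Longrightarrow> t \<le> f c + L + 2 \<Longrightarrow>
        I (Nd c (L + 1)) (f c + L + 4)"
    and out_right: "\<And>c i t. c \<le> m \<Longrightarrow> L < i \<Longrightarrow> i \<le> 2 * L \<Longrightarrow> I (Nd c i) t \<Longrightarrow> t \<le> f c + i + 3 \<Longrightarrow>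
        I (Nd c (Suc i)) (f c + i + 4)"
    and ret: "\<And>c i t s. c \<le> m \<Longrightarrow> i \<noteq> L \<Longrightarrow> I (Nd c (Suc i)) t \<Longrightarrow> t \<le> s \<Longrightarrow> I (Nd c i) (s + 1)"
    and ret_hub: "\<And>c t s. c \<le> m \<Longrightarrow> I (trip_hub m c) t \<Longrightarrow> t \<le> s \<Longrightarrow> I (Nd c L) (s + 2)"
    and hub_ret: "\<And>c t s. c \<le> m \<Longrightarrow> I (Nd c (L + 1)) t \<Longrightarrow> t \<le> s \<Longrightarrow> I (trip_hub m c) (s + 2)"
    and gadget: "\<And>v t. v < nv \<Longrightarrow> I (Xn v 0) t \<Longrightarrow> t \<le> f (m + 1 + v) \<Longrightarrow> I (Xn v 1) (f (m + 1 + v) + 1)"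
      "\<And>v t s. v < nv \<Longrightarrow> I (Xn v 1) t \<Longrightarrow> t \<le> s \<Longrightarrow> I (Xn v 2) (s + 2)"
      "\<And>v t. v < nv \<Longrightarrow> I (Xn v 2) t \<Longrightarrow> t \<le> f (m + 1 + v) + 3 \<Longrightarrow> I (Xn v 3) (f (m + 1 + v) + 4)"
      "\<And>v t s. v < nv \<Longrightarrow> I (Xn v 1) t \<Longrightarrow> t \<le> s \<Longrightarrow> I (Xn v 0) (s + 1)"
      "\<And>v t s. v < nv \<Longrightarrow> I (Xn v 2) t \<Longrightarrow> t \<le> s \<Longrightarrow> I (Xn v 1) (s + 2)"
      "\<And>v t s. v < nv \<Longrightarrow> I (Xn v 3) t \<Longrightarrow> t \<le> s \<Longrightarrow> I (Xn v 2) (s + 1)"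
    and light: "\<And>x y e t s. (x, y, e) \<in> set Ls \<Longrightarrow> I x t \<Longrightarrow> t \<le> s \<Longrightarrow> I y (s + e)"
      "\<And>x y e t s. (x, y, e) \<in> set Ls \<Longrightarrow> I y t \<Longrightarrow> t \<le> s \<Longrightarrow> I x (s + e)"
  shows "I w (s + d)"
  using edge
proof (cases rule: route_edge_cases)
  case (trip c i)
  consider "i < L" | "i = L" | "i = L + 1" | j where "i = j + 1" "L < j" "j \<le> 2 * L"
  proof -
    have "i < L \<or> i = L \<or> i = L + 1 \<or> (i = (i - 1) + 1 \<and> L < i - 1 \<and> i - 1 \<le> 2 * L)"
      using trip(2) by linarith
    then show ?thesis using that by blast
  qed
  then show ?thesis
  proof cases
    case 1
    then have d: "d = 1" using trip by (simp add: trip_cum_def)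
    from trip(4) show ?thesis
    proof
      assume "u = trip_pos m L c i \<and> w = trip_pos m L c (Suc i) \<and> s = f c + real (trip_cum L i)"
      then show ?thesis using 1 trip(1) I t out_left[of c i t] d by
          (simp add: trip_pos_def trip_cum_def)
    next
      assume "u = trip_pos m L c (Suc i) \<and> w = trip_pos m L c i"
      then show ?thesis using 1 trip(1) I t ret[of c i t s] d by (simp add: trip_pos_def)
    qed
  next
    case 2
    then have d: "d = 2" using trip by (simp add: trip_cum_def)
    from trip(4) show ?thesis
    proof
      assume "u = trip_pos m L c i \<and> w = trip_pos m L c (Suc i) \<and> s = f c + real (trip_cum L i)"
      then show ?thesis using 2 trip(1) I t out_hub[of c t] d by
          (simp add: trip_pos_def trip_cum_def)
    next
      assume "u = trip_pos m L c (Suc i) \<and> w = trip_pos m L c i"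
      then show ?thesis using 2 trip(1) I t ret_hub[of c t s] d by (simp add: trip_pos_def)
    qed
  next
    case 3
    then have d: "d = 2" using trip by (simp add: trip_cum_def)
    from trip(4) show ?thesis
    proof
      assume "u = trip_pos m L c i \<and> w = trip_pos m L c (Suc i) \<and> s = f c + real (trip_cum L i)"
      then show ?thesis using 3 trip(1) I t hub_out[of c t] d by
          (simp add: trip_pos_def trip_cum_def algebra_simps)
    next
      assume "u = trip_pos m L c (Suc i) \<and> w = trip_pos m L c i"
      then show ?thesis using 3 trip(1) I t hub_ret[of c t s] d by (simp add: trip_pos_def)
    qed
  next
    case (4 j)
    then have d: "d = 1" using trip by (simp add: trip_cum_def)
    from trip(4) show ?thesis
    proof
      assume "u = trip_pos m L c i \<and> w = trip_pos m L c (Suc i) \<and> s = f c + real (trip_cum L i)"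
      then show ?thesis using 4 trip(1) I t out_right[of c j t] d by
          (simp add: trip_pos_def trip_cum_def algebra_simps)
    next
      assume "u = trip_pos m L c (Suc i) \<and> w = trip_pos m L c i"
      then show ?thesis using 4 trip(1) I t ret[of c j t s] d by (simp add: trip_pos_def)
    qed
  qed
next
  case (gadget v i)
  then consider "i = 0" | "i = 1" | "i = 2" by linarith
  then show ?thesis
  proof cases
    case 1
    then show ?thesis using gadget I t assms(11,14)[of v t] by (auto simp: gadget_cum_def)
  next
    case 2
    then show ?thesis using gadget I t assms(12,15)[of v t] by
        (auto simp: gadget_cum_def numeral_2_eq_2)
  next
    case 3
    then show ?thesis using gadget I t assms(13,16)[of v t] by
        (auto simp: gadget_cum_def numeral_2_eq_2 numeral_3_eq_3 add.assoc)
  qed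
next
  case (light x y e)
  then show ?thesis using I t assms(17,18) by auto
qed


text \<open>The left block of trip \<open>m\<close> can be left only by riding that trip, and the
  right block of \<open>c\<close> can be entered only by riding trip \<open>c\<close> from its right
  port. The ports are 4 apart, which is also the time each trip takes from its left to its right
  port.\<close>

lemma right_trip_not_earlier:
  assumes "connects (route_edges Rs f b) (Nd m i) (Nd c j)" "i < L" "c < m" "L + 2 \<le> j"
  shows "f m \<le> f c"
proof (rule ccontr)
  assume less: "\<not> f m \<le> f c"
  define \<theta> where "\<theta> = f m + real L"
  \<comment> \<open>The time \<open>\<theta>\<close> is when trip \<open>m\<close> leaves its left
    port. Hubs are 2 and other ports at least 4 away from there; the bound 3 at gadget nodes is not
    tight but is preserved by all edges. The right block of \<open>c\<close> is declared
    unreachable.\<close>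
  define I where "I a t = (case a of
      Nd d i \<Rightarrow> if d = m then (if i < L then True else if i = L then \<theta> \<le> t else \<theta> + 4 \<le> t)
        else if d = c \<and> L + 2 \<le> i then False else \<theta> + 4 \<le> t
    | Hub j \<Rightarrow> \<theta> + 2 \<le> t | Xn v i \<Rightarrow> \<theta> + 3 \<le> t)" for a t
  obtain t t' where J: "journey (route_edges Rs f b) (Nd m i) t (Nd c j) t'"
    using assms(1) by (auto simp: connects_def)
  have "\<exists>t. I (Nd c j) t"
  proof (rule journey_invariant[OF J])
    show "I (Nd m i) t" using assms by (simp add: I_def)
    fix u w s d t assume e: "(u, w, s, d) \<in> route_edges Rs f b" "t \<le> s" "I u t"
    show "I w (s + d)"
    proof (rule invariant_preserved[where I = I, OF e])
      fix d i t assume "d \<le> m" "i < L" "I (Nd d i) t" "t \<le> f d + real i"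
      then show "I (Nd d (Suc i)) (f d + real i + 1)"
        by (auto simp: I_def \<theta>_def split: if_splits dest: less_antisym)
    next
      fix d t assume "d \<le> m" "I (Nd d L) t" "t \<le> f d + real L"
      then show "I (trip_hub m d) (f d + real L + 2)"
        by (auto simp: I_def \<theta>_def trip_hub_def split: if_splits)
    next
      fix d t assume "d \<le> m" "I (trip_hub m d) t" "t \<le> f d + real L + 2"
      then show "I (Nd d (L + 1)) (f d + real L + 4)"
        by (auto simp: I_def \<theta>_def trip_hub_def split: if_splits)
    next
      \<comment> \<open>At the right port of \<open>c\<close> the departure time is
        \<open>f c + L + 4\<close>, which is less than \<open>\<theta> + 4\<close>: the trip has
        been missed.\<close>
      fix d i t assume "d \<le> m" "L < i" "i \<le> 2 * L" "I (Nd d i) t" "t \<le> f d + real i + 3"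
      moreover have "real i = real L + 1" if "i = L + 1" using that by simp
      moreover have "i = L + 1" if "L < i" "\<not> L + 2 \<le> i" using that by simp
      ultimately show "I (Nd d (Suc i)) (f d + real i + 4)"
        using less by (auto simp: I_def \<theta>_def split: if_splits)
    next
      fix x y e t s assume "(x, y, e) \<in> set Ls" "I x t" "t \<le> s"
      then show "I y (s + real e)"
        unfolding set_lights by (auto simp: I_def)
    next
      fix x y e t s assume "(x, y, e) \<in> set Ls" "I y t" "t \<le> s"
      then show "I x (s + real e)"
        unfolding set_lights by (auto simp: I_def)
    qed (auto simp: I_def trip_hub_def split: if_splits)
  qed
  then show False using assms by (auto simp: I_def)
qed

text \<open>
  Unless a gadget trip runs exactly when the trip of the clause can use it, every journey arrives
  at the right port of trip \<open>m\<close> after that trip has left; the invariant bounds the arrival times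
  at all nodes from below.
\<close>

lemma clause_needs_gadget:
  assumes "connects (route_edges Rs f b) (Nd c i) (Nd m j)" "i < L" "c < m" "L + 2 \<le> j" "f m \<le> f c"
  shows "\<exists>(s, v) \<in> set (cls ! c). f (m + 1 + v) = f m + real L + (if s then 2 else - 1)"
proof (rule ccontr)
  assume "\<not> ?thesis"
  \<comment> \<open>The two excluded values are those for which the gadget trip leaves
    \<open>Xn v 0\<close>, or \<open>Xn v 2\<close> three units later, at time
    \<open>f m + L + 2\<close>. This is when a literal edge taken at \<open>f m + L\<close>
    arrives.\<close>
  then have none: "f (m + 1 + v) \<noteq> f m + real L + (if s then 2 else - 1)" if
      "(s, v) \<in> set (cls ! c)" for s v
    using that by blast
  define \<theta> where "\<theta> = f m + real L"
  \<comment> \<open>Trip \<open>m\<close> leaves its right port at \<open>\<theta> + 4\<close>, so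
    this port needs a strict bound. Strictness must then hold at its neighbours:
    \<open>Hub 1\<close> two units before and the gadget exits one unit before. Entrances of
    literals of the clause can be reached exactly at \<open>\<theta> + 2\<close>, all other
    entrances only at \<open>\<theta> + 4\<close> or later.\<close>
  define I where "I a t = (case a of
      Nd d i \<Rightarrow> if d = c then (if i < L then True else if i = L then \<theta> \<le> t else \<theta> + 4 \<le> t)
        else if d = m \<and> i = L + 1 then \<theta> + 4 < t else if d = m \<and> L + 2 \<le> i then False else \<theta> + 4 \<le> t
    | Hub j \<Rightarrow> if j = 0 then \<theta> + 2 \<le> t else \<theta> + 2 < t
    | Xn v i \<Rightarrow> if i = 0 then (if (True, v) \<in> set (cls ! c) then \<theta> + 2 \<le> t else \<theta> + 4 \<le> t)
        else if i = 2 then (if (False, v) \<in> set (cls ! c) then \<theta> + 2 \<le> t else \<theta> + 4 \<le> t)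
        else \<theta> + 3 < t)" for a t
  obtain t t' where J: "journey (route_edges Rs f b) (Nd c i) t (Nd m j) t'"
    using assms(1) by (auto simp: connects_def)
  have "\<exists>t. I (Nd m j) t"
  proof (rule journey_invariant[OF J])
    show "I (Nd c i) t" using assms by (simp add: I_def)
    fix u w s d t assume e: "(u, w, s, d) \<in> route_edges Rs f b" "t \<le> s" "I u t"
    show "I w (s + d)"
    proof (rule invariant_preserved[where I = I, OF e])
      fix d i t assume "d \<le> m" "i < L" "I (Nd d i) t" "t \<le> f d + real i"
      moreover have "real (Suc i) = real L" if "Suc i = L" using that by simp
      ultimately show "I (Nd d (Suc i)) (f d + real i + 1)"
        using assms(5) by (auto simp: I_def \<theta>_def split: if_splits)
    next
      fix d t assume "d \<le> m" "I (Nd d L) t" "t \<le> f d + real L"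
      then show "I (trip_hub m d) (f d + real L + 2)"
        using assms(3,5) by (auto simp: I_def \<theta>_def trip_hub_def split: if_splits)
    next
      fix d t assume "d \<le> m" "I (trip_hub m d) t" "t \<le> f d + real L + 2"
      then show "I (Nd d (L + 1)) (f d + real L + 4)"
        using assms(3,5) by (auto simp: I_def \<theta>_def trip_hub_def split: if_splits)
    next
      fix d i t assume "d \<le> m" "L < i" "i \<le> 2 * L" "I (Nd d i) t" "t \<le> f d + real i + 3"
      moreover have "real i = real L + 1" if "i = L + 1" using that by simp
      moreover have "i = L + 1" if "L < i" "\<not> L + 2 \<le> i" using that by simp
      ultimately show "I (Nd d (Suc i)) (f d + real i + 4)"
        by (auto simp: I_def \<theta>_def split: if_splits)
    next
      \<comment> \<open>For a literal of the clause, boarding forces a departure at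
        \<open>\<theta> + 2\<close> or later, and \<open>none\<close> excludes equality. For other
        entrances the bound is large enough already.\<close>
      fix v t assume "v < nv" "I (Xn v 0) t" "t \<le> f (m + 1 + v)"
      then show "I (Xn v 1) (f (m + 1 + v) + 1)"
        using none[of True v] by (auto simp: I_def \<theta>_def split: if_splits)
    next
      fix v t assume "v < nv" "I (Xn v 2) t" "t \<le> f (m + 1 + v) + 3"
      then show "I (Xn v 3) (f (m + 1 + v) + 4)"
        using none[of False v] by (auto simp: I_def \<theta>_def split: if_splits)
    next
      fix x y e t s assume "(x, y, e) \<in> set Ls" "I x t" "t \<le> s"
      then show "I y (s + real e)"
        unfolding set_lights using assms(3) by (auto simp: I_def split: if_splits)
    next
      fix x y e t s assume "(x, y, e) \<in> set Ls" "I y t" "t \<le> s"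
      then show "I x (s + real e)"
        unfolding set_lights using assms(3) by (auto simp: I_def split: if_splits)
    qed (use assms(3) in \<open>auto simp: I_def trip_hub_def split: if_splits\<close>)
  qed
  then show False using assms by (auto simp: I_def)
qed


lemma finite_V: "finite V" and card_V: "card V = n"
  using bij_betw_finite[OF bij_node_code[of m L nv]]
      bij_betw_same_card[OF bij_node_code[of m L nv]] by auto

lemma block_connected:
  assumes "sat_bound m nv L \<le> card {(u, v). u \<in> V \<and> v \<in> V \<and> P u v}"
    and "B \<subseteq> V" "B' \<subseteq> V" "card B = L" "card B' = L"
  shows "\<exists>u \<in> B. \<exists>v \<in> B'. P u v"
proof (rule ccontr)
  assume "\<not> ?thesis"
  then have "{(u, v). u \<in> V \<and> v \<in> V \<and> P u v} \<subseteq> V \<times> V - B \<times> B'" by blast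
  then have "card {(u, v). u \<in> V \<and> v \<in> V \<and> P u v} \<le> card (V \<times> V - B \<times> B')"
    using finite_V by (intro card_mono) auto
  also have "\<dots> = card (V \<times> V) - card (B \<times> B')"
    using assms(2,3) finite_V by (intro card_Diff_subset) (auto intro: finite_subset)
  also have "\<dots> = n * n - L * L" using assms(4,5) card_V by (simp add: card_cartesian_product)
  finally show False using assms(1) by (simp add: sat_bound_def)
qed

lemma satisfiable_if_reachable:
  assumes "sat_bound m nv L \<le> card {(u, v). u \<in> V \<and> v \<in> V \<and> connects (route_edges Rs f b) u v}"
  shows "satisfiable cls"
proof -
  let ?l = "\<lambda>c. Nd c ` {..<L}" and ?r = "\<lambda>c. Nd c ` {L + 2..<2 * L + 2}"
  have blocks: "?l c \<subseteq> V" "?r c \<subseteq> V" "card (?l c) = L" "card (?r c) = L" if "c \<le> m" for c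
    using that by (auto simp: nodes_def card_image inj_on_def)
  have *: "\<exists>(s, v) \<in> set (cls ! c). f (m + 1 + v) = f m + real L + (if s then 2 else - 1)" if c:
      "c < m" for c
  proof -
    obtain i j where "i < L" "L + 2 \<le> j" "connects (route_edges Rs f b) (Nd m i) (Nd c j)"
      using block_connected[OF assms, of "?l m" "?r c"] blocks[of m] blocks[of c] c by auto
    then have le: "f m \<le> f c" using right_trip_not_earlier c by blast
    obtain i j where "i < L" "L + 2 \<le> j" "connects (route_edges Rs f b) (Nd c i) (Nd m j)"
      using block_connected[OF assms, of "?l c" "?r m"] blocks[of m] blocks[of c] c by auto
    then show ?thesis using clause_needs_gadget c le by blast
  qed
  \<comment> \<open>A gadget trip has one starting time, and the offsets 2 and -1 exclude each
    other; so testing for 2 yields a consistent assignment.\<close>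
  have "\<forall>C \<in> set cls. \<exists>(s, v) \<in> set C. (f (m + 1 + v) = f m + real L + 2) = s"
  proof
    fix C assume "C \<in> set cls"
    then obtain c where "c < m" "C = cls ! c" by (metis in_set_conv_nth)
    with * obtain s v where sv: "(s, v) \<in> set C"
        "f (m + 1 + v) = f m + real L + (if s then 2 else - 1)"
      by blast
    then have "(f (m + 1 + v) = f m + real L + 2) = s" by (cases s) simp_all
    with sv(1) show "\<exists>(s, v) \<in> set C. (f (m + 1 + v) = f m + real L + 2) = s" by blast
  qed
  then show ?thesis unfolding satisfiable_def by
      (rule exI[of _ "\<lambda>v. f (m + 1 + v) = f m + real L + 2"])
qed

section \<open>From a satisfying assignment to a schedule\<close>

text \<open>Time 0 is the middle of every connection: trips are at their hubs, gadget trips at the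
  entrance chosen by \<open>A\<close>, and edges of weight 2 at their second end. Exit edges of
  weight 1 run from time 1 to time 2.\<close>

definition schedule_f :: "(nat \<Rightarrow> bool) \<Rightarrow> nat \<Rightarrow> real" where
  "schedule_f A k = (if k \<le> m then - real (L + 2) else if k < m + 1 + nv then
      (if A (k - (m + 1)) then 0 else - 3)
     else if snd (snd (Ls ! (k - (m + 1 + nv)))) = 2 then - 2 else 1)"

text \<open>The negative of \<open>schedule_f\<close>: since position \<open>i\<close> is passed at
  \<open>b k - cum i\<close>, the backward trips are the mirror images of the forward trips at time
  0.\<close>

definition schedule_b :: "(nat \<Rightarrow> bool) \<Rightarrow> nat \<Rightarrow> real" where
  "schedule_b A k = (if k \<le> m then real (L + 2) else if k < m + 1 + nv then
      (if A (k - (m + 1)) then 0 else 3)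
     else if snd (snd (Ls ! (k - (m + 1 + nv)))) = 2 then 2 else - 1)"

context
  fixes A :: "nat \<Rightarrow> bool"
begin

abbreviation "E \<equiv> route_edges Rs (schedule_f A) (schedule_b A)"

lemma trip_forward:
  assumes "c \<le> m" "i \<le> j" "j \<le> 2 * L + 2"
  shows "journey E (trip_pos m L c i) (real (trip_cum L i) - (L + 2)) (trip_pos m L c j)
      (real (trip_cum L j) - (L + 2))"
  using forward_journey[of c Rs "trip_route m L c" i j "schedule_f A" "schedule_b A"] assms
  by (simp add: nth_Rs length_Rs schedule_f_def algebra_simps)

lemma trip_backward:
  assumes "c \<le> m" "i \<le> j" "j \<le> 2 * L + 2"
  shows "journey E (trip_pos m L c j) ((L + 2) - real (trip_cum L j)) (trip_pos m L c i)
      ((L + 2) - real (trip_cum L i))"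
  using backward_journey[of c Rs "trip_route m L c" i j "schedule_f A" "schedule_b A"] assms
  by (simp add: nth_Rs length_Rs schedule_b_def algebra_simps)

lemma gadget_journey:
  assumes "v < nv"
  shows "journey E (Xn v (if A v then 0 else 2)) 0 (Xn v (if A v then 1 else 3)) 1"
    "journey E (Xn v (if A v then 1 else 3)) (-1) (Xn v (if A v then 0 else 2)) 0"
proof -
  have k: "m + 1 + v < length Rs" "Rs ! (m + 1 + v) = gadget_route v"
    using assms nth_Rs(2) by (simp_all add: length_Rs)
  have fb: "schedule_f A (m + 1 + v) = (if A v then 0 else - 3)" "schedule_b A (m + 1 + v) =
      (if A v then 0 else 3)"
    using assms by (simp_all add: schedule_f_def schedule_b_def)
  show "journey E (Xn v (if A v then 0 else 2)) 0 (Xn v (if A v then 1 else 3)) 1"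
    using forward_journey[OF k(1) k(2)[symmetric], of "if A v then 0 else 2"
        "if A v then 1 else 3" "schedule_f A" "schedule_b A"] fb
    by (auto simp: gadget_cum_def)
  show "journey E (Xn v (if A v then 1 else 3)) (-1) (Xn v (if A v then 0 else 2)) 0"
    using backward_journey[OF k(1) k(2)[symmetric], of "if A v then 0 else 2"
        "if A v then 1 else 3" "schedule_f A" "schedule_b A"] fb
    by (auto simp: gadget_cum_def)
qed

lemma light_journey:
  assumes "(x, y, w) \<in> set Ls"
  shows "w = 2 \<Longrightarrow> journey E x (-2) y 0" "w = 2 \<Longrightarrow> journey E y 0 x 2"
    "w = 1 \<Longrightarrow> journey E x 1 y 2" "w = 1 \<Longrightarrow> journey E y (-2) x (-1)"
proof -
  obtain i where i: "i < length Ls" "Ls ! i = (x, y, w)"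
    using assms by (metis in_set_conv_nth)
  let ?k = "m + 1 + nv + i"
  have k: "?k < length Rs" "Rs ! ?k = light_route (x, y, w)"
    using i nth_Rs(3) by (simp_all add: length_Rs)
  have fb: "schedule_f A ?k = (if w = 2 then - 2 else 1)" "schedule_b A ?k =
      (if w = 2 then 2 else - 1)"
    using i by (simp_all add: schedule_f_def schedule_b_def)
  note F = forward_journey[OF k(1) k(2)[symmetric], of 0 1 "schedule_f A" "schedule_b A"]
  note B = backward_journey[OF k(1) k(2)[symmetric], of 0 1 "schedule_f A" "schedule_b A"]
  show "w = 2 \<Longrightarrow> journey E x (-2) y 0" "w = 1 \<Longrightarrow> journey E x 1 y 2" using F fb by auto
  show "w = 2 \<Longrightarrow> journey E y 0 x 2" "w = 1 \<Longrightarrow> journey E y (-2) x (-1)" using B fb by auto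
qed

lemma port_hub:
  assumes "c \<le> m" "p = L \<or> p = L + 1"
  shows "journey E (Nd c p) (-2) (trip_hub m c) 0" "journey E (trip_hub m c) 0 (Nd c p) 2"
  using assms(2) trip_forward[OF assms(1), of L "L + 1"] trip_forward[OF assms(1),
      of "L + 1" "L + 2"]
    trip_backward[OF assms(1), of L "L + 1"] trip_backward[OF assms(1), of "L + 1" "L + 2"]
  by (auto simp: trip_pos_def trip_cum_def)

lemma block_port:
  assumes "c \<le> m" "i < 2 * L + 2" "i \<noteq> L" "i \<noteq> L + 1" "p = (if i < L then L else L + 1)"
  shows "\<exists>t. journey E (Nd c i) t (Nd c p) (-2)" "\<exists>t. journey E (Nd c p) 2 (Nd c i) t"
proof -
  have "(\<exists>t. journey E (Nd c i) t (Nd c p) (-2)) \<and> (\<exists>t. journey E (Nd c p) 2 (Nd c i) t)"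
  proof (cases "i < L")
    case True
    then have "trip_pos m L c i = Nd c i" "trip_pos m L c L = Nd c p" using assms by
        (simp_all add: trip_pos_def)
    then show ?thesis
      using trip_forward[OF assms(1), of i L] trip_backward[OF assms(1), of i L] True
      by (auto simp: trip_cum_def)
  next
    case False
    then have i: "L + 2 \<le> i" using assms by linarith
    then have "trip_pos m L c (i + 1) = Nd c i" "trip_pos m L c (L + 2) = Nd c p" using assms by
        (simp_all add: trip_pos_def)
    then show ?thesis
      using trip_forward[OF assms(1), of "L + 2" "i + 1"] trip_backward[OF assms(1),
          of "L + 2" "i + 1"] i assms(2)
      by (auto simp: trip_cum_def)
  qed
  then show "\<exists>t. journey E (Nd c i) t (Nd c p) (-2)" "\<exists>t. journey E (Nd c p) 2 (Nd c i) t" by auto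
qed

text \<open>The ports meet at \<open>Hub 0\<close> unless one of them is the right port of trip
  \<open>m\<close>. In that case they meet at \<open>Hub 1\<close> unless the other one is the left
  port of a clause. This last pair uses the gadget of a true literal, forwards or mirrored.\<close>

lemma ports_connected:
  assumes "\<forall>C \<in> set cls. \<exists>(s, v) \<in> set C. A v = s"
    and "c \<le> m" "c' \<le> m" "c \<noteq> c'" "p = L \<or> p = L + 1" "p' = L \<or> p' = L + 1"
  shows "journey E (Nd c p) (-2) (Nd c' p') 2"
proof -
  have tr: "journey E u (-2) h 0 \<Longrightarrow> journey E h 0 v 2 \<Longrightarrow> journey E u (-2) v 2" for u h v
    by (rule journey_trans) auto
  have h0: "journey E (Nd c p) (-2) (Hub 0) 0 \<and> journey E (Hub 0) 0 (Nd c p) 2"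
    if "c \<le> m" "p = L \<or> p = L + 1" "\<not> (c = m \<and> p = L + 1)" for c p
  proof (cases "c = m")
    case True
    then have "(Nd c p, Hub 0, 2) \<in> set Ls" using that by (auto simp: set_lights)
    from light_journey(1,2)[OF this] show ?thesis by simp
  next
    case False
    then show ?thesis using port_hub[OF that(1,2)] by (simp add: trip_hub_def)
  qed
  have h1: "journey E (Nd c p) (-2) (Hub 1) 0 \<and> journey E (Hub 1) 0 (Nd c p) 2"
    if "c \<le> m" "p = L \<or> p = L + 1" "c = m \<or> p = L + 1" for c p
  proof (cases "c = m")
    case False
    then have "(Nd c p, Hub 1, 2) \<in> set Ls" using that by (auto simp: set_lights)
    from light_journey(1,2)[OF this] show ?thesis by simp
  next
    case True
    then show ?thesis using port_hub[OF that(1,2)] by (simp add: trip_hub_def)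
  qed
  have lit: "journey E (Nd c L) (-2) (Nd m (L + 1)) 2 \<and> journey E (Nd m (L + 1)) (-2) (Nd c L) 2"
      if c: "c < m" for c
  proof -
    obtain v where v: "(A v, v) \<in> set (cls ! c)" using assms(1) c nth_mem[OF c] by fastforce
    then have nv: "v < nv" using vars[of "cls ! c"] c by auto
    let ?p = "Xn v (if A v then 0 else 2)" and ?q = "Xn v (if A v then 1 else 3)"
    have e1: "(Nd c L, ?p, 2) \<in> set Ls" unfolding set_lights using v c by blast
    have e2: "(?q, Nd m (L + 1), 1) \<in> set Ls" unfolding set_lights using nv by auto
    have "journey E (Nd c L) (-2) ?q 1"
      by (rule journey_trans[OF light_journey(1)[OF e1 refl] _ gadget_journey(1)[OF nv]]) simp
    then have 1: "journey E (Nd c L) (-2) (Nd m (L + 1)) 2"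
      by (rule journey_trans[OF _ _ light_journey(3)[OF e2 refl]]) simp
    have "journey E (Nd m (L + 1)) (-2) ?p 0"
      by (rule journey_trans[OF light_journey(4)[OF e2 refl] _ gadget_journey(2)[OF nv]]) simp
    then have "journey E (Nd m (L + 1)) (-2) (Nd c L) 2"
      by (rule journey_trans[OF _ _ light_journey(2)[OF e1 refl]]) simp
    then show ?thesis using 1 by simp
  qed
  consider "\<not> (c = m \<and> p = L + 1)" "\<not> (c' = m \<and> p' = L + 1)"
    | "c = m" "p = L + 1" "p' = L + 1" | "c = m" "p = L + 1" "p' = L"
    | "c' = m" "p' = L + 1" "p = L + 1" | "c' = m" "p' = L + 1" "p = L"
    using assms(5,6) by blast
  then show ?thesis
  proof cases
    case 1
    then show ?thesis using tr h0[of c p] h0[of c' p'] assms by blast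
  next
    case 2
    then show ?thesis using tr h1[of c p] h1[of c' p'] assms by blast
  next
    case 3
    then show ?thesis using lit[of c'] assms by auto
  next
    case 4
    then show ?thesis using tr h1[of c p] h1[of c' p'] assms by blast
  next
    case 5
    then show ?thesis using lit[of c] assms by auto
  qed
qed

lemma blocks_connected:
  assumes "\<forall>C \<in> set cls. \<exists>(s, v) \<in> set C. A v = s"
    and "c \<le> m" "i < 2 * L + 2" "i \<noteq> L" "i \<noteq> L + 1" "c' \<le> m" "j < 2 * L + 2" "j \<noteq> L" "j \<noteq> L + 1"
  shows "connects E (Nd c i) (Nd c' j)"
proof (cases "c = c'")
  case True
  define q where "q i = (if i \<le> L then i else i + 1)" for i
  have q: "trip_pos m L c (q i) = Nd c i" for i by (auto simp: q_def trip_pos_def)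
  have le: "q i \<le> 2 * L + 2" "q j \<le> 2 * L + 2" using assms by (auto simp: q_def)
  show ?thesis
  proof (cases "q i \<le> q j")
    case True
    then show ?thesis using trip_forward[OF assms(2), of "q i" "q j"] le \<open>c = c'\<close> unfolding q
      by (auto simp: connects_def)
  next
    case False
    then show ?thesis using trip_backward[OF assms(2), of "q j" "q i"] le \<open>c = c'\<close> unfolding q
      by (auto simp: connects_def)
  qed
next
  case False
  let ?p = "if i < L then L else L + 1" and ?p' = "if j < L then L else L + 1"
  obtain t t' where "journey E (Nd c i) t (Nd c ?p) (-2)" "journey E (Nd c' ?p') 2 (Nd c' j) t'"
    using block_port(1)[OF assms(2-5) refl] block_port(2)[OF assms(6-9) refl] by blast
  moreover have "journey E (Nd c ?p) (-2) (Nd c' ?p') 2"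
    by (rule ports_connected[OF assms(1,2,6) False]) auto
  ultimately have "journey E (Nd c i) t (Nd c' j) t'" by (meson journey_trans order_refl)
  then show ?thesis unfolding connects_def by blast
qed

end

text \<open>Only the pairs inside the blocks are counted; \<open>big\<close> says that they alone
  reach the bound.\<close>

lemma reachable_if_satisfiable:
  assumes "satisfiable cls" and big: "n * n + 1 \<le> L * L + ((m + 1) * (2 * L)) * ((m + 1) * (2 * L))"
  shows "\<exists>f b. sat_bound m nv L \<le> card {(u, v). u \<in> V \<and> v \<in> V \<and> connects (route_edges Rs f b) u v}"
proof -
  obtain A where A: "\<forall>C \<in> set cls. \<exists>(s, v) \<in> set C. A v = s" using assms(1)
      unfolding satisfiable_def by blast
  let ?I = "{..<L} \<union> {L + 2..<2 * L + 2}"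
  let ?H = "(\<lambda>(c, i). Nd c i) ` ({..m} \<times> ?I)"
  let ?S = "{(u, v). u \<in> V \<and> v \<in> V \<and> connects (route_edges Rs (schedule_f A) (schedule_b A)) u v}"
  have "card ?I = card {..<L} + card {L + 2..<2 * L + 2}" by (rule card_Un_disjoint) auto
  then have I: "card ?I = 2 * L" by simp
  have "card ?H = card ({..m} \<times> ?I)" by (rule card_image) (auto simp: inj_on_def)
  then have H: "card ?H = (m + 1) * (2 * L)" using I by (simp add: card_cartesian_product)
  have "?H \<times> ?H \<subseteq> ?S"
  proof
    fix x assume "x \<in> ?H \<times> ?H"
    then obtain c i d j where x: "x = (Nd c i, Nd d j)" "c \<le> m" "d \<le> m" "i \<in> ?I" "j \<in> ?I" by auto
    then have "connects (route_edges Rs (schedule_f A) (schedule_b A)) (Nd c i) (Nd d j)"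
      by (intro blocks_connected[OF A]) auto
    then show "x \<in> ?S" using x by (auto simp: nodes_def)
  qed
  moreover have "finite ?S" by (rule finite_subset[of _ "V \<times> V"]) (use finite_V in auto)
  ultimately have "card (?H \<times> ?H) \<le> card ?S" by (intro card_mono)
  then have "((m + 1) * (2 * L)) * ((m + 1) * (2 * L)) \<le> card ?S" using H by
      (simp only: card_cartesian_product)
  \<comment> \<open>This makes the subtraction of natural numbers in \<open>sat_bound\<close>
    exact.\<close>
  moreover have "L * L \<le> n * n" by (intro mult_le_mono) (auto simp: node_count_def)
  ultimately have "sat_bound m nv L \<le> card ?S" using big unfolding sat_bound_def by linarith
  then show ?thesis by blast
qed

theorem sat_input_correct:
  assumes big: "n * n + 1 \<le> L * L + ((m + 1) * (2 * L)) * ((m + 1) * (2 * L))"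
  defines "N \<equiv> sat_input cls nv L"
  shows "valid_input N" "symmetric_trips (input_digraph N) (input_trips N)"
    "strongly_connected (input_digraph N)"
    "(\<exists>\<tau>. sat_bound m nv L \<le> reachability (input_digraph N) (input_weight N) (input_trips N) \<tau>) \<longleftrightarrow>
        satisfiable cls"
  unfolding N_def
  using strongly_connected_sat rs.valid_N rs.symmetric_N rs.ex_reachability
    satisfiable_if_reachable reachable_if_satisfiable[OF _ big]
  unfolding sat_input_eq by blast+

end

section \<open>Clause families\<close>

primrec exp_vars :: "exp \<Rightarrow> nat set" where
  "exp_vars (Const n) = {}"
| "exp_vars (Var k) = {k}"
| "exp_vars Len = {}"
| "exp_vars (Bit e) = exp_vars e"
| "exp_vars (Add e1 e2) = exp_vars e1 \<union> exp_vars e2"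
| "exp_vars (Sub e1 e2) = exp_vars e1 \<union> exp_vars e2"
| "exp_vars (Mul e1 e2) = exp_vars e1 \<union> exp_vars e2"

lemma exp_below_vars: "exp_below d e \<longleftrightarrow> (\<forall>k \<in> exp_vars e. k < d)"
  by (induction e) auto

lemma eval_vars_cong: "(\<And>k. k \<in> exp_vars e \<Longrightarrow> \<rho> k = \<rho>' k) \<Longrightarrow> eval x \<rho> e = eval x \<rho>' e"
  by (induction e) auto

text \<open>Horner's scheme; it turns time bounds into loop bounds.\<close>

lemma ex_poly_exp: "\<exists>e. exp_vars e = {} \<and> (\<forall>x \<rho>. eval x \<rho> e = poly p (length x))"
proof (induction p)
  case 0
  then show ?case by (intro exI[of _ "Const 0"]) simp
next
  case (pCons a p)
  then obtain e where "exp_vars e = {}" "\<forall>x \<rho>. eval x \<rho> e = poly p (length x)" by blast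
  then show ?case by (intro exI[of _ "Add (Const a) (Mul Len e)"]) simp
qed

text \<open>
  A family \<open>(b1, b2, lits)\<close> stands for one clause for each \<open>i < b1\<close> and \<open>j < b2\<close>; the literals refer
  to \<open>i\<close> as variable 0 and to \<open>j\<close> as variable 2.
\<close>

type_synonym family = "exp \<times> exp \<times> (bool \<times> exp) list"

text \<open>This agrees with the registers of two nested \<open>For\<close> loops at the even
  numbers only. The odd registers hold remaining counts, hence the condition
  \<open>exp_vars e \<subseteq> {0, 2}\<close> in \<open>family_ok\<close>.\<close>

definition loop_env :: "nat \<Rightarrow> nat \<Rightarrow> nat \<Rightarrow> nat" where
  "loop_env i j = (\<lambda>k. if k = 0 then i else if k = 2 then j else 0)"

lemma loop_env_simps [simp]: "loop_env i j 0 = i" "loop_env i j 2 = j"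
  by (simp_all add: loop_env_def)

abbreviation ceval :: "bool list \<Rightarrow> exp \<Rightarrow> nat" where
  "ceval x \<equiv> eval x (\<lambda>_. 0)"

abbreviation inst :: "bool list \<Rightarrow> nat \<Rightarrow> nat \<Rightarrow> (bool \<times> exp) list \<Rightarrow> (bool \<times> nat) list" where
  "inst x i j \<equiv> map (\<lambda>(s, e). (s, eval x (loop_env i j) e))"

fun family_ok :: "family \<Rightarrow> bool" where
  "family_ok (b1, b2, lits) \<longleftrightarrow> exp_vars b1 = {} \<and> exp_vars b2 = {} \<and>
      (\<forall>(s, e) \<in> set lits. exp_vars e \<subseteq> {0, 2})"

fun family_clauses :: "bool list \<Rightarrow> family \<Rightarrow> (bool \<times> nat) list list" where
  "family_clauses x (b1, b2, lits) =
    concat (map (\<lambda>i. map (\<lambda>j. inst x i j lits) [0..<ceval x b2]) [0..<ceval x b1])"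

definition family_lits :: "bool list \<Rightarrow> family list \<Rightarrow> ((bool \<times> nat) list \<Rightarrow> bool) \<Rightarrow> bool" where
  "family_lits x fams P \<longleftrightarrow> (\<forall>(b1, b2, lits) \<in> set fams. \<forall>i < ceval x b1. \<forall>j < ceval x b2.
     P (inst x i j lits))"

definition clauses :: "bool list \<Rightarrow> family list \<Rightarrow> (bool \<times> nat) list list" where
  "clauses x fams = concat (map (family_clauses x) fams)"

lemma ball_clauses: "(\<forall>C \<in> set (clauses x fams). P C) \<longleftrightarrow> family_lits x fams P"
  unfolding clauses_def family_lits_def by (fastforce simp: split_beta)

lemma family_lits_simps:
  "family_lits x [] P \<longleftrightarrow> True"
  "family_lits x (f # g # fs) P \<longleftrightarrow> family_lits x [f] P \<and> family_lits x (g # fs) P"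
  "family_lits x (fs @ gs) P \<longleftrightarrow> family_lits x fs P \<and> family_lits x gs P"
  "family_lits x (concat (map F ys)) P \<longleftrightarrow> (\<forall>y \<in> set ys. family_lits x (F y) P)"
  "family_lits x (map G ys) P \<longleftrightarrow> (\<forall>y \<in> set ys. family_lits x [G y] P)"
  by (simp_all add: family_lits_def ball_Un)

lemma family_lits_single:
  "family_lits x [(b1, b2, lits)] P \<longleftrightarrow>
    (\<forall>i < ceval x b1. \<forall>j < ceval x b2. P (inst x i j lits))"
  by (simp add: family_lits_def)

section \<open>Turing machine runs relative to the heads\<close>

fun move_int :: "move \<Rightarrow> int" where
  "move_int Left = -1"
| "move_int Stay = 0"
| "move_int Right = 1"

lemma move_head_int: "move_head m h = h + move_int m"
  by (cases m) auto

lemma move_int_bounds: "- 1 \<le> move_int m" "move_int m \<le> 1"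
  by (cases m; simp)+

text \<open>
  Tape contents are addressed relative to the head, so that the head is always at position 0; the
  state is treated as the content of one more tape.
\<close>

fun rel :: "config \<Rightarrow> nat \<Rightarrow> int \<Rightarrow> nat" where
  "rel (q, ts) i h =
    (if i < length ts then fst (ts ! i) (snd (ts ! i) + h) else if h = 0 then q else 0)"

definition wf_config :: "tm \<Rightarrow> config \<Rightarrow> bool" where
  "wf_config M cfg \<longleftrightarrow> fst cfg \<le> states M \<and> length (snd cfg) = tapes M \<and>
    (\<forall>tp \<in> set (snd cfg). \<forall>y. fst tp y < symbols M)"

definition view :: "tm \<Rightarrow> config \<Rightarrow> nat list" where
  "view M cfg = map (\<lambda>i. rel cfg i 0) [0..<tapes M + 1]"

definition valid_view :: "tm \<Rightarrow> nat list \<Rightarrow> bool" where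
  "valid_view M e \<longleftrightarrow> length e = tapes M + 1 \<and> (\<forall>i < tapes M. e ! i < symbols M) \<and>
      e ! tapes M \<le> states M"

text \<open>The tape of the state never moves, and a halted machine rewrites what it reads. Thus the
  tableau treats states, symbols and halted configurations alike.\<close>

definition view_act :: "tm \<Rightarrow> nat list \<Rightarrow> nat \<Rightarrow> nat \<times> int" where
  "view_act M e i = (let K = tapes M; q = e ! K; d = delta M q (take K e) in
    if states M \<le> q then (e ! i, 0)
    else if i < K then (fst (snd d ! i), move_int (snd (snd d ! i)))
    else (fst d, 0))"

lemma view_act_bounds: "- 1 \<le> snd (view_act M e i)" "snd (view_act M e i) \<le> 1"
  by (auto simp: view_act_def Let_def move_int_bounds)

lemma valid_view_view: "wf_config M cfg \<Longrightarrow> valid_view M (view M cfg)"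
  by (cases cfg) (auto simp: wf_config_def valid_view_def view_def nth_append simp del: upt_Suc)

lemma delta_wf:
  assumes "wf_tm M" "valid_view M e" "e ! tapes M < states M"
      "delta M (e ! tapes M) (take (tapes M) e) = (q', acts)"
  shows "q' \<le> states M" "length acts = tapes M" "fst ` set acts \<subseteq> {..<symbols M}"
proof -
  have "length (take (tapes M) e) = tapes M" using assms(2) by (simp add: valid_view_def)
  moreover have "set (take (tapes M) e) \<subseteq> {..<symbols M}"
    using assms(2) by (auto simp: valid_view_def in_set_conv_nth)
  ultimately have "length (take (tapes M) e) = tapes M \<and> set (take (tapes M) e) \<subseteq> {..<symbols M}" ..
  from assms(1)[unfolded wf_tm_def, THEN conjunct2, THEN conjunct2, rule_format, OF assms(3) this]
  show "q' \<le> states M" "length acts = tapes M" "fst ` set acts \<subseteq> {..<symbols M}"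
    by (simp_all add: assms(4))
qed

lemma view_act_valid:
  assumes "wf_tm M" "valid_view M e"
  shows "i < tapes M \<Longrightarrow> fst (view_act M e i) < symbols M" "fst (view_act M e (tapes M)) \<le> states M"
proof -
  obtain q' acts where d: "delta M (e ! tapes M) (take (tapes M) e) = (q', acts)" by
      (metis surj_pair)
  note wf = delta_wf[OF assms _ d]
  show "i < tapes M \<Longrightarrow> fst (view_act M e i) < symbols M"
    using assms(2) wf nth_mem[of i acts] by (auto simp: view_act_def Let_def d valid_view_def
        image_subset_iff)
  show "fst (view_act M e (tapes M)) \<le> states M"
    using assms(2) wf by (auto simp: view_act_def Let_def d valid_view_def)
qed

lemma take_view: "length (snd cfg) = tapes M \<Longrightarrow> take (tapes M) (view M cfg) = map (\<lambda>(c, h). c h)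
    (snd cfg)"
  by (cases cfg) (auto simp: view_def take_map split_beta intro!: nth_equalityI simp del: upt_Suc)

lemma nth_view: "i \<le> tapes M \<Longrightarrow> view M cfg ! i = rel cfg i 0"
  by (auto simp: view_def simp del: upt_Suc)

text \<open>When the head moves, the contents shift the other way: what is now at offset
  \<open>h\<close> was at offset \<open>h\<close> plus the move, unless it has just been
  written.\<close>

lemma tm_step_wf_rel:
  assumes "wf_tm M" "wf_config M cfg"
  shows "wf_config M (tm_step M cfg)"
    and "i \<le> tapes M \<Longrightarrow> rel (tm_step M cfg) i h =
      (if h + snd (view_act M (view M cfg) i) = 0 then fst (view_act M (view M cfg) i)
       else rel cfg i (h + snd (view_act M (view M cfg) i)))"
proof -
  obtain q ts where cfg: "cfg = (q, ts)" by (metis surj_pair)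
  let ?e = "view M cfg"
  have len: "length ts = tapes M" and q: "q \<le> states M" and ts:
      "\<forall>tp \<in> set ts. \<forall>y. fst tp y < symbols M"
    using assms(2) by (auto simp: wf_config_def cfg)
  have eq: "?e ! tapes M = q" using len by (simp add: nth_view cfg)
  have tk: "take (tapes M) ?e = map (\<lambda>(c, h). c h) ts" using take_view[of cfg M] len by
      (simp add: cfg)
  obtain q' acts where d: "delta M q (map (\<lambda>(c, h). c h) ts) = (q', acts)" by (metis surj_pair)
  have dwf: "q' \<le> states M" "length acts = tapes M" "fst ` set acts \<subseteq> {..<symbols M}" if
      "q < states M"
    using delta_wf[OF assms(1) valid_view_view[OF assms(2)], unfolded eq tk, OF that d] .
  show "wf_config M (tm_step M cfg)"
  proof (cases "q < states M")
    case True
    have "fst (act_tape a tp) y < symbols M" if "a \<in> set acts" "tp \<in> set ts" for a tp y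
      using dwf(3)[OF True] ts that by (cases a; cases tp) (fastforce simp: fun_upd_def)
    then have "fst tp y < symbols M" if "tp \<in> set (map2 act_tape acts ts)" for tp y
      using that by (auto elim!: in_set_zipE simp del: act_tape.simps)
    then show ?thesis using True dwf len
      by (simp add: cfg tm_step_def d wf_config_def)
  next
    case False
    then show ?thesis using assms(2) by (simp add: cfg tm_step_def)
  qed
  show "rel (tm_step M cfg) i h =
      (if h + snd (view_act M ?e i) = 0 then fst (view_act M ?e i)
       else rel cfg i (h + snd (view_act M ?e i)))" if i: "i \<le> tapes M"
  proof (cases "q < states M")
    case True
    have step: "tm_step M cfg = (q', map2 act_tape acts ts)" using True by
        (simp add: cfg tm_step_def d)
    have va: "view_act M ?e i = (if i < tapes M then (fst (acts ! i), move_int (snd (acts ! i)))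
        else (q', 0))"
      using True by (simp add: view_act_def Let_def eq tk d)
    show ?thesis
    proof (cases "i < tapes M")
      case True
      obtain c p where cp: "ts ! i = (c, p)" by (metis surj_pair)
      obtain s mv where a: "acts ! i = (s, mv)" by (metis surj_pair)
      have "map2 act_tape acts ts ! i = (c(p := s), p + move_int mv)"
        using True dwf \<open>q < states M\<close> len by (simp add: cp a move_head_int)
      then show ?thesis unfolding step va using True dwf \<open>q < states M\<close> len
        by (auto simp: cfg cp a algebra_simps)
    next
      case False
      then show ?thesis unfolding step va using dwf \<open>q < states M\<close> len by (simp add: cfg)
    qed
  next
    case False
    then have "tm_step M cfg = cfg" "view_act M ?e i = (?e ! i, 0)"
      by (simp_all add: cfg tm_step_def view_act_def Let_def eq[unfolded cfg])
    then show ?thesis using i by (simp add: nth_view)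
  qed
qed

lemma tm_step_head:
  assumes "i < length (snd cfg)"
  shows "length (snd (tm_step M cfg)) \<le> length (snd cfg)"
    "i < length (snd (tm_step M cfg)) \<Longrightarrow> \<bar>snd (snd (tm_step M cfg) ! i)\<bar> \<le> \<bar>snd (snd cfg ! i)\<bar> + 1"
proof -
  obtain q ts where cfg: "cfg = (q, ts)" by (metis surj_pair)
  obtain q' acts where d: "delta M q (map (\<lambda>(c, h). c h) ts) = (q', acts)" by (metis surj_pair)
  show "length (snd (tm_step M cfg)) \<le> length (snd cfg)"
    by (simp add: cfg tm_step_def d)
  obtain c p where cp: "ts ! i = (c, p)" by (metis surj_pair)
  obtain s mv where a: "acts ! i = (s, mv)" by (metis surj_pair)
  show "\<bar>snd (snd (tm_step M cfg) ! i)\<bar> \<le> \<bar>snd (snd cfg ! i)\<bar> + 1" if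
      "i < length (snd (tm_step M cfg))"
    using that assms move_int_bounds[of mv]
    by (auto simp: cfg tm_step_def d cp a move_head_int split: if_splits)
qed

lemma tm_steps_halted:
  assumes "fst cfg = states M"
  shows "(tm_step M ^^ k) cfg = cfg"
  by (induction k) (use assms in \<open>auto simp: tm_step_def split: prod.splits\<close>)

lemma wf_config_initial:
  assumes "wf_tm M"
  shows "wf_config M (initial_config M z)"
  using assms by (auto simp: wf_config_def initial_config_def wf_tm_def string_contents_def)

definition run_config :: "tm \<Rightarrow> bool list \<Rightarrow> nat \<Rightarrow> config" where
  "run_config M z t = (tm_step M ^^ t) (initial_config M z)"

lemma run_config_simps:
  "run_config M z 0 = initial_config M z" "run_config M z (Suc t) = tm_step M (run_config M z t)"
  by (simp_all add: run_config_def)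

lemma wf_run_config: "wf_tm M \<Longrightarrow> wf_config M (run_config M z t)"
  by (induction t) (auto simp: run_config_simps wf_config_initial tm_step_wf_rel)

text \<open>Locates the absolute cell 0 of the output tape relative to the head.\<close>

lemma run_config_head:
  assumes "wf_tm M" "i < tapes M"
  shows "\<bar>snd (snd (run_config M z t) ! i)\<bar> \<le> int t"
proof (induction t)
  case 0
  then show ?case using assms(2) by (cases i) (auto simp: run_config_simps initial_config_def)
next
  case (Suc t)
  have "i < length (snd (run_config M z t))" "i < length (snd (run_config M z (Suc t)))"
    using wf_run_config[OF assms(1)] assms(2) by (auto simp: wf_config_def)
  then show ?case using tm_step_head(2)[of i "run_config M z t" M] Suc by
      (simp add: run_config_simps)
qed

lemma rel_initial:
  assumes "wf_tm M" "i \<le> tapes M"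
  shows "rel (run_config M z 0) i h = (if i = 0 then string_contents z h else 0)"
proof -
  have "0 < tapes M" using assms(1) by (simp add: wf_tm_def)
  then show ?thesis using assms(2) by (cases i) (auto simp: run_config_simps initial_config_def)
qed

text \<open>A halted machine stands still, so one common time \<open>T\<close> can be used for all
  certificates.\<close>

lemma run_output:
  assumes "wf_tm M" "halts_with_output M ((tm_step M ^^ n) (initial_config M z)) y" "n \<le> T"
  shows "rel (run_config M z T) 1 h = string_contents y (snd (snd (run_config M z T) ! 1) + h)"
proof -
  have "run_config M z T = (tm_step M ^^ (T - n)) ((tm_step M ^^ n) (initial_config M z))"
    using assms(3) by (simp add: run_config_def flip: funpow_add[THEN fun_cong, unfolded o_apply])
  also have "\<dots> = (tm_step M ^^ n) (initial_config M z)"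
    using assms(2) by (intro tm_steps_halted) (simp add: halts_with_output_def)
  finally have *: "halts_with_output M (run_config M z T) y" using assms(2) by simp
  moreover have "1 < length (snd (run_config M z T))"
    using wf_run_config[OF assms(1), of z T] assms(1) by (auto simp: wf_config_def wf_tm_def)
  ultimately show ?thesis by (cases "run_config M z T") (auto simp: halts_with_output_def)
qed


section \<open>Fulfilled clauses and the layout of encoded pairs\<close>

definition fulfils :: "(nat \<Rightarrow> bool) \<Rightarrow> (bool \<times> nat) list \<Rightarrow> bool" where
  "fulfils A C \<longleftrightarrow> (\<exists>(s, v) \<in> set C. A v = s)"

lemma fulfils_simps [simp]:
  "fulfils A [] \<longleftrightarrow> False"
  "fulfils A ((s, v) # C) \<longleftrightarrow> A v = s \<or> fulfils A C"
  "fulfils A (C @ D) \<longleftrightarrow> fulfils A C \<or> fulfils A D"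
  "fulfils A (map (\<lambda>i. (False, g i)) is) \<longleftrightarrow> (\<exists>i \<in> set is. \<not> A (g i))"
  by (auto simp: fulfils_def)

lemma satisfiable_clauses: "satisfiable (clauses x fams) \<longleftrightarrow> (\<exists>A. family_lits x fams (fulfils A))"
  unfolding satisfiable_def ball_clauses[symmetric] fulfils_def ..

lemma nth_concat_pairs:
  assumes "j < length x"
  shows "(concat (map (\<lambda>b. [True, b]) x) @ r) ! (2 * j) = True"
    "(concat (map (\<lambda>b. [True, b]) x) @ r) ! Suc (2 * j) = x ! j"
proof -
  have "(concat (map (\<lambda>b. [True, b]) x) @ r) ! (2 * j) = True \<and>
    (concat (map (\<lambda>b. [True, b]) x) @ r) ! Suc (2 * j) = x ! j"
    using assms
  proof (induction x arbitrary: j)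
    case (Cons a x)
    then show ?case by (cases j) auto
  qed simp
  then show "(concat (map (\<lambda>b. [True, b]) x) @ r) ! (2 * j) = True"
    "(concat (map (\<lambda>b. [True, b]) x) @ r) ! Suc (2 * j) = x ! j" by auto
qed

lemma length_concat_pairs: "length (concat (map (\<lambda>b. [True, b]) x)) = 2 * length x"
  by (induction x) auto

lemma encode_pair_eq: "encode_pair x y = concat (map (\<lambda>b. [True, b]) x) @ False # y"
  by (simp add: encode_pair_def encode_list_def)

lemma length_encode_pair: "length (encode_pair x y) = 2 * length x + 1 + length y"
  unfolding encode_pair_eq length_append length_concat_pairs by simp

lemma string_contents_nth: "j < length z \<Longrightarrow> string_contents z (int j) = (if z ! j then 2 else 1)"
  by (simp add: string_contents_def)

lemma string_contents_encode_pair: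
  "j < length x \<Longrightarrow> string_contents (encode_pair x y) (int (2 * j)) = 2"
  "j < length x \<Longrightarrow> string_contents (encode_pair x y) (int (2 * j + 1)) = string_contents x (int j)"
  "string_contents (encode_pair x y) (int (2 * length x)) = 1"
  "string_contents (encode_pair x y) (int (2 * length x + 1 + j)) = string_contents y (int j)"
proof -
  note len = length_encode_pair[of x y]
  show "string_contents (encode_pair x y) (int (2 * j)) = 2" if "j < length x"
    using that nth_concat_pairs(1)[OF that, of "False # y"]
    by (subst string_contents_nth) (auto simp: len encode_pair_eq[symmetric])
  show "string_contents (encode_pair x y) (int (2 * j + 1)) = string_contents x (int j)" if
      "j < length x"
    using that nth_concat_pairs(2)[OF that, of "False # y"]
    by (subst string_contents_nth, simp add: len, subst string_contents_nth)
        (auto simp: encode_pair_eq[symmetric])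
  have at: "encode_pair x y ! (2 * length x + k) = (False # y) ! k" for k
    using nth_append_length_plus[of "concat (map (\<lambda>b. [True, b]) x)" "False # y" k]
    unfolding length_concat_pairs encode_pair_eq .
  show "string_contents (encode_pair x y) (int (2 * length x)) = 1"
    using at[of 0] by (subst string_contents_nth) (auto simp: len)
  show "string_contents (encode_pair x y) (int (2 * length x + 1 + j)) = string_contents y (int j)"
  proof (cases "j < length y")
    case True
    then show ?thesis using at[of "Suc j"]
      by (subst string_contents_nth, simp add: len, subst string_contents_nth) auto
  next
    case False
    then show ?thesis by (simp add: string_contents_def len)
  qed
qed

section \<open>The tableau\<close>

text \<open>
  \<open>TE\<close> bounds the running time and \<open>PE\<close> the length of the certificate. The variable \<open>cell i s t h\<close>
  says that at time \<open>t\<close> tape \<open>i\<close> has symbol \<open>s\<close> at index \<open>h\<close>, where index \<open>OE\<close> is the head position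
  and tape \<open>K\<close> holds the state.
\<close>

locale tableau =
  fixes M :: tm and TE PE :: exp
  assumes wf: "wf_tm M" and closed: "exp_vars TE = {}" "exp_vars PE = {}"
    and T_large: "2 * length x + ceval x PE < ceval x TE"
begin

definition "K = tapes M"
text \<open>A common digit range for tape symbols and states.\<close>

definition "G = symbols M + states M + 1"
text \<open>The region in which the contents are known shrinks by one cell per step. At time
  \<open>T\<close> it must still contain all offsets up to \<open>T\<close>, because the head may be
  that far from the output bit; hence a radius of about \<open>2 * T\<close>.\<close>

definition "SE = Add (Mul (Const 2) TE) (Const 1)"
definition "OE = Add SE (Const 1)"
text \<open>Offsets up to the radius on both sides of the head, and one more cell at each end for
  contents that shift outwards.\<close>

definition "WE = Add (Mul (Const 2) SE) (Const 3)"

definition cell :: "nat \<Rightarrow> exp \<Rightarrow> exp \<Rightarrow> exp \<Rightarrow> exp" where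
  "cell i s t h = Add (Mul (Add (Mul (Add (Const (i * G)) s) (Add TE (Const 1))) t) WE) h"

definition "NV = Mul (Mul (Const ((K + 1) * G)) (Add TE (Const 1))) WE"

definition view_lits :: "nat list \<Rightarrow> (bool \<times> exp) list" where
  "view_lits e = map (\<lambda>i. (False, cell i (Const (e ! i)) (Var 0) OE)) [0..<K + 1]"

text \<open>The written cell moves to offset minus the move. Counting from \<open>SE\<close>, one
  below the head index, turns this into the addition of a natural constant.\<close>

abbreviation write_lits :: "nat list \<Rightarrow> nat \<Rightarrow> (bool \<times> exp) list" where
  "write_lits e i \<equiv> view_lits e @
     [(True, cell i (Const (fst (view_act M e i))) (Add (Var 0) (Const 1))
        (Add SE (Const (nat (1 - snd (view_act M e i))))))]"

text \<open>Variable 2 is the distance from the head minus 1. The two sides get separate clauses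
  because indices are natural numbers: the left side has to count down.\<close>

abbreviation right_lits :: "nat list \<Rightarrow> nat \<Rightarrow> nat \<Rightarrow> (bool \<times> exp) list" where
  "right_lits e i s \<equiv> view_lits e @
     [(False, cell i (Const s) (Var 0) (Add (Add OE (Const 1)) (Var 2))),
      (True, cell i (Const s) (Add (Var 0) (Const 1))
        (Add (Add SE (Var 2)) (Const (nat (2 - snd (view_act M e i))))))]"

abbreviation left_lits :: "nat list \<Rightarrow> nat \<Rightarrow> nat \<Rightarrow> (bool \<times> exp) list" where
  "left_lits e i s \<equiv> view_lits e @
     [(False, cell i (Const s) (Var 0) (Sub SE (Var 2))),
      (True, cell i (Const s) (Add (Var 0) (Const 1))
        (Sub (Add SE (Const (nat (1 - snd (view_act M e i))))) (Add (Var 2) (Const 1))))]"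

text \<open>The enumeration depends on the machine alone, so the number of families is constant and
  only the loop bounds grow with the input.\<close>

definition views :: "nat list list" where
  "views = filter (valid_view M) (List.n_lists (K + 1) [0..<G])"

definition write_fams :: "family list" where
  "write_fams = concat (map (\<lambda>e. map (\<lambda>i. (TE, Const 1, write_lits e i)) [0..<K + 1]) views)"

definition right_fams :: "family list" where
  "right_fams = concat (map (\<lambda>e. concat (map (\<lambda>i. map (\<lambda>s. (TE, SE, right_lits e i s))
      [0..<symbols M]) [0..<K])) views)"

definition left_fams :: "family list" where
  "left_fams = concat (map (\<lambda>e. concat (map (\<lambda>i. map (\<lambda>s. (TE, SE, left_lits e i s))
      [0..<symbols M]) [0..<K])) views)"

definition unit_fam :: "exp \<Rightarrow> bool \<Rightarrow> nat \<Rightarrow> exp \<Rightarrow> exp \<Rightarrow> exp \<Rightarrow> family" where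
  "unit_fam b pol i s t h = (b, Const 1, [(pol, cell i s t h)])"

definition blank_fams :: "family list" where
  "blank_fams = map (\<lambda>i. unit_fam (Add (Mul (Const 2) SE) (Const 1)) True i (Const 0) (Const 0)
      (Add (Var 0) (Const 1))) [1..<K]"

definition "input_end = Add OE (Mul (Const 2) Len)"

text \<open>\<open>encode_pair\<close> announces each bit of the input by \<open>True\<close> and
  ends with \<open>False\<close> before the certificate. This is the origin of the factor 2 and of
  the symbols 2 and 1 in constant positions. The gap of \<open>PE\<close> cells is left to the
  certificate.\<close>

definition input_fams :: "family list" where
  "input_fams = [
     unit_fam (Const 1) True K (Const 0) (Const 0) OE,
     unit_fam SE True 0 (Const 0) (Const 0) (Sub SE (Var 0)),
     unit_fam Len True 0 (Const 2) (Const 0) (Add OE (Mul (Const 2) (Var 0))),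
     unit_fam Len True 0 (Bit (Var 0)) (Const 0) (Add (Add OE (Mul (Const 2) (Var 0))) (Const 1)),
     unit_fam (Const 1) True 0 (Const 1) (Const 0) input_end,
     unit_fam (Sub SE (Add (Mul (Const 2) Len) PE)) True 0 (Const 0) (Const 0)
       (Add (Add (Add input_end (Const 1)) PE) (Var 0))]"

text \<open>The first family contains the only clauses with several positive literals. The second
  makes blanks hereditary, so that the certificate has no holes.\<close>

definition guess_fams :: "family list" where
  "guess_fams = [
     (PE, Const 1, map (\<lambda>s. (True, cell 0 (Const s) (Const 0)
         (Add (Add input_end (Const 1)) (Var 0)))) [0, 1, 2]),
     (PE, Const 1, [(False, cell 0 (Const 0) (Const 0) (Add (Add input_end (Const 1)) (Var 0))),
        (True, cell 0 (Const 0) (Const 0) (Add (Add input_end (Const 2)) (Var 0)))])]"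

text \<open>Acceptance is the absence of the symbol 1, the output \<open>False\<close>, on tape 1.
  This negative form suits assignments that are only known to contain the actual run.\<close>

definition accept_fam :: family where
  "accept_fam = unit_fam (Add (Mul (Const 2) TE) (Const 1)) False 1 (Const 1) TE
      (Add (Var 0) (Add TE (Const 2)))"

definition fams :: "family list" where
  "fams = write_fams @ right_fams @ left_fams @ blank_fams @ input_fams @ guess_fams @ [accept_fam]"

lemma exp_vars_cell: "exp_vars (cell i s t h) = exp_vars s \<union> exp_vars t \<union> exp_vars h"
  by (simp add: cell_def closed WE_def SE_def)

lemma fams_ok: "\<forall>fam \<in> set fams. family_ok fam"
  unfolding fams_def write_fams_def right_fams_def left_fams_def blank_fams_def input_fams_def
    guess_fams_def accept_fam_def unit_fam_def view_lits_def
  by (auto simp: exp_vars_cell SE_def OE_def input_end_def closed)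

lemma NV_closed: "exp_vars NV = {}"
  by (simp add: NV_def WE_def SE_def closed)

context
  fixes x :: "bool list"
begin

definition "T = ceval x TE"
definition "P = ceval x PE"
abbreviation "S \<equiv> 2 * T + 1"
abbreviation "W \<equiv> 2 * S + 3"

definition cell_code :: "nat \<Rightarrow> nat \<Rightarrow> nat \<Rightarrow> nat \<Rightarrow> nat" where
  "cell_code i s t h = ((i * G + s) * (T + 1) + t) * W + h"

lemma eval_TE [simp]: "eval x \<rho> TE = T" and eval_PE [simp]: "eval x \<rho> PE = P"
  unfolding T_def P_def by (rule eval_vars_cong, simp add: closed)+

lemma eval_simps [simp]:
  "eval x \<rho> SE = S" "eval x \<rho> OE = S + 1" "eval x \<rho> WE = W" "eval x \<rho> input_end =
      S + 1 + 2 * length x"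
  "eval x \<rho> (cell i s t h) = cell_code i (eval x \<rho> s) (eval x \<rho> t) (eval x \<rho> h)"
  by (simp_all add: SE_def OE_def WE_def input_end_def cell_def cell_code_def)

lemma mixed_radix_less: "a < m \<Longrightarrow> b < n \<Longrightarrow> a * n + b < m * (n::nat)"
proof -
  assume "a < m" "b < n"
  then have "a * n + b < (a + 1) * n" by simp
  also have "\<dots> \<le> m * n" using \<open>a < m\<close> by (intro mult_le_mono1) simp
  finally show ?thesis .
qed

lemma mixed_radix_inj: "a * n + b = a' * n + b' \<Longrightarrow> b < n \<Longrightarrow> b' < (n::nat) \<Longrightarrow> a = a' \<and> b = b'"
proof -
  assume eq: "a * n + b = a' * n + b'" and b: "b < n" "b' < n"
  have "(a * n + b) div n = a" "(a' * n + b') div n = a'" using b by simp_all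
  then show ?thesis using eq by auto
qed

lemma cell_code_less:
  "i \<le> K \<Longrightarrow> s < G \<Longrightarrow> t \<le> T \<Longrightarrow> h < W \<Longrightarrow> cell_code i s t h < eval x \<rho> NV"
proof -
  have "eval x \<rho> NV = (K + 1) * G * (T + 1) * W" by (simp add: NV_def)
  moreover assume "i \<le> K" "s < G" "t \<le> T" "h < W"
  then have "cell_code i s t h < (K + 1) * G * (T + 1) * W"
    unfolding cell_code_def by (intro mixed_radix_less) auto
  ultimately show ?thesis by simp
qed

lemma cell_code_inj:
  assumes "cell_code i s t h = cell_code i' s' t' h'" "s < G" "t \<le> T" "h < W" "s' < G" "t' \<le> T"
      "h' < W"
  shows "i = i' \<and> s = s' \<and> t = t' \<and> h = h'"
proof -
  have 1: "(i * G + s) * (T + 1) + t = (i' * G + s') * (T + 1) + t' \<and> h = h'"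
    using mixed_radix_inj[OF assms(1)[unfolded cell_code_def]] assms by blast
  then have 2: "i * G + s = i' * G + s' \<and> t = t'"
    using mixed_radix_inj[of "i * G + s" "T + 1" t "i' * G + s'" t'] assms by auto
  then show ?thesis using 1 mixed_radix_inj[of i G s i' s'] assms by auto
qed

lemma valid_view_less_G: "valid_view M e \<Longrightarrow> k \<le> K \<Longrightarrow> e ! k < G"
proof -
  assume e: "valid_view M e" "k \<le> K"
  then have "k < tapes M \<Longrightarrow> e ! k < symbols M" "e ! tapes M \<le> states M" by
      (simp_all add: valid_view_def)
  then show "e ! k < G" using e(2) by (cases "k = tapes M") (simp_all add: G_def K_def)
qed

lemma set_views: "e \<in> set views \<longleftrightarrow> valid_view M e"
proof
  assume e: "valid_view M e"
  then have "set e \<subseteq> {..<G}"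
    using valid_view_less_G[OF e] by (auto simp: valid_view_def in_set_conv_nth K_def)
  moreover have "length e = K + 1" using e by (simp add: valid_view_def K_def)
  ultimately have "e \<in> set (List.n_lists (K + 1) [0..<G])" unfolding set_n_lists by
      (simp add: atLeast0LessThan)
  then show "e \<in> set views" using e by (simp only: views_def set_filter mem_Collect_eq)
qed (simp add: views_def)

lemma K_ge: "2 \<le> K" "3 \<le> symbols M"
  using wf by (auto simp: wf_tm_def K_def)


lemma snd_view_act_state: "snd (view_act M e K) = 0"
  by (simp add: view_act_def Let_def K_def)

lemma T_large': "2 * length x + P < T"
  using T_large unfolding T_def P_def .

lemma view_lits_fulfils:
  "fulfils A (inst x t j (view_lits e @ C)) \<longleftrightarrow>
    ((\<forall>k \<le> K. A (cell_code k (e ! k) t (S + 1))) \<longrightarrow> fulfils A (inst x t j C))"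
  unfolding view_lits_def map_append fulfils_simps map_map comp_def
  by (auto simp: less_Suc_eq_le simp del: upt_Suc)

section \<open>From a satisfied tableau to an accepting run\<close>

lemma write_fams_fulfilled:
  assumes "family_lits x write_fams (fulfils A)" "valid_view M e" "i \<le> K" "t < T"
    and "\<forall>k \<le> K. A (cell_code k (e ! k) t (S + 1))"
  shows "A (cell_code i (fst (view_act M e i)) (t + 1) (S + nat (1 - snd (view_act M e i))))"
proof -
  have "family_lits x [(TE, Const 1, write_lits e i)] (fulfils A)"
    using assms(1)[unfolded write_fams_def family_lits_simps(4,5), rule_format, of e i] assms(2,3)
    by (simp add: set_views less_Suc_eq_le del: upt_Suc)
  from this[unfolded family_lits_single, rule_format, of t 0, unfolded view_lits_fulfils,
      rule_format, OF _ _ assms(5)[rule_format]]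
  show ?thesis using assms(4) by simp
qed

lemma right_fams_fulfilled:
  assumes "family_lits x right_fams (fulfils A)" "valid_view M e" "i < K" "t < T"
    and "\<forall>k \<le> K. A (cell_code k (e ! k) t (S + 1))" "s < symbols M" "j < S"
    and "A (cell_code i s t (S + 2 + j))"
  shows "A (cell_code i s (t + 1) (S + j + nat (2 - snd (view_act M e i))))"
proof -
  have "family_lits x [(TE, SE, right_lits e i s)] (fulfils A)"
    using assms(1)[unfolded right_fams_def family_lits_simps(4,5), rule_format, of e i s]
        assms(2,3,6)
    by (simp add: set_views)
  from this[unfolded family_lits_single, rule_format, of t j, unfolded view_lits_fulfils,
      rule_format, OF _ _ assms(5)[rule_format]]
  show ?thesis using assms(4,7,8) by simp
qed

lemma left_fams_fulfilled:
  assumes "family_lits x left_fams (fulfils A)" "valid_view M e" "i < K" "t < T"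
    and "\<forall>k \<le> K. A (cell_code k (e ! k) t (S + 1))" "s < symbols M" "j < S"
    and "A (cell_code i s t (S - j))"
  shows "A (cell_code i s (t + 1) (S + nat (1 - snd (view_act M e i)) - (j + 1)))"
proof -
  have "family_lits x [(TE, SE, left_lits e i s)] (fulfils A)"
    using assms(1)[unfolded left_fams_def family_lits_simps(4,5), rule_format, of e i s]
        assms(2,3,6)
    by (simp add: set_views)
  from this[unfolded family_lits_single, rule_format, of t j, unfolded view_lits_fulfils,
      rule_format, OF _ _ assms(5)[rule_format]]
  show ?thesis using assms(4,7,8) by simp
qed

lemma unit_fam_fulfilled:
  "family_lits x [unit_fam b pol i s t h] (fulfils A) \<longleftrightarrow>
    (\<forall>j < ceval x b. A (cell_code i (eval x (loop_env j 0) s) (eval x (loop_env j 0) t)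
        (eval x (loop_env j 0) h)) = pol)"
  by (simp add: unit_fam_def family_lits_single)

text \<open>One inclusion is enough: the assignment contains the actual contents, so the premises
  with the actual view hold and enforce the next step. Additional true cells do no harm. The radius
  shrinks because a cell at the edge depends on one further out.\<close>

lemma simulation:
  assumes sat: "family_lits x write_fams (fulfils A)" "family_lits x right_fams (fulfils A)"
      "family_lits x left_fams (fulfils A)"
    and init: "\<And>i h. i < K \<Longrightarrow> \<bar>h\<bar> \<le> int S \<Longrightarrow> A (cell_code i (rel (run_config M z 0) i h) 0
        (nat (int S + 1 + h)))"
      "A (cell_code K (rel (run_config M z 0) K 0) 0 (S + 1))"
    and "t \<le> T"
  shows "(\<forall>i < K. \<forall>h. \<bar>h\<bar> \<le> int S - int t \<longrightarrow> A (cell_code i (rel (run_config M z t) i h) t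
      (nat (int S + 1 + h)))) \<and>
    A (cell_code K (rel (run_config M z t) K 0) t (S + 1))"
  using \<open>t \<le> T\<close>
proof (induction t)
  case 0
  then show ?case using init by simp
next
  case (Suc t)
  let ?c = "run_config M z t"
  let ?e = "view M ?c"
  have wfc: "wf_config M ?c" by (rule wf_run_config[OF wf])
  have t: "t < T" using Suc.prems by simp
  have IH: "A (cell_code i (rel ?c i h) t (nat (int S + 1 + h)))" if "i < K" "\<bar>h\<bar> \<le> int S - int t"
      for i h
    using Suc that by simp
  have IHK: "A (cell_code K (rel ?c K 0) t (S + 1))" using Suc by simp
  have prem: "\<forall>k \<le> K. A (cell_code k (?e ! k) t (S + 1))"
  proof (intro allI impI)
    fix k assume "k \<le> K"
    then have "?e ! k = rel ?c k 0" by (simp add: nth_view K_def)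
    moreover have "nat (int S + 1 + 0) = S + 1" by simp
    ultimately show "A (cell_code k (?e ! k) t (S + 1))"
      using IH[of k 0] IHK \<open>k \<le> K\<close> t by (cases "k = K") simp_all
  qed
  note vv = valid_view_view[OF wfc]
  have step: "rel (run_config M z (Suc t)) i h =
      (if h + snd (view_act M ?e i) = 0 then fst (view_act M ?e i) else rel ?c i
          (h + snd (view_act M ?e i)))"
    if "i \<le> K" for i h
    using tm_step_wf_rel(2)[OF wf wfc] that by (simp add: run_config_simps K_def)
  have "A (cell_code i (rel (run_config M z (Suc t)) i h) (Suc t) (nat (int S + 1 + h)))"
    if i: "i < K" and h: "\<bar>h\<bar> \<le> int S - int (Suc t)" for i h
  proof -
    let ?m = "snd (view_act M ?e i)"
    have m: "- 1 \<le> ?m" "?m \<le> 1" by (rule view_act_bounds)+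
    \<comment> \<open>The offset of the same cell before the move; its sign decides which family of
      clauses applies.\<close>
    define g where "g = h + ?m"
    have hg: "h = g - ?m" by (simp add: g_def)
    consider "g = 0" | "0 < g" | "g < 0" by linarith
    then show ?thesis
    proof cases
      case 1
      then have "nat (int S + 1 + h) = S + nat (1 - ?m)" using m by
          (simp add: hg nat_add_distrib[symmetric] del: One_nat_def) 
      then show ?thesis
        using write_fams_fulfilled[OF sat(1) vv _ t prem, of i] i step[of i h] 1 by
            (simp add: g_def)
    next
      case 2
      have s: "rel ?c i g < symbols M"
        using wfc i by (cases ?c) (auto simp: wf_config_def K_def)
      have g: "\<bar>g\<bar> \<le> int S - int t" using h m by (simp add: g_def)
      define j where "j = nat (g - 1)"
      have j: "g = int j + 1" using 2 by (simp add: j_def)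
      have "j < S" using g j by simp
      moreover have "nat (int S + 1 + g) = S + 2 + j" using j by simp
      moreover have "nat (int S + 1 + h) = S + j + nat (2 - ?m)" using m j by (simp add: hg)
      ultimately show ?thesis
        using right_fams_fulfilled[OF sat(2) vv i t prem s, of j] IH[OF i g] step[of i h] 2 i by
            (simp add: g_def)
    next
      case 3
      have s: "rel ?c i g < symbols M"
        using wfc i by (cases ?c) (auto simp: wf_config_def K_def)
      have g: "\<bar>g\<bar> \<le> int S - int t" using h m by (simp add: g_def)
      define j where "j = nat (- g - 1)"
      have j: "g = - int j - 1" using 3 by (simp add: j_def)
      have js: "j < S" using g j by simp
      moreover have "nat (int S + 1 + g) = S - j" using j by simp
      moreover have "nat (int S + 1 + h) = S + nat (1 - ?m) - (j + 1)"
      proof -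
        have "int (S + nat (1 - ?m) - (j + 1)) = int S + (1 - ?m) - (int j + 1)"
          using m js by (simp add: of_nat_diff)
        then show ?thesis using j by (simp add: hg)
      qed
      ultimately show ?thesis
        using left_fams_fulfilled[OF sat(3) vv i t prem s, of j] IH[OF i g] step[of i h] 3 i by
            (simp add: g_def)
    qed
  qed
  moreover have "A (cell_code K (rel (run_config M z (Suc t)) K 0) (Suc t) (S + 1))"
    using write_fams_fulfilled[OF sat(1) vv _ t prem, of K] step[of K 0] by
        (simp add: snd_view_act_state)
  ultimately show ?case by blast
qed

lemma tableau_sound:
  assumes sat: "family_lits x fams (fulfils A)"
  shows "\<exists>y. length y \<le> P \<and> (\<forall>h. \<bar>h\<bar> \<le> int T \<longrightarrow> rel (run_config M (encode_pair x y) T) 1 h \<noteq> 1)"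
proof -
  let ?n = "length x"
  have fam: "family_lits x write_fams (fulfils A)" "family_lits x right_fams (fulfils A)"
    "family_lits x left_fams (fulfils A)" "family_lits x blank_fams (fulfils A)"
    "family_lits x input_fams (fulfils A)" "family_lits x guess_fams (fulfils A)"
        "family_lits x [accept_fam] (fulfils A)"
    using sat unfolding fams_def family_lits_simps(3) by blast+
  have blank: "A (cell_code i 0 0 (j + 1))" if "1 \<le> i" "i < K" "j < 2 * S + 1" for i j
    using fam(4) that unfolding blank_fams_def family_lits_simps(5) unit_fam_fulfilled by simp
  have inp: "A (cell_code K 0 0 (S + 1))" "\<And>j. j < S \<Longrightarrow> A (cell_code 0 0 0 (S - j))"
    "\<And>j. j < ?n \<Longrightarrow> A (cell_code 0 2 0 (S + 1 + 2 * j))"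
    "\<And>j. j < ?n \<Longrightarrow> A (cell_code 0 (string_contents x (int j)) 0 (S + 1 + 2 * j + 1))"
    "A (cell_code 0 1 0 (S + 1 + 2 * ?n))"
    "\<And>j. j < S - (2 * ?n + P) \<Longrightarrow> A (cell_code 0 0 0 (S + 1 + 2 * ?n + 1 + P + j))"
    using fam(5) unfolding input_fams_def family_lits_simps(2) unit_fam_fulfilled by simp_all
  have guess: "A (cell_code 0 0 0 (S + 1 + 2 * ?n + 1 + j)) \<or>
      A (cell_code 0 1 0 (S + 1 + 2 * ?n + 1 + j)) \<or>
      A (cell_code 0 2 0 (S + 1 + 2 * ?n + 1 + j))"
    "A (cell_code 0 0 0 (S + 1 + 2 * ?n + 1 + j)) \<Longrightarrow> A (cell_code 0 0 0 (S + 1 + 2 * ?n + 2 + j))"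
        if "j < P" for j
    using fam(6) that unfolding guess_fams_def family_lits_simps(2) family_lits_single by auto
  have accept: "\<not> A (cell_code 1 1 T (j + (T + 2)))" if "j < 2 * T + 1" for j
    using fam(7) that unfolding accept_fam_def unit_fam_fulfilled by simp
  define good where "good j \<longleftrightarrow> A (cell_code 0 1 0 (S + 1 + 2 * ?n + 1 + j)) \<or>
      A (cell_code 0 2 0 (S + 1 + 2 * ?n + 1 + j))" for j
  \<comment> \<open>The certificate ends at the first cell without a bit. That cell must be blank,
    and the blank spreads to all later certificate cells.\<close>
  define l where "l = (LEAST j. j = P \<or> \<not> good j)"
  have l: "l = P \<or> \<not> good l" unfolding l_def by (rule LeastI[of _ P]) simp
  have l_le: "l \<le> P" unfolding l_def by (rule Least_le) simp
  have below_l: "good j" if "j < l" for j using not_less_Least[of j "\<lambda>j. j = P \<or> \<not> good j"] that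
      unfolding l_def by blast
  have above_l: "A (cell_code 0 0 0 (S + 1 + 2 * ?n + 1 + j))" if "l \<le> j" "j < P" for j
    using that
  proof (induction j rule: dec_induct)
    case base
    then show ?case using l guess(1)[of l] by (auto simp: good_def)
  next
    case (step j)
    then show ?case using guess(2)[of j] by (simp add: ac_simps)
  qed
  \<comment> \<open>A cell may be asserted to hold both bits; either choice is admissible, and
    \<open>True\<close> is taken.\<close>
  define y where "y = map (\<lambda>j. A (cell_code 0 2 0 (S + 1 + 2 * ?n + 1 + j))) [0..<l]"
  have y: "A (cell_code 0 (string_contents y (int j)) 0 (S + 1 + 2 * ?n + 1 + j))" if "j < P" for j
  proof (cases "j < l")
    case True
    then have "string_contents y (int j) = (if A (cell_code 0 2 0 (S + 1 + 2 * ?n + 1 + j)) then 2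
        else 1)"
      by (subst string_contents_nth) (auto simp: y_def)
    then show ?thesis using below_l[OF True] by (auto simp: good_def)
  next
    case False
    then have "string_contents y (int j) = 0" by (simp add: string_contents_def y_def)
    then show ?thesis using above_l that False by simp
  qed
  let ?z = "encode_pair x y"
  have init0: "A (cell_code 0 (string_contents ?z h) 0 (nat (int S + 1 + h)))" if h: "\<bar>h\<bar> \<le> int S"
      for h
  proof (cases "h < 0")
    case True
    then have "nat (int S + 1 + h) = S - nat (- h - 1)" "nat (- h - 1) < S" using h by linarith+
    moreover have "string_contents ?z h = 0" using True by (simp add: string_contents_def)
    ultimately show ?thesis using inp(2)[of "nat (- h - 1)"] by simp
  next
    case False
    define k where "k = nat h"
    have k: "h = int k" "k \<le> S" "nat (int S + 1 + h) = S + 1 + k" using False h by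
        (auto simp: k_def)
    consider j where "k = 2 * j" "j < ?n" | j where "k = 2 * j + 1" "j < ?n" | "k = 2 * ?n"
      | j where "k = 2 * ?n + 1 + j" "j < P" | j where "k = 2 * ?n + 1 + (P + j)"
    proof -
      have "k = 2 * (k div 2) \<and> k div 2 < ?n \<or> k = 2 * (k div 2) + 1 \<and> k div 2 < ?n \<or> k = 2 * ?n \<or>
        k = 2 * ?n + 1 + (k - (2 * ?n + 1)) \<and> k - (2 * ?n + 1) < P \<or> k =
            2 * ?n + 1 + (P + (k - (2 * ?n + 1 + P)))"
        by linarith
      then show ?thesis using that by blast
    qed
    then show ?thesis unfolding k(3) unfolding k(1)
    proof cases
      case (1 j)
      then show "A (cell_code 0 (string_contents ?z (int k)) 0 (S + 1 + k))"
        using inp(3)[of j] string_contents_encode_pair(1)[of j x y] by (simp only: 1)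
    next
      case (2 j)
      then show "A (cell_code 0 (string_contents ?z (int k)) 0 (S + 1 + k))"
        using inp(4)[of j] string_contents_encode_pair(2)[of j x y] by (simp only: 2 add.assoc)
    next
      case 3
      show "A (cell_code 0 (string_contents ?z (int k)) 0 (S + 1 + k))"
        using inp(5) string_contents_encode_pair(3)[of x y] by (simp only: 3)
    next
      case (4 j)
      show "A (cell_code 0 (string_contents ?z (int k)) 0 (S + 1 + k))"
        using y[of j] string_contents_encode_pair(4)[of x y j] 4(2) by (simp only: 4(1) add.assoc)
    next
      case (5 j)
      have "string_contents y (int (P + j)) = 0" using l_le by (simp add: string_contents_def y_def)
      moreover have "j < S - (2 * ?n + P)" using 5 k(2) by linarith
      ultimately show "A (cell_code 0 (string_contents ?z (int k)) 0 (S + 1 + k))"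
        using inp(6)[of j] string_contents_encode_pair(4)[of x y "P + j"] by
            (simp only: 5 add.assoc)
    qed
  qed
  have init: "A (cell_code i (rel (run_config M ?z 0) i h) 0 (nat (int S + 1 + h)))" if "i < K"
      "\<bar>h\<bar> \<le> int S" for i h
  proof (cases "i = 0")
    case True
    then show ?thesis using rel_initial[OF wf, of 0 ?z h] init0[OF that(2)] by simp
  next
    case False
    have "nat (int S + 1 + h) = nat (int S + h) + 1" "nat (int S + h) < 2 * S + 1"
      using that(2) by (auto simp: nat_less_iff)
    then show ?thesis using rel_initial[OF wf, of i ?z h] blank[of i "nat (int S + h)"] that(1)
        False by (simp add: K_def)
  qed
  have initK: "A (cell_code K (rel (run_config M ?z 0) K 0) 0 (S + 1))"
    using rel_initial[OF wf, of K ?z 0] inp(1) K_ge by (simp add: K_def)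
  have "rel (run_config M ?z T) 1 h \<noteq> 1" if h: "\<bar>h\<bar> \<le> int T" for h
  proof
    assume eq: "rel (run_config M ?z T) 1 h = 1"
    have "A (cell_code 1 (rel (run_config M ?z T) 1 h) T (nat (int S + 1 + h)))"
      using simulation[OF fam(1-3) init initK order_refl] K_ge(1) h by simp
    \<comment> \<open>Since \<open>S + 1 = 2 * T + 2\<close>, the offsets from \<open>- T\<close> to
      \<open>T\<close> are exactly the indices covered by \<open>accept_fam\<close>.\<close>
    moreover have "nat (int S + 1 + h) = nat (int T + h) + (T + 2)" "nat (int T + h) < 2 * T + 1"
        using h by linarith+
    ultimately show False using accept[of "nat (int T + h)"] unfolding eq by simp
  qed
  moreover have "length y \<le> P" using l_le by (simp add: y_def)
  ultimately show ?thesis by blast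
qed


section \<open>From an accepting run to a satisfying assignment\<close>

text \<open>Spells out all clauses with their variable numbers, for use both in bounding the
  variables and in verifying the assignment of a run.\<close>

lemma fams_cases:
  assumes views: "\<And>e i t. valid_view M e \<Longrightarrow> i \<le> K \<Longrightarrow> t < T \<Longrightarrow> Q (inst x t 0 (write_lits e i))"
    and right: "\<And>e i s t j. valid_view M e \<Longrightarrow> i < K \<Longrightarrow> s < symbols M \<Longrightarrow> t < T \<Longrightarrow> j < S \<Longrightarrow>
      Q (inst x t j (right_lits e i s))"
    and left: "\<And>e i s t j. valid_view M e \<Longrightarrow> i < K \<Longrightarrow> s < symbols M \<Longrightarrow> t < T \<Longrightarrow> j < S \<Longrightarrow>
      Q (inst x t j (left_lits e i s))"
    and blank: "\<And>i j. 1 \<le> i \<Longrightarrow> i < K \<Longrightarrow> j < 2 * S + 1 \<Longrightarrow> Q [(True, cell_code i 0 0 (j + 1))]"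
    and input: "Q [(True, cell_code K 0 0 (S + 1))]"
        "\<And>j. j < S \<Longrightarrow> Q [(True, cell_code 0 0 0 (S - j))]"
      "\<And>j. j < length x \<Longrightarrow> Q [(True, cell_code 0 2 0 (S + 1 + 2 * j))]"
      "\<And>j. j < length x \<Longrightarrow> Q [(True, cell_code 0 (string_contents x (int j)) 0 (S + 1 + 2 * j + 1))]"
      "Q [(True, cell_code 0 1 0 (S + 1 + 2 * length x))]"
      "\<And>j. j < S - (2 * length x + P) \<Longrightarrow> Q [(True,
          cell_code 0 0 0 (S + 1 + 2 * length x + 1 + P + j))]"
    and guess: "\<And>j. j < P \<Longrightarrow> Q (map (\<lambda>s. (True, cell_code 0 s 0 (S + 1 + 2 * length x + 1 + j)))
        [0, 1, 2])"
      "\<And>j. j < P \<Longrightarrow> Q [(False, cell_code 0 0 0 (S + 1 + 2 * length x + 1 + j)),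
          (True, cell_code 0 0 0 (S + 1 + 2 * length x + 2 + j))]"
    and accept: "\<And>j. j < 2 * T + 1 \<Longrightarrow> Q [(False, cell_code 1 1 T (j + (T + 2)))]"
  shows "family_lits x fams Q"
proof -
  have "family_lits x write_fams Q"
    unfolding write_fams_def family_lits_simps(4,5) family_lits_single set_views
    using views by (simp add: set_views less_Suc_eq_le del: upt_Suc map_append)
  moreover have "family_lits x right_fams Q"
    unfolding right_fams_def family_lits_simps(4,5) family_lits_single
    using right by (simp add: set_views del: map_append)
  moreover have "family_lits x left_fams Q"
    unfolding left_fams_def family_lits_simps(4,5) family_lits_single
    using left by (simp add: set_views del: map_append)
  moreover have "family_lits x blank_fams Q"
    unfolding blank_fams_def family_lits_simps(5) unit_fam_def family_lits_single using blank
        by simp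
  moreover have "family_lits x input_fams Q"
    unfolding input_fams_def family_lits_simps(2) unit_fam_def family_lits_single using input
        by simp
  moreover have "family_lits x guess_fams Q"
    unfolding guess_fams_def family_lits_simps(2) family_lits_single using guess by simp
  moreover have "family_lits x [accept_fam] Q"
    unfolding accept_fam_def unit_fam_def family_lits_single using accept by simp
  ultimately show ?thesis unfolding fams_def family_lits_simps(3) by blast
qed

lemma view_index:
  assumes "j < S"
  shows "S + nat (1 - snd (view_act M e i)) < W" "S + j + nat (2 - snd (view_act M e i)) < W"
    "S + nat (1 - snd (view_act M e i)) - (j + 1) < W"
proof -
  have "snd (view_act M e i) = -1 \<or> snd (view_act M e i) = 0 \<or> snd (view_act M e i) = 1"
    using view_act_bounds[of M e i] by linarith
  then show "S + nat (1 - snd (view_act M e i)) < W" "S + j + nat (2 - snd (view_act M e i)) < W"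
    "S + nat (1 - snd (view_act M e i)) - (j + 1) < W"
    using assms by auto
qed

lemma view_act_less_G: "valid_view M e \<Longrightarrow> i \<le> K \<Longrightarrow> fst (view_act M e i) < G"
  using view_act_valid(1)[OF wf, of e i] view_act_valid(2)[OF wf, of e]
  by (cases "i = K") (auto simp: K_def G_def)

lemma small_symbols: "s < symbols M \<Longrightarrow> s < G" "string_contents x h < G" "0 < G" "1 < G" "2 < G"
  using K_ge by (auto simp: G_def string_contents_def)

lemma vars_bounded: "family_lits x fams (\<lambda>C. \<forall>(s, v) \<in> set C. v < eval x \<rho> NV)"
proof -
  have vl: "\<forall>(s, v) \<in> set (inst x t j (view_lits e)). v < eval x \<rho> NV"
    if "valid_view M e" "t < T" for e t j
    unfolding view_lits_def using that valid_view_less_G[OF that(1)]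
    by (auto simp: less_Suc_eq_le intro!: cell_code_less simp del: upt_Suc)
  have T: "2 * length x + P < T" by (rule T_large')
  have S: "0 < S" by simp
  have K: "0 \<le> K" "1 \<le> K" using K_ge by auto
  note sym = small_symbols
  show ?thesis
  proof (rule fams_cases)
    fix e i t assume "valid_view M e" "i \<le> K" "t < T"
    then show "\<forall>(s, v) \<in> set (inst x t 0 (write_lits e i)). v < eval x \<rho> NV"
      using vl[of e t 0] view_index(1)[OF S, of e i] view_act_less_G[of e i]
      unfolding map_append set_append ball_Un by (simp add: cell_code_less)
  next
    fix e i s t j assume "valid_view M e" "i < K" "s < symbols M" "t < T" "j < S"
    then show "\<forall>(s, v) \<in> set (inst x t j (right_lits e i s)). v < eval x \<rho> NV"
      using vl[of e t j] view_index(2)[of j e i] sym(1)[of s]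
      unfolding map_append set_append ball_Un by (simp add: cell_code_less)
  next
    fix e i s t j assume "valid_view M e" "i < K" "s < symbols M" "t < T" "j < S"
    then show "\<forall>(s, v) \<in> set (inst x t j (left_lits e i s)). v < eval x \<rho> NV"
      using vl[of e t j] view_index(3)[of j e i] sym(1)[of s]
      unfolding map_append set_append ball_Un by (simp add: cell_code_less)
  qed (use T K sym in \<open>auto intro!: cell_code_less\<close>)
qed

lemma tableau_complete:
  assumes y: "length y \<le> P"
    and acc: "\<And>h. \<bar>h\<bar> \<le> int T \<Longrightarrow> rel (run_config M (encode_pair x y) T) 1 h \<noteq> 1"
  shows "\<exists>A. family_lits x fams (fulfils A)"
proof -
  let ?z = "encode_pair x y"
  let ?c = "run_config M ?z"
  \<comment> \<open>The assignment of the actual run; the bounds make \<open>cell_code\<close>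
    injective, so that \<open>A\<close> can be read off cell by cell.\<close>
  define A where "A v \<longleftrightarrow> (\<exists>i s t h. i \<le> K \<and> s < G \<and> t \<le> T \<and> h < W \<and> v = cell_code i s t h \<and>
     rel (?c t) i (int h - (int S + 1)) = s)" for v
  have A: "A (cell_code i s t h) \<longleftrightarrow> rel (?c t) i (int h - (int S + 1)) = s"
    if "i \<le> K" "s < G" "t \<le> T" "h < W" for i s t h
    unfolding A_def using cell_code_inj that by blast
  have T: "2 * length x + P < T" by (rule T_large')
  have S: "0 < S" by simp
  have K: "0 < K" "1 < K" "1 \<le> K" using K_ge by auto
  note sym = small_symbols
  \<comment> \<open>Clauses about any other view are fulfilled by a false premise; only the step
    that the machine really makes has to be checked.\<close>
  have view: "e = view M (?c t)"
    if "valid_view M e" "t < T" "\<forall>k \<le> K. A (cell_code k (e ! k) t (S + 1))" for e t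
  proof (rule nth_equalityI)
    show "length e = length (view M (?c t))" using that(1) by (simp add: valid_view_def view_def)
    fix k assume "k < length e"
    then have k: "k \<le> K" using that(1) by (simp add: valid_view_def K_def)
    then have "rel (?c t) k (int (S + 1) - (int S + 1)) = e ! k"
      using that A[of k "e ! k" t "S + 1"] valid_view_less_G[OF that(1) k] by simp
    then show "e ! k = view M (?c t) ! k" using k by (simp add: nth_view K_def)
  qed
  have step: "rel (?c (t + 1)) i h =
      (if h + snd (view_act M (view M (?c t)) i) = 0 then fst (view_act M (view M (?c t)) i)
       else rel (?c t) i (h + snd (view_act M (view M (?c t)) i)))" if "i \<le> K" for t i h
    using tm_step_wf_rel(2)[OF wf wf_run_config[OF wf]] that by (simp add: run_config_simps K_def)
  have init: "A (cell_code 0 s 0 h) \<longleftrightarrow> string_contents ?z (int h - (int S + 1)) = s" if "s < G"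
      "h < W" for s h
    using A[of 0 s 0 h] that rel_initial[OF wf, of 0] by simp
  have init': "A (cell_code i 0 0 h)" if "i \<le> K" "i \<noteq> 0" "h < W" for i h
    using A[of i 0 0 h] that rel_initial[OF wf, of i] sym by (simp add: K_def)
  have "family_lits x fams (fulfils A)"
  proof (rule fams_cases)
    fix e i t assume H: "valid_view M e" "i \<le> K" "t < T"
    have "A (cell_code i (fst (view_act M e i)) (t + 1) (S + nat (1 - snd (view_act M e i))))"
      if pr: "\<forall>k \<le> K. A (cell_code k (e ! k) t (S + 1))"
    proof -
      have e: "e = view M (?c t)" by (rule view[OF H(1,3) pr])
      have eq: "int (S + nat (1 - snd (view_act M e i))) - (int S + 1) = - snd (view_act M e i)"
        using view_act_bounds[of M e i] by simp
      show ?thesis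
        using A[of i "fst (view_act M e i)" "t + 1" "S + nat (1 - snd (view_act M e i))",
            unfolded eq] H
          view_act_less_G[OF H(1,2)] view_index(1)[OF S, of e i] step[OF H(2),
              of t "- snd (view_act M e i)"]
        unfolding e[symmetric] by simp
    qed
    then show "fulfils A (inst x t 0 (write_lits e i))"
      unfolding view_lits_fulfils by simp
  next
    fix e i s t j assume H: "valid_view M e" "i < K" "s < symbols M" "t < T" "j < S"
    let ?h = "S + j + nat (2 - snd (view_act M e i))"
    have "A (cell_code i s (t + 1) ?h)"
      if pr: "\<forall>k \<le> K. A (cell_code k (e ! k) t (S + 1))" and c: "A (cell_code i s t (S + 2 + j))"
    proof -
      have e: "e = view M (?c t)" by (rule view[OF H(1,4) pr])
      have eq: "int ?h - (int S + 1) = int j + 1 - snd (view_act M e i)"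
        using view_act_bounds[of M e i] by simp
      have "rel (?c t) i (int j + 1) = s"
        using c A[of i s t "S + 2 + j"] H sym(1)[OF H(3)] by (simp add: algebra_simps)
      then show ?thesis
        using A[of i s "t + 1" ?h, unfolded eq] H sym(1)[OF H(3)] view_index(2)[OF H(5), of e i]
          step[of i t "int j + 1 - snd (view_act M e i)"]
        unfolding e[symmetric] by simp
    qed
    then show "fulfils A (inst x t j (right_lits e i s))"
      unfolding view_lits_fulfils by (auto simp: algebra_simps)
  next
    fix e i s t j assume H: "valid_view M e" "i < K" "s < symbols M" "t < T" "j < S"
    let ?h = "S + nat (1 - snd (view_act M e i)) - (j + 1)"
    have "A (cell_code i s (t + 1) ?h)"
      if pr: "\<forall>k \<le> K. A (cell_code k (e ! k) t (S + 1))" and c: "A (cell_code i s t (S - j))"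
    proof -
      have e: "e = view M (?c t)" by (rule view[OF H(1,4) pr])
      have eq: "int ?h - (int S + 1) = - int j - 1 - snd (view_act M e i)"
        using view_act_bounds[of M e i] H(5) by (simp add: of_nat_diff)
      have "rel (?c t) i (- int j - 1) = s"
      proof -
        have "int (S - j) - (int S + 1) = - int j - 1" using H(5) by (simp add: of_nat_diff)
        with A[of i s t "S - j", unfolded this] c H sym(1)[OF H(3)] show ?thesis by simp
      qed
      then show ?thesis
        using A[of i s "t + 1" ?h, unfolded eq] H sym(1)[OF H(3)] view_index(3)[OF H(5), of e i]
          step[of i t "- int j - 1 - snd (view_act M e i)"]
        unfolding e[symmetric] by simp
    qed
    then show "fulfils A (inst x t j (left_lits e i s))"
      unfolding view_lits_fulfils by auto
  next
    fix i j :: nat assume "1 \<le> i" "i < K" "j < 2 * S + 1"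
    then show "fulfils A [(True, cell_code i 0 0 (j + 1))]" using init'[of i "j + 1"] by simp
  next
    show "fulfils A [(True, cell_code K 0 0 (S + 1))]" using init'[of K "S + 1"] K by simp
  next
    fix j assume "j < S"
    then show "fulfils A [(True, cell_code 0 0 0 (S - j))]"
      using init[of 0 "S - j"] sym by (simp add: string_contents_def of_nat_diff)
  next
    fix j assume j: "j < length x"
    have eq: "int (S + 1 + 2 * j) - (int S + 1) = int (2 * j)"
        "int (S + 1 + 2 * j + 1) - (int S + 1) = int (2 * j + 1)" by simp_all
    have lt: "S + 1 + 2 * j < W" "S + 1 + 2 * j + 1 < W" using j T by auto
    show "fulfils A [(True, cell_code 0 2 0 (S + 1 + 2 * j))]"
      using init[OF sym(5) lt(1)] string_contents_encode_pair(1)[OF j, of y] unfolding eq by simp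
    show "fulfils A [(True, cell_code 0 (string_contents x (int j)) 0 (S + 1 + 2 * j + 1))]"
      using init[OF sym(2) lt(2)] string_contents_encode_pair(2)[OF j, of y] unfolding eq by simp
  next
    have eq: "int (S + 1 + 2 * length x) - (int S + 1) = int (2 * length x)" by simp
    have lt: "S + 1 + 2 * length x < W" using T by auto
    show "fulfils A [(True, cell_code 0 1 0 (S + 1 + 2 * length x))]"
      using init[OF sym(4) lt] string_contents_encode_pair(3)[of x y] unfolding eq by simp
  next
    fix j assume j: "j < S - (2 * length x + P)"
    have eq: "int (S + 1 + 2 * length x + 1 + P + j) - (int S + 1) =
        int (2 * length x + 1 + (P + j))" by simp
    have lt: "S + 1 + 2 * length x + 1 + P + j < W" using T j by auto
    have "string_contents y (int (P + j)) = 0" using y by (simp add: string_contents_def)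
    then show "fulfils A [(True, cell_code 0 0 0 (S + 1 + 2 * length x + 1 + P + j))]"
      using init[OF sym(3) lt] string_contents_encode_pair(4)[of x y "P + j"] unfolding eq by simp
  next
    fix j assume j: "j < P"
    have eq: "int (S + 1 + 2 * length x + 1 + j) - (int S + 1) = int (2 * length x + 1 + j)"
      "int (S + 1 + 2 * length x + 2 + j) - (int S + 1) = int (2 * length x + 1 + (j + 1))"
          by simp_all
    have lt: "S + 1 + 2 * length x + 1 + j < W" "S + 1 + 2 * length x + 2 + j < W" using T j by auto
    have i1: "A (cell_code 0 s 0 (S + 1 + 2 * length x + 1 + j)) \<longleftrightarrow> string_contents y (int j) = s"
        if "s < G" for s
      using init[OF that lt(1)] string_contents_encode_pair(4)[of x y j] unfolding eq by simp
    have i2: "A (cell_code 0 0 0 (S + 1 + 2 * length x + 2 + j)) \<longleftrightarrow> string_contents y (int (j + 1))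
        = 0"
      using init[OF sym(3) lt(2)] string_contents_encode_pair(4)[of x y "j + 1"] unfolding eq
          by simp
    have "string_contents y (int j) \<in> {0, 1, 2}" by (simp add: string_contents_def)
    then show "fulfils A (map (\<lambda>s. (True, cell_code 0 s 0 (S + 1 + 2 * length x + 1 + j))) [0, 1,
        2])"
      unfolding list.map fulfils_simps i1[OF sym(3)] i1[OF sym(4)] i1[OF sym(5)] by auto
    have "string_contents y (int j) = 0 \<Longrightarrow> string_contents y (int (j + 1)) = 0"
      by (auto simp: string_contents_def split: if_splits)
    then show "fulfils A [(False, cell_code 0 0 0 (S + 1 + 2 * length x + 1 + j)),
        (True, cell_code 0 0 0 (S + 1 + 2 * length x + 2 + j))]"
      unfolding fulfils_simps i1[OF sym(3)] i2 by blast
  next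
    fix j assume j: "j < 2 * T + 1"
    have eq: "int (j + (T + 2)) - (int S + 1) = int j - int T" by simp
    have lt: "j + (T + 2) < W" using j by auto
    have "\<not> A (cell_code 1 1 T (j + (T + 2)))"
      using A[OF K(3) sym(4) order_refl lt] acc[of "int j - int T"] j unfolding eq by simp
    then show "fulfils A [(False, cell_code 1 1 T (j + (T + 2)))]" by simp
  qed
  then show ?thesis by blast
qed

end

end

text \<open>The order of quantifiers is the point: the families and the variable bound depend on
  \<open>L\<close> only, so that one program can print the network for every
  \<open>x\<close>.\<close>

theorem cook_levin:
  assumes "in_NP L"
  shows "\<exists>fams NV. (\<forall>fam \<in> set fams. family_ok fam) \<and> exp_vars NV = {} \<and>
    (\<forall>x. (\<forall>C \<in> set (clauses x fams). \<forall>(s, v) \<in> set C. v < ceval x NV) \<and>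
      (x \<in> L \<longleftrightarrow> satisfiable (clauses x fams)))"
proof -
  obtain R p where R: "polytime (\<lambda>z. [R z])"
    and L: "\<And>x. x \<in> L \<longleftrightarrow> (\<exists>y. length y \<le> poly p (length x) \<and> R (encode_pair x y))"
    using assms unfolding in_NP_def by blast
  obtain M pM where M: "wf_tm M" and run: "\<And>z. \<exists>n \<le> poly pM (length z).
      halts_with_output M ((tm_step M ^^ n) (initial_config M z)) [R z]"
    using R unfolding polytime_def by blast
  obtain PE where PE: "exp_vars PE = {}" "\<forall>x \<rho>. eval x \<rho> PE = poly p (length x)"
    using ex_poly_exp by blast
  \<comment> \<open>The composed polynomial bounds the verifier's time on pairs, whose length is at
    most \<open>2 * length x + 1\<close> plus the certificate bound. The other summands make the
    whole input fit, as \<open>T_large\<close> demands.\<close>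
  obtain TE where TE: "exp_vars TE = {}"
    "\<forall>x \<rho>. eval x \<rho> TE = poly (pcompose pM ([:1, 2:] + p) + p + [:1, 2:]) (length x)"
    using ex_poly_exp by blast
  interpret tableau M TE PE
    by unfold_locales (use M PE TE in auto)
  have T: "T x = poly (pcompose pM ([:1, 2:] + p) + p + [:1, 2:]) (length x)" for x
    unfolding T_def by (rule TE(2)[rule_format])
  have accept: "(\<forall>h. \<bar>h\<bar> \<le> int (T x) \<longrightarrow> rel (run_config M (encode_pair x y) (T x)) 1 h \<noteq> 1) \<longleftrightarrow>
      R (encode_pair x y)"
    if y: "length y \<le> poly p (length x)" for x y
  proof -
    let ?z = "encode_pair x y"
    let ?p = "snd (snd (run_config M ?z (T x)) ! 1)"
    obtain n where n: "n \<le> poly pM (length ?z)"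
        "halts_with_output M ((tm_step M ^^ n) (initial_config M ?z)) [R ?z]"
      using run by blast
    have "poly pM (length ?z) \<le> poly pM (2 * length x + 1 + poly p (length x))"
      using y by (intro poly_mono_nat) (simp add: length_encode_pair)
    also have "2 * length x + 1 + poly p (length x) = poly ([:1, 2:] + p) (length x)" by simp
    also have "poly pM \<dots> \<le> T x" unfolding T poly_add poly_pcompose by simp
    finally have "n \<le> T x" using n(1) by simp
    then have out: "rel (run_config M ?z (T x)) 1 h = string_contents [R ?z] (?p + h)" for h
      using run_output[OF M n(2)] by blast
    have head: "\<bar>?p\<bar> \<le> int (T x)" using run_config_head[OF M, of 1] M by (simp add: wf_tm_def)
    show ?thesis
    proof (cases "R ?z")
      case True
      then show ?thesis unfolding out by (simp add: string_contents_def)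
    next
      case False
      \<comment> \<open>Offset \<open>- ?p\<close> from the head is the absolute cell 0, which holds
        the single output bit.\<close>
      have "rel (run_config M ?z (T x)) 1 (- ?p) = 1" unfolding out using False by
          (simp add: string_contents_def)
      moreover have "\<bar>- ?p\<bar> \<le> int (T x)" using head by simp
      ultimately show ?thesis using False by blast
    qed
  qed
  have P: "P x = poly p (length x)" for x unfolding P_def by (rule PE(2)[rule_format])
  have "x \<in> L \<longleftrightarrow> satisfiable (clauses x fams)" for x
  proof
    assume "x \<in> L"
    then obtain y where "length y \<le> poly p (length x)" "R (encode_pair x y)" using L by blast
    then show "satisfiable (clauses x fams)"
      unfolding satisfiable_clauses using tableau_complete[of y x] accept[of y x] P by simp
  next
    assume "satisfiable (clauses x fams)"
    then obtain A where "family_lits x fams (fulfils A)" unfolding satisfiable_clauses by blast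
    from tableau_sound[OF this] show "x \<in> L" unfolding L P using accept by blast
  qed
  moreover have "\<forall>C \<in> set (clauses x fams). \<forall>(s, v) \<in> set C. v < ceval x NV" for x
    unfolding ball_clauses by (rule vars_bounded)
  ultimately show ?thesis by (intro exI[of _ fams] exI[of _ NV] conjI allI fams_ok NV_closed)
qed

section \<open>Programs for the network\<close>

text \<open>The last number is the denominator of the integral weight.\<close>

definition arc_bits :: "nat \<Rightarrow> nat \<Rightarrow> nat \<Rightarrow> bool list" where
  "arc_bits u v w = True # encode_nat u @ encode_nat v @ encode_nat w @ encode_nat 1"

fun edge_bits :: "nat \<times> nat \<times> nat \<Rightarrow> bool list" where
  "edge_bits (u, v, w) = arc_bits u v w @ arc_bits v u w"

lemma encode_rat_of_nat: "encode_rat (of_nat w) = encode_nat w @ encode_nat 1"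
proof -
  have "rat_of_nat w = Rat.of_int (int w)" by (simp add: Rat.of_int_def)
  then have "quotient_of (of_nat w) = (int w, 1)" by (simp add: quotient_of_int)
  then show ?thesis by (simp add: encode_rat_def)
qed

lemma encode_bidirect:
  "encode_list (\<lambda>(u, v, w). encode_nat u @ encode_nat v @ encode_rat w) (bidirect U) =
    concat (map edge_bits U) @ [False]"
proof -
  have "concat (map (\<lambda>x. True # (\<lambda>(u, v, w). encode_nat u @ encode_nat v @ encode_rat w) x)
      (bidirect U)) =
      concat (map edge_bits U)"
    by (induction U) (auto simp: bidirect_def arc_bits_def encode_rat_of_nat)
  then show ?thesis by (simp add: encode_list_def)
qed

definition trip_bits :: "nat list \<Rightarrow> bool list" where
  "trip_bits T = True # concat (map (\<lambda>i. True # encode_nat i) T) @ [False]"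

lemma encode_trips: "encode_list (encode_list encode_nat) Ts = concat (map trip_bits Ts) @ [False]"
  unfolding encode_list_def trip_bits_def[abs_def] by simp

text \<open>Trips of equal length have offsets in arithmetic progression, which a loop can
  compute.\<close>

lemma trips_from_replicate:
  "trips_from s (replicate k l @ ls) =
    concat (map (\<lambda>i. [forward_trip (s + i * l) l, backward_trip (s + i * l) l]) [0..<k]) @
        trips_from (s + k * l) ls"
proof (induction k arbitrary: ls)
  case (Suc k)
  have "replicate (Suc k) l @ ls = replicate k l @ (l # ls)" by (simp add: replicate_append_same)
  then show ?case using Suc[of "l # ls"] by (simp add: ac_simps)
qed simp

primrec seqs :: "prog list \<Rightarrow> prog" where
  "seqs [] = Nop"
| "seqs (p # ps) = Seq p (seqs ps)"

lemma emitted_seqs: "emitted x (seqs ps) d \<rho> = concat (map (\<lambda>p. emitted x p d \<rho>) ps)"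
  by (induction ps) auto

lemma prog_below_seqs: "prog_below d (seqs ps) \<longleftrightarrow> (\<forall>p \<in> set ps. prog_below d p)"
  by (induction ps) auto

definition arc_prog :: "exp \<Rightarrow> exp \<Rightarrow> nat \<Rightarrow> prog" where
  "arc_prog u v w = Seq (Emit True) (Seq (EmitNat u)
      (Seq (EmitNat v) (Seq (EmitNat (Const w)) (EmitNat (Const 1)))))"

definition edge_prog :: "exp \<Rightarrow> exp \<Rightarrow> nat \<Rightarrow> prog" where
  "edge_prog u v w = Seq (arc_prog u v w) (arc_prog v u w)"

lemma emitted_edge_prog [simp]: "emitted x (edge_prog u v w) d \<rho> =
    edge_bits (eval x \<rho> u, eval x \<rho> v, w)"
  by (simp add: edge_prog_def arc_prog_def arc_bits_def)

lemma prog_below_edge_prog [simp]: "prog_below d (edge_prog u v w) \<longleftrightarrow> exp_below d u \<and> exp_below d v"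
  by (auto simp: edge_prog_def arc_prog_def)

definition trips_prog :: "exp \<Rightarrow> exp \<Rightarrow> exp \<Rightarrow> prog" where
  "trips_prog s k l = For k (seqs [
     Emit True, For l (Seq (Emit True) (EmitNat
         (Mul (Const 2) (Add (Add s (Mul (Var 0) l)) (Var 2))))), Emit False,
     Emit True, For l (Seq (Emit True) (EmitNat (Add (Mul (Const 2)
       (Add (Add s (Mul (Var 0) l)) (Sub l (Add (Var 2) (Const 1))))) (Const 1)))), Emit False])"

lemma ceval_closed: "exp_vars e = {} \<Longrightarrow> eval x \<rho> e = ceval x e"
  by (rule eval_vars_cong) simp

text \<open>The remaining lengths \<open>ls\<close> are carried along so that the three groups of
  routes can be chained, each starting at the arc offset where the previous one ends.\<close>

lemma emitted_trips_prog:
  assumes "exp_vars s = {}" "exp_vars k = {}" "exp_vars l = {}"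
  shows "emitted x (trips_prog s k l) 0 \<rho> @ concat
      (map trip_bits (trips_from (ceval x s + ceval x k * ceval x l) ls)) =
    concat (map trip_bits (trips_from (ceval x s) (replicate (ceval x k) (ceval x l) @ ls)))"
proof -
  define S K L where "S = ceval x s" "K = ceval x k" "L = ceval x l"
  then have v: "eval x \<rho> s = S" "eval x \<rho> k = K" "eval x \<rho> l = L" for \<rho>
    by (simp_all only: ceval_closed[OF assms(1), of x \<rho>] ceval_closed[OF assms(2), of x \<rho>]
        ceval_closed[OF assms(3), of x \<rho>])
  have "emitted x (trips_prog s k l) 0 \<rho> =
    concat (map (\<lambda>i. trip_bits (forward_trip (S + i * L) L) @
        trip_bits (backward_trip (S + i * L) L)) [0..<K])"
    unfolding trips_prog_def trip_bits_def forward_trip_def backward_trip_def seqs.simps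
        emitted.simps
      eval.simps v map_map comp_def
    by (simp add: numeral_2_eq_2)
  moreover have "concat (map trip_bits (concat (map (\<lambda>i. [g i, h i]) is))) =
      concat (map (\<lambda>i. trip_bits (g i) @ trip_bits (h i)) is)" for g h and "is" :: "nat list"
    by (induction "is") auto
  ultimately show ?thesis unfolding trips_from_replicate v by simp
qed

lemma prog_below_trips_prog:
  "exp_vars s = {} \<Longrightarrow> exp_vars k = {} \<Longrightarrow> exp_vars l = {} \<Longrightarrow> prog_below 0 (trips_prog s k l)"
  by (simp add: trips_prog_def exp_below_vars)

definition lit_edge :: "nat \<Rightarrow> nat \<Rightarrow> nat \<Rightarrow> bool \<times> nat \<Rightarrow> nat \<times> nat \<times> nat" where
  "lit_edge m L c l = (node_code m L (Nd c L), node_code m L (literal_node l), 2)"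

text \<open>The running clause number is a parameter because each family continues the numbering of
  the previous ones.\<close>

primrec lit_edges :: "nat \<Rightarrow> nat \<Rightarrow> nat \<Rightarrow> (bool \<times> nat) list list \<Rightarrow> (nat \<times> nat \<times> nat) list" where
  "lit_edges m L c [] = []"
| "lit_edges m L c (C # Cs) = map (lit_edge m L c) C @ lit_edges m L (Suc c) Cs"

lemma lit_edges_append: "lit_edges m L c (Cs @ Ds) = lit_edges m L c Cs @
    lit_edges m L (c + length Cs) Ds"
  by (induction Cs arbitrary: c) auto

lemma lit_edges_rows:
  "lit_edges m L c (map C [0..<n]) = concat (map (\<lambda>j. map (lit_edge m L (c + j)) (C j)) [0..<n])"
  by (induction n) (simp_all add: lit_edges_append)

lemma lit_edges_nth:
  "lit_edges m L c Cs = concat (map (\<lambda>i. map (lit_edge m L (c + i)) (Cs ! i)) [0..<length Cs])"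
  using lit_edges_rows[of m L c "(!) Cs" "length Cs"] by (simp add: map_nth)

lemma concat_map_concat_map: "concat (map g (concat (map f xs))) =
    concat (map (\<lambda>x. concat (map g (f x))) xs)"
  by (induction xs) auto

lemma lit_edges_blocks:
  assumes "\<And>i. length (F i) = k"
  shows "lit_edges m L c (concat (map F [0..<n])) =
      concat (map (\<lambda>i. lit_edges m L (c + i * k) (F i)) [0..<n])"
proof (induction n)
  case (Suc n)
  have "length (concat (map F [0..<n])) = n * k" using assms by (induction n) auto
  then show ?case using Suc by (simp add: lit_edges_append)
qed simp

lemma length_family_clauses: "length (family_clauses x (b1, b2, lits)) = ceval x b1 * ceval x b2"
proof -
  have "length (concat (map (\<lambda>i. map (g i) [0..<k]) [0..<n])) = n * k" for n k :: nat and g ::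
      "nat \<Rightarrow> nat \<Rightarrow> 'z"
    by (induction n) auto
  then show ?thesis by simp
qed

lemma concat_map_concat: "concat (map (\<lambda>i. concat (g i)) is) = concat (concat (map g is))"
  by (induction "is") auto

section \<open>The program that writes down the instance\<close>

locale reduction =
  fixes fams :: "family list" and NV :: exp
  assumes fams_ok: "\<forall>fam \<in> set fams. family_ok fam" and NV_closed: "exp_vars NV = {}"
begin

primrec clause_count :: "family list \<Rightarrow> exp" where
  "clause_count [] = Const 0"
| "clause_count (f # fs) = (case f of (b1, b2, lits) \<Rightarrow> Add (Mul b1 b2) (clause_count fs))"

primrec literal_count :: "family list \<Rightarrow> exp" where
  "literal_count [] = Const 0"
| "literal_count (f # fs) = (case f of (b1, b2, lits) \<Rightarrow> Add
    (Mul (Mul b1 b2) (Const (length lits))) (literal_count fs))"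

definition "ME = clause_count fams"
text \<open>The nodes outside the blocks: two ports per trip, two hubs and four nodes per gadget.
  Their number does not involve \<open>L\<close>, which can therefore be chosen afterwards.\<close>

definition "light_nodes = Add (Add (Mul (Const 2) (Add ME (Const 1))) (Const 2)) (Mul (Const 4) NV)"
text \<open>Large enough for \<open>L * L\<close> to exceed the number of pairs with a node outside the blocks.\<close>

definition "LE = Add (Mul light_nodes (Add (Mul (Const 4) (Add ME (Const 1))) (Const 1))) (Const 1)"
definition "trip_size = Add (Mul (Const 2) LE) (Const 2)"
definition "hub0 = Mul (Add ME (Const 1)) trip_size"
definition "hub1 = Add hub0 (Const 1)"
definition "gadgets = Add hub0 (Const 2)"
definition "NE = Add gadgets (Mul (Const 4) NV)"
definition "light_count = Add (Add ME (Const 1)) (Add (Mul (Const 2) NV) (literal_count fams))"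

text \<open>The parameter \<open>d\<close> is the loop depth of the call, 2 inside the loop over the
  clauses and 0 for the last trip; the inner counters are then \<open>Var d\<close>.\<close>

definition block_prog :: "nat \<Rightarrow> exp \<Rightarrow> exp \<Rightarrow> prog" where
  "block_prog d c h = (let b = Mul c trip_size in seqs [
     For LE (edge_prog (Add b (Var d)) (Add (Add b (Var d)) (Const 1)) 1),
     edge_prog (Add b LE) h 2,
     edge_prog h (Add b (Add LE (Const 1))) 2,
     For LE (edge_prog (Add b (Add (Add LE (Const 1)) (Var d)))
         (Add b (Add (Add LE (Const 2)) (Var d))) 1)])"

definition gadget_prog :: prog where
  "gadget_prog = (let b = Add gadgets (Mul (Const 4) (Var 0)) in seqs [
     edge_prog b (Add b (Const 1)) 1, edge_prog (Add b (Const 1)) (Add b (Const 2)) 2,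
     edge_prog (Add b (Const 2)) (Add b (Const 3)) 1])"

definition sink :: exp where
  "sink = Add (Mul ME trip_size) (Add LE (Const 1))"

definition literal_prog :: "exp \<Rightarrow> bool \<times> exp \<Rightarrow> prog" where
  "literal_prog c l = (case l of (s, e) \<Rightarrow> edge_prog (Add (Mul c trip_size) LE)
     (Add (Add gadgets (Mul (Const 4) e)) (Const (if s then 0 else 2))) 2)"

primrec literals_prog :: "exp \<Rightarrow> family list \<Rightarrow> prog" where
  "literals_prog c [] = Nop"
| "literals_prog c (f # fs) = (case f of (b1, b2, lits) \<Rightarrow>
     Seq (For b1 (For b2 (seqs (map (literal_prog (Add c (Add (Mul (Var 0) b2) (Var 2)))) lits))))
       (literals_prog (Add c (Mul b1 b2)) fs))"

text \<open>The order has to be that of \<open>sat_routes\<close> and \<open>lights\<close>, since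
  trips refer to arcs by their position in the list.\<close>

definition edges_prog :: prog where
  "edges_prog = seqs [
     For ME (block_prog 2 (Var 0) hub0), block_prog 0 ME hub1,
     For NV gadget_prog,
     For ME (edge_prog (Add (Mul (Var 0) trip_size) (Add LE (Const 1))) hub1 2),
     edge_prog (Add (Mul ME trip_size) LE) hub0 2,
     For NV (edge_prog (Add (Add gadgets (Mul (Const 4) (Var 0))) (Const 1)) sink 1),
     For NV (edge_prog (Add (Add gadgets (Mul (Const 4) (Var 0))) (Const 3)) sink 1),
     literals_prog (Const 0) fams]"

definition all_trips_prog :: prog where
  "all_trips_prog = seqs [
     trips_prog (Const 0) (Add ME (Const 1)) trip_size,
     trips_prog hub0 NV (Const 3),
     trips_prog (Add hub0 (Mul NV (Const 3))) light_count (Const 1)]"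

definition main_prog :: prog where
  "main_prog = seqs [EmitNat NE, edges_prog, Emit False, all_trips_prog, Emit False,
     EmitNat (Add (Sub (Mul NE NE) (Mul LE LE)) (Const 1))]"

lemma vars_clause_count: "\<forall>fam \<in> set fs. family_ok fam \<Longrightarrow> exp_vars (clause_count fs) = {}"
  by (induction fs) (auto split: prod.splits)

lemma vars_literal_count: "\<forall>fam \<in> set fs. family_ok fam \<Longrightarrow> exp_vars (literal_count fs) = {}"
  by (induction fs) (auto split: prod.splits)

lemma closed [simp]:
  "exp_vars ME = {}" "exp_vars light_nodes = {}" "exp_vars LE = {}" "exp_vars trip_size = {}"
      "exp_vars hub0 = {}"
  "exp_vars hub1 = {}" "exp_vars gadgets = {}" "exp_vars NE = {}" "exp_vars light_count = {}"
      "exp_vars sink = {}"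
  "exp_vars NV = {}"
  by (simp_all add: ME_def light_nodes_def LE_def trip_size_def hub0_def hub1_def gadgets_def
      NE_def light_count_def
      sink_def NV_closed vars_clause_count[OF fams_ok] vars_literal_count[OF fams_ok])

lemma literals_prog_below:
  "\<forall>fam \<in> set fs. family_ok fam \<Longrightarrow> exp_vars c = {} \<Longrightarrow> prog_below 0 (literals_prog c fs)"
proof (induction fs arbitrary: c)
  case (Cons f fs)
  obtain b1 b2 lits where f: "f = (b1, b2, lits)" by (metis surj_pair)
  have "exp_vars e \<subseteq> {0, 2}" if "(s, e) \<in> set lits" for s e using Cons.prems(1) that by
      (auto simp: f)
  then have "prog_below (Suc (Suc (Suc (Suc 0))))
      (literal_prog (Add c (Add (Mul (Var 0) b2) (Var 2))) l)" if "l \<in> set lits" for l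
    using that Cons.prems by (cases l) (fastforce simp: literal_prog_def exp_below_vars f)
  moreover have "prog_below 0 (literals_prog (Add c (Mul b1 b2)) fs)"
    using Cons.prems by (intro Cons.IH) (auto simp: f)
  ultimately show ?case using Cons.prems by (auto simp: f prog_below_seqs exp_below_vars)
qed simp

lemma main_prog_below: "prog_below 0 main_prog"
proof -
  have "prog_below (Suc (Suc 0)) (block_prog 2 (Var 0) hub0)" "prog_below 0 (block_prog 0 ME hub1)"
    "prog_below (Suc (Suc 0)) gadget_prog"
    by (auto simp: block_prog_def gadget_prog_def Let_def exp_below_vars)
  moreover have "prog_below 0 (literals_prog (Const 0) fams)" by
      (rule literals_prog_below[OF fams_ok]) simp
  ultimately show ?thesis
    by (auto simp: main_prog_def edges_prog_def all_trips_prog_def exp_below_vars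
        prog_below_trips_prog)
qed

section \<open>Correctness of the written instance\<close>

context
  fixes x :: "bool list"
begin

abbreviation "cls \<equiv> clauses x fams"
definition "m = length cls"
definition "nv = ceval x NV"
definition "L = (2 * (m + 1) + 2 + 4 * nv) * (4 * (m + 1) + 1) + 1"

lemma eval_clause_count: "ceval x (clause_count fs) = length (clauses x fs)"
proof (induction fs)
  case (Cons f fs)
  obtain b1 b2 lits where f: "f = (b1, b2, lits)" by (metis surj_pair)
  show ?case using Cons length_family_clauses[of x b1 b2 lits] by
      (simp add: f clauses_def del: family_clauses.simps)
qed (simp add: clauses_def)

lemma eval_literal_count: "ceval x (literal_count fs) = length (lit_edges m' L' c (clauses x fs))"
proof (induction fs arbitrary: c)
  case (Cons f fs)
  obtain b1 b2 lits where f: "f = (b1, b2, lits)" by (metis surj_pair)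
  have len: "length (lit_edges m' L' c (concat (map (\<lambda>i. map (g i) [0..<k]) [0..<n]))) =
      n * k * length lits"
    if "\<And>i j. length (g i j) = length lits" for n k :: nat and g ::
        "nat \<Rightarrow> nat \<Rightarrow> (bool \<times> nat) list" and c
  proof -
    have row: "length (lit_edges m' L' c (map (g i) [0..<k])) = k * length lits" for i c
      unfolding lit_edges_rows using that by (induction k) auto
    show ?thesis
      by (subst lit_edges_blocks[where k = k], simp) (induction n, auto simp: row algebra_simps)
  qed
  show ?case using Cons[of "c + ceval x b1 * ceval x b2"] length_family_clauses[of x b1 b2 lits]
    by (simp add: f clauses_def lit_edges_append len)
qed (simp add: clauses_def)

lemma evals [simp]:
  "eval x \<rho> ME = m" "eval x \<rho> NV = nv" "eval x \<rho> LE = L" "eval x \<rho> trip_size = 2 * L + 2"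
  "eval x \<rho> hub0 = (m + 1) * (2 * L + 2)" "eval x \<rho> hub1 = (m + 1) * (2 * L + 2) + 1"
  "eval x \<rho> gadgets = (m + 1) * (2 * L + 2) + 2" "eval x \<rho> NE = node_count m nv L"
  "eval x \<rho> sink = m * (2 * L + 2) + (L + 1)"
proof -
  show M: "eval x \<rho> ME = m" for \<rho>
    using ceval_closed[OF closed(1), of x \<rho>] eval_clause_count[of fams] unfolding ME_def m_def by
        (rule trans)
  show N: "eval x \<rho> NV = nv" for \<rho> unfolding nv_def by (rule ceval_closed) simp
  show "eval x \<rho> LE = L" "eval x \<rho> trip_size = 2 * L + 2"
  "eval x \<rho> hub0 = (m + 1) * (2 * L + 2)" "eval x \<rho> hub1 = (m + 1) * (2 * L + 2) + 1"
  "eval x \<rho> gadgets = (m + 1) * (2 * L + 2) + 2" "eval x \<rho> NE = node_count m nv L"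
  "eval x \<rho> sink = m * (2 * L + 2) + (L + 1)"
    by (simp_all add: LE_def light_nodes_def trip_size_def hub0_def hub1_def gadgets_def NE_def
        sink_def
        L_def M N node_count_def)
qed

lemma trip_arcs:
  "route_arcs (node_code m L) (trip_route m L c) =
    map (\<lambda>i. (c * (2 * L + 2) + i, c * (2 * L + 2) + i + 1, 1)) [0..<L] @
    [(c * (2 * L + 2) + L, node_code m L (trip_hub m c), 2),
     (node_code m L (trip_hub m c), c * (2 * L + 2) + (L + 1), 2)] @
    map (\<lambda>i. (c * (2 * L + 2) + (L + 1 + i), c * (2 * L + 2) + (L + 2 + i), 1)) [0..<L]"
proof -
  have "[0..<2 * L + 2] = [0..<L] @ [L, L + 1] @ map (\<lambda>i. i + (L + 2)) [0..<L]"
  proof -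
    have "[0..<2 * L + 2] = [0..<L + (2 + L)]" by (simp add: mult_2 ac_simps)
    also have "\<dots> = [0..<L] @ [L..<L + (2 + L)]" by (rule upt_add_eq_append) simp
    also have "[L..<L + (2 + L)] = [L..<(L + 2) + L]" by (simp add: ac_simps)
    also have "\<dots> = [L..<L + 2] @ [L + 2..<(L + 2) + L]" by (rule upt_add_eq_append) simp
    also have "[L + 2..<(L + 2) + L] = map (\<lambda>i. i + (L + 2)) [0..<L]"
      by (subst map_add_upt) (simp add: ac_simps)
    also have "[L..<L + 2] = [L, L + 1]" by (simp add: upt_conv_Cons)
    finally show ?thesis by simp
  qed
  then show ?thesis
    unfolding route_arcs_def
    by (simp add: trip_route_def trip_pos_def trip_cum_def algebra_simps)
qed

lemma emitted_block_prog:
  assumes "exp_below d c" "\<And>\<rho>. eval x \<rho> h = node_code m L (trip_hub m (eval x \<rho>0 c))"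
  shows "emitted x (block_prog d c h) d \<rho>0 = concat
      (map edge_bits (route_arcs (node_code m L) (trip_route m L (eval x \<rho>0 c))))"
proof -
  have c: "eval x (\<rho>0(d := i, d + 1 := j)) c = eval x \<rho>0 c" for i j
    by (rule eval_cong[OF assms(1)]) simp
  show ?thesis unfolding trip_arcs block_prog_def Let_def
    by (simp add: assms(2) c[simplified] comp_def ac_simps)
qed

lemma emitted_gadget_prog:
  "emitted x gadget_prog d \<rho> = concat (map edge_bits
      (route_arcs (node_code m L) (gadget_route (\<rho> 0))))"
proof -
  have "[0..<3] = [0, 1, 2::nat]" by (simp add: upt_rec)
  then have "route_arcs (node_code m L) (gadget_route v) =
      (let b = (m + 1) * (2 * L + 2) + 2 + 4 * v in
      [(b, b + 1, 1), (b + 1, b + 2, 2), (b + 2, b + 3, 1)])" for v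
    by (simp add: route_arcs_def gadget_route_def gadget_cum_def Let_def)
  then show ?thesis by (simp add: gadget_prog_def Let_def)
qed

lemma emitted_literal_prog:
  assumes "eval x \<rho> c = k"
  shows "emitted x (literal_prog c (s, e)) d \<rho> = edge_bits (lit_edge m L k (s, eval x \<rho> e))"
  using assms by (simp add: literal_prog_def lit_edge_def literal_node_def)

lemma emitted_literals_prog:
  assumes "\<forall>fam \<in> set fs. family_ok fam" "exp_vars c = {}"
  shows "emitted x (literals_prog c fs) 0 (\<lambda>_. 0) =
      concat (map edge_bits (lit_edges m L (ceval x c) (clauses x fs)))"
  using assms
proof (induction fs arbitrary: c)
  case Nil
  then show ?case by (simp add: clauses_def)
next
  case (Cons f fs)
  obtain b1 b2 lits where f: "f = (b1, b2, lits)" by (metis surj_pair)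
  define n1 n2 k where n: "n1 = ceval x b1" "n2 = ceval x b2" "k = ceval x c"
  have cl: "exp_vars b1 = {}" "exp_vars b2 = {}" "exp_vars c = {}" using Cons.prems by
      (auto simp: f)
  have ev: "eval x \<rho> b1 = n1" "eval x \<rho> b2 = n2" "eval x \<rho> c = k" for \<rho>
    unfolding n by (rule ceval_closed[OF cl(1)] ceval_closed[OF cl(2)] ceval_closed[OF cl(3)])+
  have body: "emitted x (seqs (map (literal_prog (Add c (Add (Mul (Var 0) b2) (Var 2)))) lits)) 4
      \<rho> =
      concat (map edge_bits (map (lit_edge m L (k + i * n2 + j))
          (map (\<lambda>(s, e). (s, eval x (loop_env i j) e)) lits)))"
    if "\<rho> 0 = i" "\<rho> 2 = j" for \<rho> i j
  proof -
    have "emitted x (literal_prog (Add c (Add (Mul (Var 0) b2) (Var 2))) l) 4 \<rho> =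
        edge_bits (lit_edge m L (k + i * n2 + j) ((\<lambda>(s, e). (s, eval x (loop_env i j) e)) l))" if
            l: "l \<in> set lits" for l
    proof -
      obtain s e where se: "l = (s, e)" by (metis surj_pair)
      then have "exp_vars e \<subseteq> {0, 2}" using Cons.prems(1) l by (auto simp: f)
      \<comment> \<open>The odd registers, where the two environments may differ, do not occur in
        \<open>e\<close>.\<close>
      then have "eval x \<rho> e = eval x (loop_env i j) e"
        using \<open>\<rho> 0 = i\<close> \<open>\<rho> 2 = j\<close> by (intro eval_vars_cong) auto
      then show ?thesis
        unfolding se by (subst emitted_literal_prog[where k = "k + i * n2 + j"])
            (simp_all add: ev \<open>\<rho> 0 = i\<close> \<open>\<rho> 2 = j\<close>)
    qed
    then show ?thesis unfolding emitted_seqs map_map comp_def by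
        (intro arg_cong[where f = concat] map_cong) simp_all
  qed
  let ?C = "\<lambda>i j. map (\<lambda>(s, e). (s, eval x (loop_env i j) e)) lits"
  have "emitted x (For b1 (For b2 (seqs (map (literal_prog (Add c (Add (Mul (Var 0) b2) (Var 2))))
      lits)))) 0 (\<lambda>_. 0) =
      concat (map (\<lambda>i. concat (map (\<lambda>j. concat
          (map edge_bits (map (lit_edge m L (k + i * n2 + j)) (?C i j)))) [0..<n2])) [0..<n1])"
    unfolding emitted.simps ev using body[simplified] by (simp add: numeral_2_eq_2 numeral_eq_Suc)
  also have "\<dots> = concat (map edge_bits (lit_edges m L k (family_clauses x f)))"
    unfolding f family_clauses.simps n[symmetric]
    by (subst lit_edges_blocks[where k = n2], simp) (simp add: lit_edges_rows map_concat comp_def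
        concat_map_concat)
  finally have 1: "emitted x (For b1 (For b2 (seqs
      (map (literal_prog (Add c (Add (Mul (Var 0) b2) (Var 2)))) lits)))) 0 (\<lambda>_. 0) =
      concat (map edge_bits (lit_edges m L k (family_clauses x f)))" .
  have "emitted x (literals_prog (Add c (Mul b1 b2)) fs) 0 (\<lambda>_. 0) =
      concat (map edge_bits (lit_edges m L (k + n1 * n2) (clauses x fs)))"
    using Cons.IH[of "Add c (Mul b1 b2)"] Cons.prems cl by (simp add: ev)
  with 1 show ?case using length_family_clauses[of x b1 b2 lits]
    by (simp add: clauses_def lit_edges_append f n del: emitted.simps(5) family_clauses.simps)
qed


lemma map_lights:
  "map (\<lambda>(a, b, w). (node_code m L a, node_code m L b, w)) (lights cls nv L) =
    map (\<lambda>c. (c * (2 * L + 2) + (L + 1), (m + 1) * (2 * L + 2) + 1, 2)) [0..<m] @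
    [(m * (2 * L + 2) + L, (m + 1) * (2 * L + 2), 2)] @
    map (\<lambda>v. ((m + 1) * (2 * L + 2) + 2 + 4 * v + 1, m * (2 * L + 2) + (L + 1), 1)) [0..<nv] @
    map (\<lambda>v. ((m + 1) * (2 * L + 2) + 2 + 4 * v + 3, m * (2 * L + 2) + (L + 1), 1)) [0..<nv] @
    lit_edges m L 0 cls"
  unfolding lights_def lit_edges_nth m_def[symmetric]
  by (simp add: map_concat comp_def lit_edge_def[abs_def])

lemma light_arcs:
  "concat (map (route_arcs g) (map light_route ls)) = map (\<lambda>(a, b, w). (g a, g b, w)) ls"
  by (induction ls) (auto simp: route_arcs_def)

lemma emitted_edges_prog:
  "emitted x edges_prog 0 (\<lambda>_. 0) =
    concat (map edge_bits (concat (map (route_arcs (node_code m L)) (sat_routes cls nv L))))"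
proof -
  let ?bits = "\<lambda>r. concat (map edge_bits (route_arcs (node_code m L) r))"
  have trips: "emitted x (For ME (block_prog 2 (Var 0) hub0)) 0 (\<lambda>_. 0) =
      concat (map (\<lambda>c. ?bits (trip_route m L c)) [0..<m])"
    unfolding emitted.simps evals
  proof (intro arg_cong[where f = concat] map_cong refl)
    fix i assume "i \<in> set [0..<m]"
    then show "emitted x (block_prog 2 (Var 0) hub0) (0 + 2) ((\<lambda>_. 0)(0 := i, 0 + 1 := m - Suc i))
        = ?bits (trip_route m L i)"
      using emitted_block_prog[of 2 "Var 0" hub0 "(\<lambda>_. 0)(0 := i, 0 + 1 := m - Suc i)"]
      by (simp add: trip_hub_def flip: numeral_2_eq_2)
  qed
  have last: "emitted x (block_prog 0 ME hub1) 0 (\<lambda>_. 0) = ?bits (trip_route m L m)"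
    using emitted_block_prog[of 0 ME hub1 "\<lambda>_. 0"] by (simp add: trip_hub_def exp_below_vars)
  have gadgets: "emitted x (For NV gadget_prog) 0 (\<lambda>_. 0) =
      concat (map (\<lambda>v. ?bits (gadget_route v)) [0..<nv])"
    by (simp add: emitted_gadget_prog)
  note lits = emitted_literals_prog[OF fams_ok, of "Const 0", simplified]
  show ?thesis
    unfolding sat_routes_def m_def[symmetric] map_append concat_append light_arcs map_lights
        concat_map_concat_map
    unfolding edges_prog_def seqs.simps emitted.simps(4) trips last gadgets lits
    by (simp add: comp_def concat_map_concat_map del: light_route.simps)
qed

lemma len_sat_routes:
  "map len (sat_routes cls nv L) =
    replicate (m + 1) (2 * L + 2) @ replicate nv 3 @ replicate (length (lights cls nv L)) 1"
proof -
  have "map (\<lambda>x. len (light_route x)) ls = replicate (length ls) 1" for ls by (induction ls) auto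
  then show ?thesis
    unfolding sat_routes_def m_def[symmetric]
    by (simp add: trip_route_def gadget_route_def comp_def map_replicate_const
        replicate_append_same)
qed

lemma eval_light_count: "eval x \<rho> light_count = length (lights cls nv L)"
proof -
  have "length (lights cls nv L) = m + 1 + (2 * nv + length (lit_edges m L 0 cls))"
    using arg_cong[OF map_lights, of length] by simp
  moreover have "eval x \<rho> (literal_count fams) = length (lit_edges m L 0 cls)"
    using ceval_closed[OF vars_literal_count[OF fams_ok], of x \<rho>]
        eval_literal_count[of fams m L 0] by (rule trans)
  ultimately show ?thesis by (simp add: light_count_def)
qed

lemma emitted_all_trips_prog:
  "emitted x all_trips_prog 0 (\<lambda>_. 0) = concat
      (map trip_bits (trips_from 0 (map len (sat_routes cls nv L))))"
proof -
  let ?n = "length (lights cls nv L)"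
  have 1: "emitted x (trips_prog (Const 0) (Add ME (Const 1)) trip_size) 0 (\<lambda>_. 0) @
      concat (map trip_bits (trips_from ((m + 1) * (2 * L + 2)) (replicate nv 3 @
          replicate ?n 1))) =
      concat (map trip_bits (trips_from 0 (replicate (m + 1) (2 * L + 2) @ replicate nv 3 @
          replicate ?n 1)))"
    using emitted_trips_prog[of "Const 0" "Add ME (Const 1)" trip_size x "\<lambda>_. 0" "replicate nv 3 @
        replicate ?n 1"]
    by (simp only: eval.simps evals exp_vars.simps closed Un_empty_left add_0)
  have 2: "emitted x (trips_prog hub0 NV (Const 3)) 0 (\<lambda>_. 0) @
      concat (map trip_bits (trips_from ((m + 1) * (2 * L + 2) + nv * 3) (replicate ?n 1))) =
      concat (map trip_bits (trips_from ((m + 1) * (2 * L + 2)) (replicate nv 3 @ replicate ?n 1)))"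
    using emitted_trips_prog[of hub0 NV "Const 3" x "\<lambda>_. 0" "replicate ?n 1"]
    by (simp only: eval.simps evals exp_vars.simps closed)
  have 3: "emitted x (trips_prog (Add hub0 (Mul NV (Const 3))) light_count (Const 1)) 0 (\<lambda>_. 0) =
      concat (map trip_bits (trips_from ((m + 1) * (2 * L + 2) + nv * 3) (replicate ?n 1)))"
    using emitted_trips_prog[of "Add hub0 (Mul NV (Const 3))" light_count "Const 1" x "\<lambda>_. 0" "[]"]
    by (simp only: eval.simps evals exp_vars.simps closed eval_light_count trips_from.simps
        list.map concat.simps append_Nil2 Un_empty_left)
  show ?thesis
    unfolding len_sat_routes 1[symmetric] 2[symmetric] 3[symmetric] all_trips_prog_def seqs.simps
        emitted.simps by simp
qed

lemma emitted_main_prog: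
  "emitted x main_prog 0 (\<lambda>_. 0) = encode_mrtt (sat_input cls nv L) (sat_bound m nv L)"
proof -
  have "eval x \<rho> (Add (Sub (Mul NE NE) (Mul LE LE)) (Const 1)) = sat_bound m nv L" for \<rho>
    by (simp add: sat_bound_def)
  then show ?thesis
    unfolding sat_input_def route_input_def m_def[symmetric] encode_mrtt.simps encode_bidirect
        encode_trips
      main_prog_def seqs.simps emitted.simps emitted_edges_prog emitted_all_trips_prog evals by simp
qed

lemma main_prog_correct:
  assumes "\<forall>C \<in> set cls. \<forall>(s, v) \<in> set C. v < ceval x NV"
  shows "emitted x main_prog 0 (\<lambda>_. 0) \<in> symmetric_strongly_connected_inputs"
    "emitted x main_prog 0 (\<lambda>_. 0) \<in> MRTT \<longleftrightarrow> satisfiable cls"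
proof -
  let ?N = "sat_input cls nv L" and ?k = "sat_bound m nv L"
  interpret sn: sat_network cls nv L
  proof
    show "0 < L" by (simp add: L_def)
    show "v < nv" if "C \<in> set cls" "(s, v) \<in> set C" for C s v
      using assms that unfolding nv_def by blast
  qed
  \<comment> \<open>With \<open>c = m + 1\<close> and \<open>n = 2 * c * L + N0\<close> the claim
    reduces to \<open>4 * c * L * N0 + N0 * N0 + 1 \<le> L * L\<close>. The choice of
    \<open>L\<close> gives \<open>L * L = 4 * c * L * N0 + N0 * L + L\<close>, and
    \<open>N0 < L\<close>.\<close>
  have big: "node_count m nv L * node_count m nv L + 1 \<le> L * L + ((m + 1) * (2 * L)) *
      ((m + 1) * (2 * L))"
  proof -
    define N0 where "N0 = 2 * (m + 1) + 2 + 4 * nv"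
    have n: "node_count m nv L = (m + 1) * (2 * L) + N0" by (simp add: node_count_def N0_def)
    have L: "L = N0 * (4 * (m + 1) + 1) + 1" by (simp add: L_def N0_def)
    define l c where "l = L" "c = m + 1"
    have l: "l = N0 * (4 * c + 1) + 1" using L by (simp add: l_c_def)
    then have "N0 * N0 + 1 \<le> N0 * l + l" by (intro add_mono mult_le_mono2) auto
    moreover have "l * l = (N0 * (4 * c + 1) + 1) * l" using l by simp
    then have "l * l = N0 * l * (4 * c) + (N0 * l + l)" by (simp add: algebra_simps)
    ultimately have "2 * (c * (2 * l)) * N0 + N0 * N0 + 1 \<le> l * l" by (simp add: algebra_simps)
    then have "(c * (2 * l) + N0) * (c * (2 * l) + N0) + 1 \<le> l * l + (c * (2 * l)) * (c * (2 * l))"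
      by (simp add: algebra_simps)
    then show ?thesis unfolding n l_c_def .
  qed
  note correct = sn.sat_input_correct[folded m_def, OF big]
  show "emitted x main_prog 0 (\<lambda>_. 0) \<in> symmetric_strongly_connected_inputs"
    unfolding emitted_main_prog symmetric_strongly_connected_inputs_def using correct(1-3) by blast
  \<comment> \<open>\<open>MRTT\<close> is a set of strings, so another valid instance with the same
    code has to be excluded; this is the injectivity of the encoding.\<close>
  have "encode_mrtt ?N ?k \<in> MRTT \<longleftrightarrow>
      (\<exists>\<tau>. ?k \<le> reachability (input_digraph ?N) (input_weight ?N) (input_trips ?N) \<tau>)"
  proof
    assume "encode_mrtt ?N ?k \<in> MRTT"
    then obtain N' k' where N': "encode_mrtt ?N ?k = encode_mrtt N' k'" "valid_input N'"
      "\<exists>\<tau>. k' \<le> reachability (input_digraph N') (input_weight N') (input_trips N') \<tau>"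
      unfolding MRTT_def by blast
    from encode_mrtt_inj[OF correct(1) N'(2,1)] N'(3)
    show "\<exists>\<tau>. ?k \<le> reachability (input_digraph ?N) (input_weight ?N) (input_trips ?N) \<tau>" by simp
  next
    assume "\<exists>\<tau>. ?k \<le> reachability (input_digraph ?N) (input_weight ?N) (input_trips ?N) \<tau>"
    then show "encode_mrtt ?N ?k \<in> MRTT" unfolding MRTT_def using correct(1) by blast
  qed
  then show "emitted x main_prog 0 (\<lambda>_. 0) \<in> MRTT \<longleftrightarrow> satisfiable cls"
    unfolding emitted_main_prog correct(4) .
qed

end

end

theorem theorem8:
  shows "NP_hard_on symmetric_strongly_connected_inputs MRTT"
  unfolding NP_hard_on_def
proof (intro allI impI)
  fix L assume "in_NP L"
  from cook_levin[OF this] obtain fams NV where CL: "(\<forall>fam \<in> set fams. family_ok fam) \<and>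
      exp_vars NV = {} \<and>
      (\<forall>x. (\<forall>C \<in> set (clauses x fams). \<forall>(s, v) \<in> set C. v < ceval x NV) \<and>
        (x \<in> L \<longleftrightarrow> satisfiable (clauses x fams)))"
    by (elim exE)
  then have fams: "\<forall>fam \<in> set fams. family_ok fam" "exp_vars NV = {}"
    and vars: "\<forall>C \<in> set (clauses x fams). \<forall>(s, v) \<in> set C. v < ceval x NV"
    and L: "x \<in> L \<longleftrightarrow> satisfiable (clauses x fams)" for x
    by auto
  interpret reduction fams NV by unfold_locales (rule fams)+
  show "\<exists>f. polytime f \<and> (\<forall>x. f x \<in> symmetric_strongly_connected_inputs \<and> (x \<in> L \<longleftrightarrow> f x \<in> MRTT))"
    using polytime_prog[OF main_prog_below] main_prog_correct[OF vars] L
    by (intro exI[of _ "\<lambda>x. emitted x main_prog 0 (\<lambda>_. 0)"]) simp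
qed

end
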